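(* Let $C\subset\mathbb{R}^n$ be a nonempty polyhedral convex set with $\operatorname{lin}C=\{0\}$, $q\in\mathbb{R}^n$, $M\in\mathbb{R}^{n\times n}$. Suppose that $M$ is semimonotone with respect to $\operatorname{rec}C$ and that for any solution $z\ne0$ of $$z\in\operatorname{rec}C,\quad Mz\in(\operatorname{rec}C)^D,\quad z^TMz=0,$$ it holds that $$z^T(Mz'+q)\ge0\quad\text{for all } z'\in C.$$ Then PathAVI solves the $\mathrm{AVI}(C,q,M)$ (in particular a solution exists).
   Context: $\mathrm{AVI}(C,q,M)$: find $z\in C$ with $\langle Mz+q,y-z\rangle\ge 0$ for all $y\in C$. $\operatorname{rec} C$ is the recession cone, $\operatorname{lin} C=\operatorname{rec}C\cap(-\operatorname{rec}C)$ the lineality space, and for a closed convex cone $K'$, $(K')^D=\{y:\langle y,k\rangle\ge0\ \forall k\in K'\}$. $M$ is semimonotone with respect to a closed convex cone $K'$ if for every $p\in\operatorname{ri}((K')^D)$ the solution set of $z\in K'$, $Mz+p\in(K')^D$, $z^T(Mz+p)=0$ is contained in $\operatorname{lin}K'$. PathAVI (when $\operatorname{lin}C=\{0\}$). Write $C=\{z\in\mathbb{R}^n: Az-b\in K,\ l\le z\le u\}$, with $A\in\mathbb{R}^{m\times n}$ having nonzero rows, $b\in\mathbb{R}^m$, $l_j,u_j\in\mathbb{R}\cup\{\pm\infty\}$, and $K$ a Cartesian product of copies of $\mathbb{R}_+,\{0\},\mathbb{R}_-$. Normal cone: $N_C(z)=\{y:\langle y,z'-z\rangle\le0\ \forall z'\in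 C\}$ for $z\in C$. $\pi_C$ is the Euclidean projection onto $C$. For a vector $r$, $G_C(x,t)=M\pi_C(x)+q+x-\pi_C(x)-tr$ on $\mathbb{R}^n\times\mathbb{R}_+$. For each nonempty face $F$ of $C$ let $N_F$ be the constant value of $N_C$ on $\operatorname{ri}F$ and $\sigma_F=F+N_F$; the sets $\sigma_F\times\mathbb{R}_+$ are the $(n+1)$-cells of the manifold $\mathcal{M}_C$; $G_C$ is affine on each. The method chooses an extreme point $\bar z$ of $C$ and a vector $r\in\operatorname{ri}(N_C(\bar z))$ (here $N_C(\bar z)$ is full-dimensional). For all large $t$ there is a point $x(t)$ with $\pi_C(x(t))=\bar z$ and $G_C(x(t),t)=0$ (the starting ray). Starting from this ray (with $t$ decreasing), it follows the piecewise linear path in $G_C^{-1}(0)$ by complementary pivoting on the system $Mz+q-A^T\lambda-w+v=tr$, $Az-b=s$, with $K\ni s\perp\lambda\in K^D$, $0\le z-l\perp w\ge0$, $0\le u-z\perp v\ge0$, $t\ge0$ (here $x=z-A^T\lambda-w+v$; components of $w$, $v$ attached to infinite bounds are absent): the variable $t$ is pivoted into a complementary basis at $\bar z$, and then repeatedly the complement of the variable that just left the basis enters, the leaving variable being chosen by the lexicographic ratio test. Each pivot traverses one $(n+1)$-cell and no cell is traversed twice. The method terminates either when $t=0$, in which case $z=\pi_C(x)$ solves the AVI ("PathAVI solves the AVI"), or when the path leaves along an unbounded ray other than the starting ray (a "secondary ray").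
   Formalization: The column order of the lexicographic ratio test, left open in the text, is fixed so that the multipliers (λ, w, v) in the initial basis precede the z and s variables; with the opposite order the method can return along the starting ray at a degenerate extreme point. *)

theory Defs
  imports "HOL-Analysis.Analysis"
begin

section \<open>Affine variational inequalities\<close>

definition recession_cone :: "(real^'n) set \<Rightarrow> (real^'n) set" where
  "recession_cone C = {d. \<forall>x\<in>C. \<forall>a\<ge>0. x + a *\<^sub>R d \<in> C}"

definition lineality_space :: "(real^'n) set \<Rightarrow> (real^'n) set" where
  "lineality_space C = recession_cone C \<inter> uminus ` recession_cone C"

definition dual_cone :: "(real^'n) set \<Rightarrow> (real^'n) set" where
  "dual_cone K = {y. \<forall>k\<in>K. 0 \<le> y \<bullet> k}"

definition normal_cone :: "(real^'n) set \<Rightarrow> real^'n \<Rightarrow> (real^'n) set" where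
  "normal_cone C z = {y. \<forall>z'\<in>C. y \<bullet> (z' - z) \<le> 0}"

definition avi_solution :: "(real^'n) set \<Rightarrow> real^'n \<Rightarrow> real^'n^'n \<Rightarrow> real^'n \<Rightarrow> bool" where
  "avi_solution C q M z \<longleftrightarrow> z \<in> C \<and> (\<forall>y\<in>C. 0 \<le> (M *v z + q) \<bullet> (y - z))"

definition semimonotone :: "real^'n^'n \<Rightarrow> (real^'n) set \<Rightarrow> bool" where
  "semimonotone M K \<longleftrightarrow>
     (\<forall>p \<in> rel_interior (dual_cone K).
        {z \<in> K. M *v z + p \<in> dual_cone K \<and> z \<bullet> (M *v z + p) = 0} \<subseteq> lineality_space K)"


section \<open>Representations of the feasible set\<close>

datatype factor = Nonneg | Zero | Nonpos

primrec factor_set :: "factor \<Rightarrow> real set" where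
  "factor_set Nonneg = {0..}"
| "factor_set Zero = {0}"
| "factor_set Nonpos = {..0}"

text \<open>Rows of \<open>A\<close> are indexed by \<open>i < m\<close>, so that \<open>m = 0\<close> (bounds only) is allowed;
  values of \<open>rowA\<close>, \<open>rhs\<close> and \<open>fac\<close> at \<open>i \<ge> m\<close> are irrelevant.\<close>

record 'n rep =
  nrows :: nat
  rowA :: "nat \<Rightarrow> real^'n"
  rhs :: "nat \<Rightarrow> real"
  fac :: "nat \<Rightarrow> factor"
  lbd :: "'n \<Rightarrow> ereal"
  ubd :: "'n \<Rightarrow> ereal"

definition feasible_set :: "'n::finite rep \<Rightarrow> (real^'n) set" where
  "feasible_set P =
     {z. (\<forall>i<nrows P. rowA P i \<bullet> z - rhs P i \<in> factor_set (fac P i)) \<and>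
         (\<forall>j. lbd P j \<le> ereal (z $ j) \<and> ereal (z $ j) \<le> ubd P j)}"

definition represents :: "'n::finite rep \<Rightarrow> (real^'n) set \<Rightarrow> bool" where
  "represents P C \<longleftrightarrow> (\<forall>i<nrows P. rowA P i \<noteq> 0) \<and> C = feasible_set P"


section \<open>The pivoting system\<close>

datatype 'n var = Zv 'n | Sv nat | Lv nat | Wv 'n | Vv 'n | Tv

text \<open>Bounds of the variables. A multiplier of an infinite bound and a row variable with index
  \<open>\<ge> m\<close> are absent from the system; they are fixed at 0 by the bounds. For a row variable
  \<open>Lv i\<close> the interval is the dual of the factor: it is free for an equation.\<close>

definition lower :: "'n::finite rep \<Rightarrow> 'n var \<Rightarrow> ereal" where
  "lower P x = (case x of
     Zv j \<Rightarrow> lbd P j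
   | Sv i \<Rightarrow> (if i < nrows P \<and> fac P i = Nonpos then -\<infinity> else 0)
   | Lv i \<Rightarrow> (if i < nrows P \<and> fac P i \<noteq> Nonneg then -\<infinity> else 0)
   | Wv j \<Rightarrow> 0
   | Vv j \<Rightarrow> 0
   | Tv \<Rightarrow> 0)"

definition upper :: "'n::finite rep \<Rightarrow> 'n var \<Rightarrow> ereal" where
  "upper P x = (case x of
     Zv j \<Rightarrow> ubd P j
   | Sv i \<Rightarrow> (if i < nrows P \<and> fac P i = Nonneg then \<infinity> else 0)
   | Lv i \<Rightarrow> (if i < nrows P \<and> fac P i \<noteq> Nonpos then \<infinity> else 0)
   | Wv j \<Rightarrow> (if lbd P j = -\<infinity> then 0 else \<infinity>)
   | Vv j \<Rightarrow> (if ubd P j = \<infinity> then 0 else \<infinity>)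
   | Tv \<Rightarrow> \<infinity>)"

definition variables :: "'n::finite rep \<Rightarrow> 'n var set" where
  "variables P = range Zv \<union> Sv ` {..<nrows P} \<union> Lv ` {..<nrows P} \<union>
     Wv ` {j. lbd P j \<noteq> -\<infinity>} \<union> Vv ` {j. ubd P j \<noteq> \<infinity>} \<union> {Tv}"

fun is_multiplier :: "'n var \<Rightarrow> bool" where
  "is_multiplier (Lv i) = True"
| "is_multiplier (Wv j) = True"
| "is_multiplier (Vv j) = True"
| "is_multiplier _ = False"

definition zpart :: "('n::finite var \<Rightarrow> real) \<Rightarrow> real^'n" where
  "zpart x = (\<chi> j. x (Zv j))"

text \<open>The vector \<open>- A\<^sup>T \<lambda> - w + v\<close>.\<close>

definition mpart :: "'n::finite rep \<Rightarrow> ('n var \<Rightarrow> real) \<Rightarrow> real^'n" where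
  "mpart P x = (\<chi> j. - (\<Sum>i<nrows P. x (Lv i) * rowA P i $ j) - x (Wv j) + x (Vv j))"

definition solves_system ::
    "'n::finite rep \<Rightarrow> real^'n^'n \<Rightarrow> real^'n \<Rightarrow> real^'n \<Rightarrow> ('n var \<Rightarrow> real) \<Rightarrow> bool" where
  "solves_system P M q r x \<longleftrightarrow>
     M *v zpart x + q + mpart P x = x Tv *\<^sub>R r \<and>
     (\<forall>i<nrows P. rowA P i \<bullet> zpart x - rhs P i = x (Sv i))"

definition solves_homogeneous ::
    "'n::finite rep \<Rightarrow> real^'n^'n \<Rightarrow> real^'n \<Rightarrow> ('n var \<Rightarrow> real) \<Rightarrow> bool" where
  "solves_homogeneous P M r x \<longleftrightarrow>
     M *v zpart x + mpart P x = x Tv *\<^sub>R r \<and>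
     (\<forall>i<nrows P. rowA P i \<bullet> zpart x = x (Sv i))"

definition within_bounds :: "'n::finite rep \<Rightarrow> ('n var \<Rightarrow> real) \<Rightarrow> bool" where
  "within_bounds P x \<longleftrightarrow> (\<forall>y. lower P y \<le> ereal (x y) \<and> ereal (x y) \<le> upper P y)"

text \<open>As many variables as equations, with linearly independent columns.\<close>

definition is_basis :: "'n::finite rep \<Rightarrow> real^'n^'n \<Rightarrow> real^'n \<Rightarrow> 'n var set \<Rightarrow> bool" where
  "is_basis P M r B \<longleftrightarrow>
     B \<subseteq> variables P \<and> card B = CARD('n) + nrows P \<and>
     (\<forall>x. solves_homogeneous P M r x \<and> (\<forall>y. y \<notin> B \<longrightarrow> x y = 0) \<longrightarrow> (\<forall>y. x y = 0))"

definition complementary :: "'n::finite rep \<Rightarrow> 'n var set \<Rightarrow> bool" where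
  "complementary P B \<longleftrightarrow> Tv \<notin> B \<and>
     (\<forall>i<nrows P. card (B \<inter> {Sv i, Lv i}) = 1) \<and>
     (\<forall>j. card (B \<inter> {Zv j, Wv j, Vv j}) = 1)"

text \<open>A basis at an extreme point: \<open>n\<close> constraints have a basic multiplier (by nonsingularity their
  gradients are linearly independent, so these constraints determine the point). The free
  multiplier of an equation never leaves a basis; it may be nonbasic only if the equation is
  redundant relative to those with basic multiplier.\<close>

definition vertex_basis :: "'n::finite rep \<Rightarrow> real^'n^'n \<Rightarrow> real^'n \<Rightarrow> 'n var set \<Rightarrow> bool" where
  "vertex_basis P M r B \<longleftrightarrow>
     is_basis P M r B \<and> complementary P B \<and>
     card {y \<in> B. is_multiplier y} = CARD('n) \<and>
     (\<forall>i<nrows P. fac P i = Zero \<and> Lv i \<notin> B \<longrightarrow>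
        rowA P i \<in> span {rowA P k |k. k < nrows P \<and> fac P k = Zero \<and> Lv k \<in> B})"


section \<open>Pivoting\<close>

definition lex_less :: "(nat \<Rightarrow> real) \<Rightarrow> (nat \<Rightarrow> real) \<Rightarrow> bool" where
  "lex_less f g \<longleftrightarrow> (\<exists>k. (\<forall>i<k. f i = g i) \<and> f k < g k)"

text \<open>Basic values are kept as lexicographic rows \<open>X y\<close>: \<open>X y 0\<close> is the value of \<open>y\<close> and
  \<open>X y (Suc k)\<close> the coefficient of a formal infinitesimal of order \<open>k\<close>, by which the bounds of
  the variable \<open>ord ! k\<close> of the initial basis are relaxed. For a basic variable that is bounded
  on one side, the distance of \<open>X y\<close> to the relaxed bound is therefore, up to the signs of its
  entries, the value of \<open>y\<close> minus its bound followed by the row of \<open>y\<close> in the current tableau,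
  restricted to the columns of the initial basis: the usual lexicographic row.\<close>

type_synonym 'n tableau = "'n var \<Rightarrow> nat \<Rightarrow> real"

definition lex_bound :: "'n::finite rep \<Rightarrow> 'n var list \<Rightarrow> bool \<Rightarrow> 'n var \<Rightarrow> nat \<Rightarrow> real" where
  "lex_bound P ord up y k =
     (case k of
        0 \<Rightarrow> real_of_ereal (if up then upper P y else lower P y)
      | Suc i \<Rightarrow> (if i < length ord \<and> ord ! i = y then (if up then 1 else - 1) else 0))"

record 'n state =
  basis :: "'n var set"
  point :: "'n tableau"
  entering :: "'n var"
  sense :: real  \<comment> \<open>1 if the entering variable increases, -1 if it decreases\<close>

definition pivot_direction ::
    "'n::finite rep \<Rightarrow> real^'n^'n \<Rightarrow> real^'n \<Rightarrow> 'n state \<Rightarrow> ('n var \<Rightarrow> real) \<Rightarrow> bool" where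
  "pivot_direction P M r s d \<longleftrightarrow>
     solves_homogeneous P M r d \<and> d (entering s) = sense s \<and>
     (\<forall>y. y \<notin> insert (entering s) (basis s) \<longrightarrow> d y = 0)"

text \<open>The entering variable itself may block, at its opposite bound.\<close>

definition blocking :: "'n::finite rep \<Rightarrow> ('n var \<Rightarrow> real) \<Rightarrow> 'n var \<Rightarrow> bool" where
  "blocking P d y \<longleftrightarrow> (d y < 0 \<and> lower P y \<noteq> -\<infinity>) \<or> (0 < d y \<and> upper P y \<noteq> \<infinity>)"

definition ratio ::
    "'n::finite rep \<Rightarrow> 'n var list \<Rightarrow> 'n tableau \<Rightarrow> ('n var \<Rightarrow> real) \<Rightarrow> 'n var \<Rightarrow> nat \<Rightarrow> real" where
  "ratio P ord X d y k = (lex_bound P ord (0 < d y) y k - X y k) / d y"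

definition leaves ::
    "'n::finite rep \<Rightarrow> 'n var list \<Rightarrow> 'n tableau \<Rightarrow> ('n var \<Rightarrow> real) \<Rightarrow> 'n var \<Rightarrow> bool" where
  "leaves P ord X d y \<longleftrightarrow>
     blocking P d y \<and>
     (\<forall>y'. blocking P d y' \<longrightarrow> \<not> lex_less (ratio P ord X d y') (ratio P ord X d y))"

text \<open>The complement of the variable that has just left, with the sense in which it enters; the
  flag says whether a leaving \<open>z\<close>-component is at its upper bound. The value at \<open>Tv\<close> is
  irrelevant: the method stops when \<open>t\<close> leaves.\<close>

fun complement :: "'n::finite rep \<Rightarrow> bool \<Rightarrow> 'n var \<Rightarrow> 'n var \<times> real" where
  "complement P up (Zv j) = (if up then Vv j else Wv j, 1)"
| "complement P up (Wv j) = (Zv j, 1)"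
| "complement P up (Vv j) = (Zv j, - 1)"
| "complement P up (Sv i) = (Lv i, if fac P i = Nonpos then - 1 else 1)"
| "complement P up (Lv i) = (Sv i, if fac P i = Nonpos then - 1 else 1)"
| "complement P up Tv = (Tv, 1)"

definition pivot ::
    "'n::finite rep \<Rightarrow> real^'n^'n \<Rightarrow> real^'n \<Rightarrow> 'n var list \<Rightarrow> 'n state \<Rightarrow> 'n state \<Rightarrow> bool" where
  "pivot P M r ord s s' \<longleftrightarrow>
     point s Tv 0 \<noteq> 0 \<and>
     (\<exists>d y. pivot_direction P M r s d \<and> leaves P ord (point s) d y \<and>
        basis s' = insert (entering s) (basis s) - {y} \<and>
        point s' = (\<lambda>x k. point s x k + ratio P ord (point s) d y k * d x) \<and>
        (entering s', sense s') = complement P (0 < d y) y)"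

text \<open>The point of the starting ray given by the basis \<open>B\<close> at the extreme point \<open>zbar\<close> and the
  value of \<open>t\<close>; the corresponding point of the normal manifold is \<open>zbar + mpart P x\<close>.\<close>

definition starting_ray_point ::
    "'n::finite rep \<Rightarrow> real^'n^'n \<Rightarrow> real^'n \<Rightarrow> real^'n \<Rightarrow> real^'n \<Rightarrow> 'n var set \<Rightarrow>
     ('n var \<Rightarrow> real) \<Rightarrow> bool" where
  "starting_ray_point P M q zbar r B x \<longleftrightarrow>
     solves_system P M q r x \<and> within_bounds P x \<and> zpart x = zbar \<and>
     (\<forall>y. y \<notin> B \<and> y \<noteq> Tv \<and> y \<notin> range Zv \<longrightarrow> x y = 0) \<and>
     (\<forall>j. Wv j \<in> B \<longrightarrow> ereal (x (Zv j)) = lbd P j) \<and>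
     (\<forall>j. Vv j \<in> B \<longrightarrow> ereal (x (Zv j)) = ubd P j)"

text \<open>The first pivot is the one in which \<open>t\<close> enters, decreasing along the starting ray. In the
  lexicographic order the basic multipliers come before the basic components of \<open>z\<close> and \<open>s\<close>
  (i.e. ties are broken as if \<open>q\<close> were perturbed first, and the constraints of \<open>C\<close> by
  infinitesimals of higher order). With the opposite order, and \<open>r\<close> on the common boundary of
  the cones belonging to two bases at a degenerate \<open>zbar\<close>, several perturbed rays collapse to
  the starting ray, and the method may return to it.\<close>

definition start ::
    "'n::finite rep \<Rightarrow> real^'n^'n \<Rightarrow> real^'n \<Rightarrow> real^'n \<Rightarrow> real^'n \<Rightarrow> 'n var list \<Rightarrow>
     'n state \<Rightarrow> bool" where
  "start P M q zbar r ord s \<longleftrightarrow>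
     vertex_basis P M r (basis s) \<and>
     distinct ord \<and> set ord = basis s \<and>
     (\<forall>i k. i < k \<and> k < length ord \<and> is_multiplier (ord ! k) \<longrightarrow> is_multiplier (ord ! i)) \<and>
     entering s = Tv \<and> sense s = - 1 \<and>
     (\<forall>y k. point s y (Suc k) = 0) \<and>
     starting_ray_point P M q zbar r (basis s) (\<lambda>y. point s y 0) \<and>
     (\<forall>t \<ge> point s Tv 0. \<exists>x. starting_ray_point P M q zbar r (basis s) x \<and> x Tv = t)"

text \<open>The method stops with \<open>t = 0\<close>, and the projection of the final point of the normal
  manifold solves the problem.\<close>

definition stops_at_solution ::
    "'n::finite rep \<Rightarrow> real^'n^'n \<Rightarrow> real^'n \<Rightarrow> 'n state \<Rightarrow> bool" where
  "stops_at_solution P M q s \<longleftrightarrow>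
     (let x = (\<lambda>y. point s y 0);
          z = closest_point (feasible_set P) (zpart x + mpart P x)
      in x Tv = 0 \<and> z = zpart x \<and> avi_solution (feasible_set P) q M z)"

text \<open>For every choice of an extreme point, of \<open>r\<close>, of an initial basis on the starting ray
  and of its ordering, the method is finite, and it does not get stuck at \<open>t > 0\<close>. A state
  with \<open>t > 0\<close> has no successor exactly if no variable blocks, i.e. on a secondary ray. The
  existential clauses say that the method can be started.\<close>

definition pathavi_solves :: "'n::finite rep \<Rightarrow> real^'n \<Rightarrow> real^'n^'n \<Rightarrow> bool" where
  "pathavi_solves P q M \<longleftrightarrow>
     (\<exists>zbar. zbar extreme_point_of feasible_set P) \<and>
     (\<forall>zbar r. zbar extreme_point_of feasible_set P \<and>
               r \<in> rel_interior (normal_cone (feasible_set P) zbar) \<longrightarrow>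
        (\<exists>ord s. start P M q zbar r ord s) \<and>
        (\<forall>ord s. start P M q zbar r ord s \<longrightarrow>
           \<not> (\<exists>f. f 0 = s \<and> (\<forall>k::nat. pivot P M r ord (f k) (f (Suc k)))) \<and>
           (\<forall>s'. (pivot P M r ord)\<^sup>*\<^sup>* s s' \<and> (\<nexists>s''. pivot P M r ord s' s'') \<longrightarrow>
              stops_at_solution P M q s')))"

end

theory Submission
  imports Defs
begin

text \<open>
  The infinitesimals of the lexicographic rule turn the problem into a nondegenerate one, in which a
  complementary basis together with an entering variable is an end of an edge of a piecewise linear
  path: walking along the edge (\<open>traverse\<close>) and turning into the other edge at the vertex (\<open>switch\<close>)
  are partial involutions without fixed points. Hence the path repeats no vertex, and it could come
  back to the starting ray only as its own reverse, which is impossible. Since there are finitely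
  many states, the method ends with \<open>t = 0\<close> or on a ray with \<open>t > 0\<close>.

  On such a ray let \<open>(dz, dt)\<close> be the direction of \<open>(z, t)\<close>. If \<open>dz \<noteq> 0\<close>, then \<open>dt > 0\<close> contradicts
  semimonotonicity, because \<open>- r\<close> is interior to the dual of the recession cone, and \<open>dt = 0\<close>
  contradicts the assumption on the solutions of the homogeneous problem. If \<open>dz = 0\<close>, then \<open>r\<close> is
  a normal at \<open>z\<close>, so \<open>z\<close> is the initial extreme point up to infinitesimals. As \<open>q\<close> is perturbed
  by infinitesimals of lower order than the constraints, a comparison of orders shows that the
  perturbed point is the initial extreme point too and that the basis is the initial one: the ray
  is the starting ray.
\<close>


section \<open>Lexicographic positivity\<close>

text \<open>The hard case is a degenerate initial extreme point with r on the common boundary of the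
  cones of several bases: the true values then do not tell whether the final ray is the starting
  one, and only the infinitesimal levels can. Level k + 1 relaxes the bounds of
  \<open>ord ! k\<close>. Up to the last multiplier in \<open>ord\<close> the constraints of C are
  unrelaxed, so a first nonzero deviation from the extreme point would be a feasible direction,
  along which r strictly decreases, whereas the final ray forbids a decrease. After that level every
  sign-constrained multiplier of the initial basis is, along the starting ray, lexicographically
  strictly inside its bound, and pairing these multipliers with the deviation gives the
  contradiction. Equations need separate care because a free multiplier never blocks: their
  membership in the basis is frozen, and an equation with nonbasic multiplier keeps a constant slack
  because its row depends on those with basic multiplier. Strictness comes from r being interior to
  the normal cone, which is full-dimensional at an extreme point.\<close>

definition lpos :: "(nat \<Rightarrow> real) \<Rightarrow> bool" where
  "lpos f \<longleftrightarrow> (\<exists>k. (\<forall>i<k. f i = 0) \<and> 0 < f k)"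

definition lnn :: "(nat \<Rightarrow> real) \<Rightarrow> bool" where
  "lnn f \<longleftrightarrow> (\<forall>k. f k = 0) \<or> lpos f"

lemma lex_less_iff_lpos: "lex_less f g \<longleftrightarrow> lpos (\<lambda>k. g k - f k)"
  unfolding lex_less_def lpos_def by (metis diff_gt_0_iff_gt eq_iff_diff_eq_0)

lemma lpos_imp_lnn: "lpos f \<Longrightarrow> lnn f"
  by (simp add: lnn_def)

lemma lnn_zero [simp]: "lnn (\<lambda>k. 0)"
  by (simp add: lnn_def)

lemma not_lpos_zero [simp]: "\<not> lpos (\<lambda>k. 0)"
  by (simp add: lpos_def)

lemma lpos_scale: "lpos f \<Longrightarrow> 0 < c \<Longrightarrow> lpos (\<lambda>k. c * f k)"
  unfolding lpos_def by (metis mult_zero_right mult_pos_pos)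

lemma lnn_scale: "lnn f \<Longrightarrow> 0 \<le> c \<Longrightarrow> lnn (\<lambda>k. c * f k)"
  using lpos_scale[of f c] by (cases "c = 0") (auto simp: lnn_def)

lemma lpos_add: assumes "lpos f" "lpos g" shows "lpos (\<lambda>k. f k + g k)"
proof -
  from assms obtain a b where a: "\<forall>i<a. f i = 0" "0 < f a" and b: "\<forall>i<b. g i = 0" "0 < g b"
    unfolding lpos_def by auto
  have "0 < f (min a b) + g (min a b)"
    using a b by (cases a b rule: linorder_cases) (auto simp: min_def)
  then show ?thesis
    unfolding lpos_def using a b by (intro exI[of _ "min a b"]) auto
qed

lemma lpos_add_lnn: "lpos f \<Longrightarrow> lnn g \<Longrightarrow> lpos (\<lambda>k. f k + g k)"
  using lpos_add[of f g] by (auto simp: lnn_def)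

lemma lnn_add: "lnn f \<Longrightarrow> lnn g \<Longrightarrow> lnn (\<lambda>k. f k + g k)"
  using lpos_add[of f g] by (auto simp: lnn_def)

lemma lpos_trichotomy:
  obtains "lpos f" | "\<And>k. f k = 0" | "lpos (\<lambda>k. - f k)"
proof (cases "\<forall>k. f k = 0")
  case False
  define k where "k = (LEAST k. f k \<noteq> 0)"
  have k: "f k \<noteq> 0" "\<forall>i<k. f i = 0"
    unfolding k_def using False not_less_Least by (metis (mono_tags, lifting) LeastI)+
  then have "lpos f \<or> lpos (\<lambda>k. - f k)"
    unfolding lpos_def by (metis add.inverse_neutral linorder_neqE_linordered_idom neg_0_less_iff_less)
  then show ?thesis using that by blast
qed (use that in blast)

lemma lpos_not_neg: "lpos f \<Longrightarrow> \<not> lnn (\<lambda>k. - f k)"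
  using lpos_add_lnn[of f "\<lambda>k. - f k"] by auto

lemma not_lpos_iff: "\<not> lpos f \<longleftrightarrow> lnn (\<lambda>k. - f k)"
  using lpos_not_neg[of f] lpos_trichotomy[of f] by (auto simp: lnn_def)

lemma lnn_sum: "(\<And>y. y \<in> A \<Longrightarrow> lnn (f y)) \<Longrightarrow> lnn (\<lambda>k. \<Sum>y\<in>A. f y k)"
  by (induction A rule: infinite_finite_induct) (auto intro: lnn_add)

lemma lpos_sum:
  assumes "finite A" "\<And>y. y \<in> A \<Longrightarrow> lnn (f y)" "y0 \<in> A" "lpos (f y0)"
  shows "lpos (\<lambda>k. \<Sum>y\<in>A. f y k)"
  using lpos_add_lnn[of "f y0" "\<lambda>k. \<Sum>y\<in>A-{y0}. f y k"] lnn_sum[of "A-{y0}" f] assms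
  by (simp add: sum.remove)

lemma lpos_first: "0 < f 0 \<Longrightarrow> lpos f"
  unfolding lpos_def by (intro exI[of _ 0]) auto

lemma lnn_first: "lnn f \<Longrightarrow> 0 \<le> f 0"
  unfolding lnn_def lpos_def by (metis bot_nat_0.not_eq_extremum less_eq_real_def)

lemma lnn_nonneg: "lnn f \<Longrightarrow> (\<And>i. i < k \<Longrightarrow> f i = 0) \<Longrightarrow> 0 \<le> f k"
  unfolding lnn_def lpos_def by (metis less_eq_real_def not_less_iff_gr_or_eq)

text \<open>Prepending an entry adds a level of lower order: this is how a value is joined to its
  infinitesimal part, and a ray direction to the point it starts from.\<close>

lemma lpos_shift: assumes "0 \<le> c" "lpos f" shows "lpos (case_nat c f)"
proof (cases "c = 0")
  case True
  obtain k where k: "\<forall>i<k. f i = 0" "0 < f k" using assms(2) unfolding lpos_def by auto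
  then have "\<forall>i<Suc k. case_nat c f i = 0" "0 < case_nat c f (Suc k)"
    using True by (auto split: nat.split)
  then show ?thesis unfolding lpos_def by blast
qed (use assms(1) in \<open>auto intro!: lpos_first\<close>)

lemma lnn_shift: assumes "0 \<le> c" "lnn f" shows "lnn (case_nat c f)"
proof (cases "c = 0 \<and> (\<forall>k. f k = 0)")
  case True
  then show ?thesis by (auto simp: lnn_def split: nat.split)
next
  case False
  then show ?thesis
    using assms lpos_shift[of c f] lpos_first[of "case_nat c f"] by (auto simp: lnn_def)
qed

text \<open>Only an initial block of levels is controlled when the first nonzero deviation is
  examined. Cutting off the rest is harmless: a first nonzero entry that survives the cut is also
  the first nonzero entry of \<open>f\<close>.\<close>

lemma lnn_truncate: assumes "lnn f" shows "lnn (\<lambda>k. if k \<le> (N::nat) then f k else 0)"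
proof (rule ccontr)
  let ?g = "\<lambda>k. if k \<le> N then f k else 0"
  assume "\<not> lnn ?g"
  then have "lpos (\<lambda>k. - ?g k)" using not_lpos_iff[of "\<lambda>k. - ?g k"] by simp
  then obtain k where k: "\<forall>i<k. ?g i = 0" "?g k < 0" unfolding lpos_def by auto
  then have "k \<le> N" by (auto split: if_splits)
  then have "\<forall>i<k. f i = 0" "f k < 0" using k by auto
  then show False using lnn_nonneg[OF assms, of k] by auto
qed

text \<open>Transitivity of the strict order is additivity of \<open>lpos\<close>, so a minimum can
  be carried through a finite set. This supplies the leaving variable.\<close>

lemma lex_less_minimal_exists:
  assumes "finite A" "A \<noteq> {}"
  shows "\<exists>y\<in>A. \<forall>y'\<in>A. \<not> lex_less (R y') (R y)"
  using assms
proof (induction A rule: finite_ne_induct)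
  case (singleton x)
  then show ?case by (simp add: lex_less_iff_lpos)
next
  case (insert x A)
  then obtain y where y: "y \<in> A" "\<forall>y'\<in>A. \<not> lex_less (R y') (R y)" by blast
  show ?case
  proof (cases "lex_less (R x) (R y)")
    case True
    have "\<not> lex_less (R y') (R x)" if "y' \<in> A" for y'
    proof
      assume "lex_less (R y') (R x)"
      then have "lex_less (R y') (R y)"
        using lpos_add[of "\<lambda>k. R x k - R y' k" "\<lambda>k. R y k - R x k"] True
        by (simp add: lex_less_iff_lpos)
      then show False using y that by blast
    qed
    then show ?thesis by (auto simp: lex_less_iff_lpos)
  qed (use y in auto)
qed


section \<open>Underdetermined homogeneous systems\<close>

text \<open>Gaussian elimination, with arbitrary finite index sets, so that it applies to basic
  columns, to levels of the perturbation and to coordinates alike.\<close>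

lemma underdetermined_nontrivial_solution:
  fixes a :: "'i \<Rightarrow> 'j \<Rightarrow> real"
  assumes "finite I" "finite J" "card I < card J"
  shows "\<exists>x. (\<exists>j\<in>J. x j \<noteq> 0) \<and> (\<forall>j. j \<notin> J \<longrightarrow> x j = 0) \<and> (\<forall>i\<in>I. (\<Sum>j\<in>J. a i j * x j) = 0)"
  using assms
proof (induction I arbitrary: J a rule: finite_induct)
  case empty
  then obtain j where "j \<in> J" by fastforce
  then show ?case by (intro exI[of _ "\<lambda>l. if l = j then 1 else 0"]) auto
next
  case (insert i I)
  show ?case
  proof (cases "\<forall>j\<in>J. a i j = 0")
    case True
    obtain x where "\<exists>j\<in>J. x j \<noteq> 0" "\<forall>j. j \<notin> J \<longrightarrow> x j = 0" "\<forall>i\<in>I. (\<Sum>j\<in>J. a i j * x j) = 0"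
      using insert.IH[of J a] insert.hyps insert.prems by auto
    then show ?thesis using True by (intro exI[of _ x]) auto
  next
    case False
    then obtain p where p: "p \<in> J" "a i p \<noteq> 0" by auto
    let ?J = "J - {p}"
    \<comment> \<open>Substitutes for the unknown \<open>p\<close> its value from equation
      \<open>i\<close>.\<close>
    let ?a = "\<lambda>l j. a l j - a l p * a i j / a i p"
    have "card I < card ?J" using insert p by simp
    then obtain x where x: "\<exists>j\<in>?J. x j \<noteq> 0" "\<forall>j. j \<notin> ?J \<longrightarrow> x j = 0"
        "\<forall>l\<in>I. (\<Sum>j\<in>?J. ?a l j * x j) = 0"
      using insert.IH[of ?J ?a] insert.prems by auto
    define s where "s = (\<Sum>j\<in>?J. a i j * x j)"
    define x' where "x' = x(p := - s / a i p)"
    have split: "(\<Sum>j\<in>J. a l j * x' j) = a l p * (- s / a i p) + (\<Sum>j\<in>?J. a l j * x j)" for l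
      using insert.prems p by (simp add: sum.remove x'_def)
    have "(\<Sum>j\<in>J. a l j * x' j) = 0" if "l \<in> I" for l
    proof -
      have "(\<Sum>j\<in>?J. ?a l j * x j) = (\<Sum>j\<in>?J. a l j * x j) - (a l p / a i p) * s"
        unfolding s_def by (simp add: algebra_simps sum_subtractf sum_distrib_left)
      then show ?thesis using x that split[of l] by simp
    qed
    moreover have "(\<Sum>j\<in>J. a i j * x' j) = 0" using split[of i] p by (simp add: s_def)
    moreover have "\<exists>j\<in>J. x' j \<noteq> 0" using x by (auto simp: x'_def)
    moreover have "\<forall>j. j \<notin> J \<longrightarrow> x' j = 0" using x p by (auto simp: x'_def)
    ultimately show ?thesis by (intro exI[of _ x']) auto
  qed
qed


section \<open>The pivoting system\<close>

lemma zpart_nth [simp]: "zpart x $ j = x (Zv j)"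
  by (simp add: zpart_def)

lemma zpart_zero [simp]: "zpart (\<lambda>y. 0) = 0"
  by (simp add: vec_eq_iff)

lemma zpart_lincomb: "zpart (\<lambda>y. a * x y + b * x' y) = a *\<^sub>R zpart x + b *\<^sub>R zpart x'"
  by (simp add: vec_eq_iff)

lemma mpart_zero [simp]: "mpart P (\<lambda>y. 0) = 0"
  by (simp add: vec_eq_iff mpart_def)

lemma mpart_lincomb: "mpart P (\<lambda>y. a * x y + b * x' y) = a *\<^sub>R mpart P x + b *\<^sub>R mpart P x'"
  by (simp add: vec_eq_iff mpart_def algebra_simps sum.distrib sum_distrib_left sum_negf)

lemma solves_homogeneous_lincomb:
  assumes "solves_homogeneous P M r x" "solves_homogeneous P M r x'"
  shows "solves_homogeneous P M r (\<lambda>y. a * x y + b * x' y)"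
proof -
  have "M *v (a *\<^sub>R zpart x + b *\<^sub>R zpart x') + (a *\<^sub>R mpart P x + b *\<^sub>R mpart P x')
      = a *\<^sub>R (M *v zpart x + mpart P x) + b *\<^sub>R (M *v zpart x' + mpart P x')"
    by (simp add: algebra_simps matrix_vector_right_distrib matrix_vector_mult_scaleR)
  also have "\<dots> = (a * x Tv + b * x' Tv) *\<^sub>R r"
    using assms by (simp add: solves_homogeneous_def scaleR_add_left)
  finally show ?thesis
    using assms unfolding solves_homogeneous_def zpart_lincomb mpart_lincomb
    by (simp add: inner_add_right)
qed

lemma solves_homogeneous_scale:
  "solves_homogeneous P M r x \<Longrightarrow> solves_homogeneous P M r (\<lambda>y. a * x y)"
  using solves_homogeneous_lincomb[of P M r x x a 0] by simp

lemma solves_homogeneous_zero [simp]: "solves_homogeneous P M r (\<lambda>y. 0)"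
  by (simp add: solves_homogeneous_def)

lemma solves_homogeneous_sum:
  assumes "\<And>k. k \<in> A \<Longrightarrow> solves_homogeneous P M r (x k)"
  shows "solves_homogeneous P M r (\<lambda>y. \<Sum>k\<in>A. c k * x k y)"
  using assms
proof (induction A rule: infinite_finite_induct)
  case (insert k A)
  then show ?case using solves_homogeneous_lincomb[of P M r "x k" _ "c k" 1] by simp
qed auto

lemma solves_system_diff:
  assumes "solves_system P M q r x" "solves_system P M q r x'"
  shows "solves_homogeneous P M r (\<lambda>y. x y - x' y)"
proof -
  have z: "zpart (\<lambda>y. x y - x' y) = zpart x - zpart x'" using zpart_lincomb[of 1 x "-1" x'] by simp
  have m: "mpart P (\<lambda>y. x y - x' y) = mpart P x - mpart P x'"
    using mpart_lincomb[of P 1 x "-1" x'] by simp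
  have "(M *v zpart x + q + mpart P x) - (M *v zpart x' + q + mpart P x') = x Tv *\<^sub>R r - x' Tv *\<^sub>R r"
    using assms by (simp add: solves_system_def)
  then show ?thesis
    using assms unfolding solves_homogeneous_def z m solves_system_def
    by (simp add: algebra_simps inner_diff_right matrix_vector_mult_diff_distrib)
qed

lemma solves_system_add_homogeneous:
  assumes "solves_system P M q r x" "solves_homogeneous P M r d"
  shows "solves_system P M q r (\<lambda>y. x y + c * d y)"
proof -
  have z: "zpart (\<lambda>y. x y + c * d y) = zpart x + c *\<^sub>R zpart d" using zpart_lincomb[of 1 x c d] by simp
  have m: "mpart P (\<lambda>y. x y + c * d y) = mpart P x + c *\<^sub>R mpart P d"
    using mpart_lincomb[of P 1 x c d] by simp
  have "M *v (zpart x + c *\<^sub>R zpart d) + q + (mpart P x + c *\<^sub>R mpart P d) =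
      (M *v zpart x + q + mpart P x) + c *\<^sub>R (M *v zpart d + mpart P d)"
    by (simp add: algebra_simps matrix_vector_right_distrib matrix_vector_mult_scaleR)
  also have "\<dots> = (x Tv + c * d Tv) *\<^sub>R r"
    using assms by (simp add: solves_system_def solves_homogeneous_def scaleR_add_left)
  finally show ?thesis
    using assms unfolding solves_homogeneous_def z m solves_system_def
    by (simp add: algebra_simps inner_add_right)
qed

definition residual ::
    "'n::finite rep \<Rightarrow> real^'n^'n \<Rightarrow> real^'n \<Rightarrow> ('n var \<Rightarrow> real) \<Rightarrow> 'n + nat \<Rightarrow> real" where
  "residual P M r x i = (case i of
     Inl j \<Rightarrow> (M *v zpart x + mpart P x - x Tv *\<^sub>R r) $ j
   | Inr i \<Rightarrow> rowA P i \<bullet> zpart x - x (Sv i))"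

definition equations :: "'n::finite rep \<Rightarrow> ('n + nat) set" where
  "equations P = range Inl \<union> Inr ` {..<nrows P}"

lemma solves_homogeneous_iff:
  "solves_homogeneous P M r x \<longleftrightarrow> (\<forall>i\<in>equations P. residual P M r x i = 0)"
  unfolding solves_homogeneous_def residual_def equations_def
  by (auto simp: ball_Un vec_eq_iff)

lemma card_equations:
  "card (equations (P :: 'n::finite rep)) = CARD('n) + nrows P" "finite (equations P)"
  unfolding equations_def
  by (subst card_Un_disjoint) (auto simp: card_image inj_on_def)

lemma residual_lincomb:
  "residual P M r (\<lambda>y. a * x y + b * x' y) i = a * residual P M r x i + b * residual P M r x' i"
  unfolding residual_def zpart_lincomb mpart_lincomb
  by (cases i) (simp_all add: algebra_simps inner_add_right matrix_vector_right_distrib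
      matrix_vector_mult_scaleR)

text \<open>The residuals of the unit vectors are the columns of the system; in this form unknowns
  can be counted against equations.\<close>

lemma residual_eq_sum:
  assumes "finite E" "\<And>y. y \<notin> E \<Longrightarrow> x y = 0"
  shows "residual P M r x i = (\<Sum>y\<in>E. residual P M r (\<lambda>z. if z = y then 1 else 0) i * x y)"
  using assms
proof (induction E arbitrary: x rule: finite_induct)
  case empty
  then have "x = (\<lambda>y. 0 * x y + 0 * x y)" by auto
  then have "residual P M r x i = 0" using residual_lincomb[of P M r 0 x 0 x i] by simp
  then show ?case by simp
next
  case (insert e E)
  let ?u = "\<lambda>y z. if z = y then 1 else 0 :: real"
  let ?x = "x(e := 0)"
  have x: "x = (\<lambda>y. 1 * ?x y + x e * ?u e y)" by auto
  have "residual P M r x i = residual P M r ?x i + x e * residual P M r (?u e) i"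
    by (subst x, subst residual_lincomb) simp
  also have "residual P M r ?x i = (\<Sum>y\<in>E. residual P M r (?u y) i * ?x y)"
    using insert.prems by (intro insert.IH) auto
  also have "\<dots> = (\<Sum>y\<in>E. residual P M r (?u y) i * x y)"
    using insert.hyps by (intro sum.cong) auto
  finally show ?case using insert.hyps by simp
qed

section \<open>Bases, directions along an edge, and exchange of a column\<close>

lemma finite_variables: "finite (variables P)"
  unfolding variables_def by auto

lemma is_basis_finite: "is_basis P M r B \<Longrightarrow> finite B"
  unfolding is_basis_def using finite_subset finite_variables by auto

lemma is_basis_zero:
  "is_basis P M r B \<Longrightarrow> solves_homogeneous P M r x \<Longrightarrow> (\<And>y. y \<notin> B \<Longrightarrow> x y = 0) \<Longrightarrow> x y = 0"
  unfolding is_basis_def by blast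

text \<open>One column more than equations leaves a nontrivial solution. It cannot vanish at
  \<open>e\<close>, because a basis admits only the zero solution, so it can be rescaled.\<close>

lemma basis_direction_exists:
  fixes P :: "'n::finite rep"
  assumes B: "is_basis P M r B" and "e \<notin> B"
  shows "\<exists>d. solves_homogeneous P M r d \<and> d e = \<sigma> \<and> (\<forall>y. y \<notin> insert e B \<longrightarrow> d y = 0)"
proof -
  let ?a = "\<lambda>i y. residual P M r (\<lambda>z. if z = y then 1 else 0) i"
  have fin: "finite (insert e B)" using B is_basis_finite by auto
  have "card (equations P) < card (insert e B)"
    using B assms is_basis_finite[OF B] by (simp add: is_basis_def card_equations)
  then obtain x where x: "\<exists>j\<in>insert e B. x j \<noteq> 0" "\<forall>j. j \<notin> insert e B \<longrightarrow> x j = 0"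
      "\<forall>i\<in>equations P. (\<Sum>j\<in>insert e B. ?a i j * x j) = 0"
    using underdetermined_nontrivial_solution[OF card_equations(2) fin, of P ?a] by auto
  have h: "solves_homogeneous P M r x"
    unfolding solves_homogeneous_iff using residual_eq_sum[OF fin, of x] x by auto
  have "x e \<noteq> 0"
  proof
    assume "x e = 0"
    then have "x y = 0" for y
      using is_basis_zero[OF B h] x by (metis insert_iff)
    then show False using x by auto
  qed
  then show ?thesis
    using solves_homogeneous_scale[OF h, of "\<sigma> / x e"] x
    by (intro exI[of _ "\<lambda>y. \<sigma> / x e * x y"]) auto
qed

text \<open>Subtracting the multiple of \<open>d\<close> with the same entry at \<open>e\<close>
  leaves a solution supported on the basis, which is zero.\<close>

lemma edge_line:
  assumes B: "is_basis P M r B" and e: "e \<notin> B"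
    and d: "solves_homogeneous P M r d" "d e \<noteq> 0" "\<And>y. y \<notin> insert e B \<Longrightarrow> d y = 0"
    and x: "solves_homogeneous P M r x" "\<And>y. y \<notin> insert e B \<Longrightarrow> x y = 0"
  shows "x y = x e / d e * d y"
proof -
  have "1 * x z + (- (x e / d e)) * d z = 0" if "z \<notin> B" for z
    using d(2) d(3)[of z] x(2)[of z] that by (cases "z = e") auto
  from is_basis_zero[OF B solves_homogeneous_lincomb[OF x(1) d(1)] this, of y]
  show ?thesis by simp
qed

text \<open>By \<open>edge_line\<close> a solution on the edge is a multiple of \<open>d\<close>;
  vanishing at \<open>y\<close>, where \<open>d\<close> does not, it is zero.\<close>

lemma basis_exchange:
  fixes P :: "'n::finite rep"
  assumes B: "is_basis P M r B" and e: "e \<notin> B" "e \<in> variables P"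
    and d: "solves_homogeneous P M r d" "d e \<noteq> 0" "\<And>y. y \<notin> insert e B \<Longrightarrow> d y = 0"
    and y: "d y \<noteq> 0"
  shows "is_basis P M r (insert e B - {y})"
proof -
  have yE: "y \<in> insert e B" using d(3) y by blast
  have "x z = 0" if x: "solves_homogeneous P M r x" "\<forall>z. z \<notin> insert e B - {y} \<longrightarrow> x z = 0" for x z
  proof -
    have l: "x z = x e / d e * d z" for z using edge_line[OF B e(1) d x(1)] x(2) by blast
    have "x y = 0" using x(2) by simp
    then have "x e = 0" using l[of y] y d(2) by simp
    then show ?thesis using l[of z] by simp
  qed
  moreover have "insert e B - {y} \<subseteq> variables P" "card (insert e B - {y}) = CARD('n) + nrows P"
    using B e yE is_basis_finite[OF B] by (auto simp: is_basis_def card_Diff_singleton)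
  ultimately show ?thesis unfolding is_basis_def by blast
qed

text \<open>If the perturbed point had a basic variable at its bound, the \<open>n + m\<close> columns of the initial
  basis would lie in the span of the \<open>n + m - 1\<close> remaining basic columns.\<close>

lemma perturbation_nondegenerate:
  assumes B: "is_basis P M r B" and ord: "distinct ord" "set ord = B0" "is_basis P M r B0"
    and X: "\<And>k. solves_homogeneous P M r (\<lambda>y. X y (Suc k))"
    and nb: "\<And>y. y \<notin> B \<Longrightarrow> \<exists>u. X y = lex_bound P ord u y"
    and y: "y \<in> B"
  shows "X y \<noteq> lex_bound P ord u y"
proof
  assume Xy: "X y = lex_bound P ord u y"
  define B'' where "B'' = B - {y}"
  define N where "N = length ord"
  have N: "N = card B0" "card B0 = card B"
    using ord B by (auto simp: N_def distinct_card[symmetric] is_basis_def)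
  have nb'': "\<exists>u. X z = lex_bound P ord u z" if "z \<notin> B''" for z
    using nb Xy that by (auto simp: B''_def)
  let ?u = "\<lambda>k z. if z = ord ! k then 1 else 0 :: real"
  \<comment> \<open>Every column of the initial basis lies in the span of the columns of
    \<open>B''\<close>: at level \<open>Suc k\<close> only the bound of \<open>ord ! k\<close> is
    relaxed, so no other variable off \<open>B''\<close> has a nonzero entry there.\<close>
  have "\<exists>w. solves_homogeneous P M r (\<lambda>z. ?u k z + w z) \<and> (\<forall>z. z \<notin> B'' \<longrightarrow> w z = 0)"
    if k: "k < N" for k
  proof (cases "ord ! k \<in> B''")
    case True
    then show ?thesis
      by (intro exI[of _ "\<lambda>z. - ?u k z"]) auto
  next
    case False
    then obtain v where v: "X (ord ! k) = lex_bound P ord v (ord ! k)" using nb'' by blast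
    define c where "c = X (ord ! k) (Suc k)"
    have c: "c \<noteq> 0" using k by (simp add: c_def v lex_bound_def N_def)
    have 0: "X z (Suc k) = 0" if z: "z \<notin> B''" "z \<noteq> ord ! k" for z
    proof -
      obtain v where "X z = lex_bound P ord v z" using nb''[OF z(1)] ..
      then show ?thesis using z by (auto simp: lex_bound_def)
    qed
    have eq: "(\<lambda>z. ?u k z + (1 / c * X z (Suc k) - ?u k z)) = (\<lambda>z. 1 / c * X z (Suc k))" by auto
    show ?thesis
    proof (intro exI[of _ "\<lambda>z. 1 / c * X z (Suc k) - ?u k z"] conjI allI impI)
      show "solves_homogeneous P M r (\<lambda>z. ?u k z + (1 / c * X z (Suc k) - ?u k z))"
        unfolding eq by (intro solves_homogeneous_scale X)
    next
      fix z assume "z \<notin> B''"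
      then show "1 / c * X z (Suc k) - ?u k z = 0" using 0[of z] c by (auto simp: c_def)
    qed
  qed
  then obtain w where w: "\<And>k. k < N \<Longrightarrow> solves_homogeneous P M r (\<lambda>z. ?u k z + w k z)"
      "\<And>k z. k < N \<Longrightarrow> z \<notin> B'' \<Longrightarrow> w k z = 0"
    by metis
  have "finite B''" "card B'' < N"
    using card_Diff1_less[OF is_basis_finite[OF B] y] is_basis_finite[OF B] N by (simp_all add: B''_def)
  \<comment> \<open>There are more levels than members of \<open>B''\<close>: some combination
    cancels all the parts on \<open>B''\<close> and leaves a nonzero solution on the initial
    basis.\<close>
  then obtain c where c: "\<exists>k\<in>{..<N}. c k \<noteq> 0" "\<forall>z\<in>B''. (\<Sum>k<N. w k z * c k) = 0"
    using underdetermined_nontrivial_solution[of B'' "{..<N}" "\<lambda>z k. w k z"] by auto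
  define x where "x = (\<lambda>z. \<Sum>k<N. c k * (?u k z + w k z))"
  have hx: "solves_homogeneous P M r x"
    unfolding x_def by (rule solves_homogeneous_sum) (use w in auto)
  have xz: "x z = (\<Sum>k<N. c k * ?u k z)" for z
  proof -
    have "(\<Sum>k<N. c k * w k z) = 0"
      using c(2) w(2) by (cases "z \<in> B''") (auto simp: mult.commute)
    then show ?thesis by (simp only: x_def distrib_left sum.distrib)
  qed
  obtain k where k: "k < N" "c k \<noteq> 0" using c by auto
  have "x (ord ! k) = (\<Sum>l<N. if l = k then c l else 0)"
    unfolding xz using ord(1) k(1) by (intro sum.cong) (auto simp: nth_eq_iff_index_eq N_def)
  also have "\<dots> = c k" using k by simp
  finally have "x (ord ! k) \<noteq> 0" using k by simp
  moreover have "x z = 0" if "z \<notin> B0" for z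
    unfolding xz using that ord(2) by (intro sum.neutral) (auto simp: N_def)
  ultimately show False using is_basis_zero[OF ord(3) hx] by blast
qed

lemma not_lpos_antisym: "\<not> lpos f \<Longrightarrow> \<not> lpos (\<lambda>k. - f k) \<Longrightarrow> f k = 0"
  by (rule lpos_trichotomy[of f]) auto

section \<open>Signed slacks and the combinatorics of complementary sets\<close>

definition sg :: "bool \<Rightarrow> real" where
  "sg u = (if u then 1 else - 1)"

definition has_bound :: "'n::finite rep \<Rightarrow> bool \<Rightarrow> 'n var \<Rightarrow> bool" where
  "has_bound P u y \<longleftrightarrow> (if u then upper P y \<noteq> \<infinity> else lower P y \<noteq> - \<infinity>)"

text \<open>The factor \<open>sg u\<close> orients both sides inwards, so that feasibility at either
  relaxed bound reads \<open>lnn\<close>.\<close>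

definition slack :: "'n::finite rep \<Rightarrow> 'n var list \<Rightarrow> 'n tableau \<Rightarrow> bool \<Rightarrow> 'n var \<Rightarrow> nat \<Rightarrow> real" where
  "slack P ord X u y k = sg u * (lex_bound P ord u y k - X y k)"

definition edge :: "'n state \<Rightarrow> 'n var set" where
  "edge s = insert (entering s) (basis s)"

text \<open>The bound at which a variable off the edge \<open>E\<close> is fixed; true stands for the upper one.\<close>

definition fixed_side :: "'n::finite rep \<Rightarrow> 'n var set \<Rightarrow> 'n var \<Rightarrow> bool" where
  "fixed_side P E y = (case y of
     Zv j \<Rightarrow> Vv j \<in> E
   | Sv i \<Rightarrow> fac P i = Nonpos
   | Lv i \<Rightarrow> fac P i = Nonpos
   | _ \<Rightarrow> False)"

lemma sg_simps [simp]: "sg True = 1" "sg False = - 1"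
  by (auto simp: sg_def)

lemma sg_neq0 [simp]: "sg u \<noteq> 0"
  by (auto simp: sg_def)

lemma blocking_iff: "blocking P d y \<longleftrightarrow> d y \<noteq> 0 \<and> has_bound P (0 < d y) y"
  unfolding blocking_def has_bound_def by auto

lemma blocking_side: "has_bound P u y \<Longrightarrow> 0 < sg u * d y \<Longrightarrow> blocking P d y \<and> (0 < d y) = u"
  unfolding blocking_iff by (cases u) auto

lemma slack_move:
  "slack P ord (\<lambda>x k. X x k + \<rho> k * d x) u y k = slack P ord X u y k - \<rho> k * (sg u * d y)"
  by (simp add: slack_def algebra_simps)

text \<open>The ratio is a step length: the slack on the side towards which \<open>y\<close> moves,
  divided by its speed.\<close>

lemma slack_eq_ratio:
  assumes "d y \<noteq> 0" shows "slack P ord X (0 < d y) y k = \<bar>d y\<bar> * ratio P ord X d y k"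
  using assms by (auto simp: slack_def ratio_def abs_if sg_def field_simps)

lemma lex_bound_lower: "lex_bound P ord False y 0 = real_of_ereal (lower P y)"
  by (simp add: lex_bound_def)

lemma lex_bound_upper: "lex_bound P ord True y 0 = real_of_ereal (upper P y)"
  by (simp add: lex_bound_def)

lemma lex_bound_Suc:
  "lex_bound P ord u y (Suc i) = (if i < length ord \<and> ord ! i = y then sg u else 0)"
  by (simp add: lex_bound_def sg_def)

lemma lex_bound_notin: "y \<notin> set ord \<Longrightarrow> lex_bound P ord u y (Suc k) = 0"
  by (auto simp: lex_bound_def)

lemma card_Int_pair: "a \<noteq> b \<Longrightarrow> card (B \<inter> {a, b}) = 1 \<longleftrightarrow> (a \<in> B) \<noteq> (b \<in> B)"
  by (cases "a \<in> B"; cases "b \<in> B") (auto simp: Int_insert_right)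

lemma card_Int_triple:
  assumes "a \<noteq> b" "a \<noteq> c" "b \<noteq> c"
  shows "card (B \<inter> {a, b, c}) = 1 \<longleftrightarrow>
    a \<in> B \<and> b \<notin> B \<and> c \<notin> B \<or> a \<notin> B \<and> b \<in> B \<and> c \<notin> B \<or> a \<notin> B \<and> b \<notin> B \<and> c \<in> B"
  using assms by (cases "a \<in> B"; cases "b \<in> B"; cases "c \<in> B") (auto simp: Int_insert_right)

lemma complementary_iff:
  "complementary P B \<longleftrightarrow> Tv \<notin> B \<and> (\<forall>i<nrows P. (Sv i \<in> B) \<noteq> (Lv i \<in> B)) \<and>
     (\<forall>j. Zv j \<in> B \<and> Wv j \<notin> B \<and> Vv j \<notin> B \<or> Zv j \<notin> B \<and> Wv j \<in> B \<and> Vv j \<notin> B \<or>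
          Zv j \<notin> B \<and> Wv j \<notin> B \<and> Vv j \<in> B)"
  unfolding complementary_def by (simp add: card_Int_pair[unfolded One_nat_def] card_Int_triple[unfolded One_nat_def])

lemma variables_iff [simp]:
  "Zv j \<in> variables P" "Tv \<in> variables P"
  "Sv i \<in> variables P \<longleftrightarrow> i < nrows P" "Lv i \<in> variables P \<longleftrightarrow> i < nrows P"
  "Wv j \<in> variables P \<longleftrightarrow> lbd P j \<noteq> - \<infinity>" "Vv j \<in> variables P \<longleftrightarrow> ubd P j \<noteq> \<infinity>"
  by (auto simp: variables_def)

lemma factor_Nonneg_iff: "fac P i = Nonneg \<longleftrightarrow> fac P i \<noteq> Zero \<and> fac P i \<noteq> Nonpos"
  by (cases "fac P i") auto


section \<open>Feasible directions\<close>

lemma ray_bounded_below: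
  fixes a b c :: real
  assumes "\<And>t. 0 \<le> t \<Longrightarrow> c \<le> b + t * a" shows "0 \<le> a"
proof (rule ccontr)
  assume "\<not> 0 \<le> a"
  then have a: "a < 0" by simp
  define t where "t = (\<bar>b - c\<bar> + 1) / (- a)"
  have "0 \<le> t" using a by (auto simp: t_def intro!: divide_nonneg_neg)
  moreover have "t * a = - (\<bar>b - c\<bar> + 1)" using a by (simp add: t_def field_simps)
  ultimately show False using assms[of t] by simp
qed

lemma eventually_line_le:
  fixes a b c :: real
  assumes "a < b \<or> a = b \<and> c \<le> 0"
  shows "eventually (\<lambda>\<delta>. a + \<delta> * c \<le> b) (at_right 0)"
  using assms
proof
  assume "a < b"
  have "((\<lambda>\<delta>. a + \<delta> * c) \<longlongrightarrow> a + 0 * c) (at_right 0)" by (intro tendsto_intros)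
  then have "((\<lambda>\<delta>. a + \<delta> * c) \<longlongrightarrow> a) (at_right 0)" by simp
  then have "eventually (\<lambda>\<delta>. a + \<delta> * c < b) (at_right 0)" using \<open>a < b\<close> by (rule order_tendstoD(2))
  then show ?thesis by (rule eventually_mono) simp
next
  assume "a = b \<and> c \<le> 0"
  then show ?thesis
    using eventually_at_right_less[of "0::real"] by (auto elim!: eventually_mono simp: mult_nonneg_nonpos)
qed

text \<open>The variables that are functions of z. For them \<open>val\<close> is the affine
  function and \<open>grad\<close> its linear part, so rows and bounds need no separate
  treatment.\<close>

definition primal :: "'n::finite rep \<Rightarrow> 'n var set" where
  "primal P = range Zv \<union> Sv ` {..<nrows P}"

definition grad :: "'n::finite rep \<Rightarrow> 'n var \<Rightarrow> real^'n \<Rightarrow> real" where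
  "grad P y v = (case y of Sv i \<Rightarrow> rowA P i \<bullet> v | Zv j \<Rightarrow> v $ j | _ \<Rightarrow> 0)"

definition val :: "'n::finite rep \<Rightarrow> 'n var \<Rightarrow> real^'n \<Rightarrow> real" where
  "val P y z = (case y of Sv i \<Rightarrow> rowA P i \<bullet> z - rhs P i | Zv j \<Rightarrow> z $ j | _ \<Rightarrow> 0)"

lemma val_add: "val P y (z + w) = val P y z + grad P y w"
  by (cases y) (auto simp: val_def grad_def inner_add_right)

lemma grad_scale: "grad P y (c *\<^sub>R v) = c * grad P y v"
  by (cases y) (auto simp: grad_def)

lemma finite_primal: "finite (primal P)"
  by (simp add: primal_def)

lemma feasible_iff_val:
  "z \<in> feasible_set P \<longleftrightarrow>
     (\<forall>y\<in>primal P. lower P y \<le> ereal (val P y z) \<and> ereal (val P y z) \<le> upper P y)"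
proof -
  have "(rowA P i \<bullet> z - rhs P i \<in> factor_set (fac P i)) \<longleftrightarrow>
      lower P (Sv i) \<le> ereal (val P (Sv i) z) \<and> ereal (val P (Sv i) z) \<le> upper P (Sv i)" if "i < nrows P" for i
    using that by (cases "fac P i") (auto simp: lower_def upper_def val_def)
  then show ?thesis
    unfolding feasible_set_def primal_def
    by (auto simp: ball_Un lower_def upper_def val_def)
qed

locale feasible_rep =
  fixes P :: "'n::finite rep"
  assumes feasible: "feasible_set P \<noteq> {}"
begin

lemma bounds_le: "lbd P j \<le> ubd P j" "lbd P j \<noteq> \<infinity>" "ubd P j \<noteq> - \<infinity>"
proof -
  obtain z where "lbd P j \<le> ereal (z $ j)" "ereal (z $ j) \<le> ubd P j"
    using feasible by (auto simp: feasible_set_def)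
  then show "lbd P j \<le> ubd P j" "lbd P j \<noteq> \<infinity>" "ubd P j \<noteq> - \<infinity>" by auto
qed

lemma lower_le_upper: "lower P y \<le> upper P y"
  using bounds_le by (cases y) (auto simp: lower_def upper_def)

lemma lower_finite: "has_bound P False y \<Longrightarrow> lower P y = ereal (real_of_ereal (lower P y))"
  using bounds_le by (cases y) (auto simp: lower_def has_bound_def ereal_real split: if_splits)

lemma upper_finite: "has_bound P True y \<Longrightarrow> upper P y = ereal (real_of_ereal (upper P y))"
  using bounds_le by (cases y) (auto simp: upper_def has_bound_def ereal_real split: if_splits)

definition bnd :: "bool \<Rightarrow> 'n var \<Rightarrow> real" where
  "bnd u y = real_of_ereal (if u then upper P y else lower P y)"

lemma bound_iff:
  "lower P y \<le> ereal c \<longleftrightarrow> (has_bound P False y \<longrightarrow> bnd False y \<le> c)"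
  "ereal c \<le> upper P y \<longleftrightarrow> (has_bound P True y \<longrightarrow> c \<le> bnd True y)"
proof -
  show "lower P y \<le> ereal c \<longleftrightarrow> (has_bound P False y \<longrightarrow> bnd False y \<le> c)"
  proof (cases "has_bound P False y")
    case True
    then show ?thesis using lower_finite[OF True] by (metis bnd_def ereal_less_eq(3))
  qed (simp add: has_bound_def)
  show "ereal c \<le> upper P y \<longleftrightarrow> (has_bound P True y \<longrightarrow> c \<le> bnd True y)"
  proof (cases "has_bound P True y")
    case True
    then show ?thesis using upper_finite[OF True] by (metis bnd_def ereal_less_eq(3))
  qed (simp add: has_bound_def)
qed

lemma feasible_iff_slack:
  "z \<in> feasible_set P \<longleftrightarrow> (\<forall>y\<in>primal P. \<forall>u. has_bound P u y \<longrightarrow> 0 \<le> sg u * (bnd u y - val P y z))"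
  unfolding feasible_iff_val bound_iff by (auto simp: sg_def)

text \<open>Inactive constraints leave room for a small step, and active ones are not approached
  from inside; finitely many constraints share one step length.\<close>

lemma feasible_direction:
  assumes z: "z \<in> feasible_set P"
    and v: "\<And>y u. y \<in> primal P \<Longrightarrow> has_bound P u y \<Longrightarrow> bnd u y = val P y z \<Longrightarrow> sg u * grad P y v \<le> 0"
  shows "\<exists>\<delta>>0. z + \<delta> *\<^sub>R v \<in> feasible_set P"
proof -
  have "eventually (\<lambda>\<delta>. has_bound P u y \<longrightarrow> 0 \<le> sg u * (bnd u y - val P y (z + \<delta> *\<^sub>R v))) (at_right 0)"
    if y: "y \<in> primal P" for y u
  proof (cases "has_bound P u y")
    case True
    have "0 \<le> sg u * (bnd u y - val P y z)" using z y True by (auto simp: feasible_iff_slack)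
    then have "sg u * val P y z < sg u * bnd u y \<or>
        sg u * val P y z = sg u * bnd u y \<and> sg u * grad P y v \<le> 0"
      using v[OF y True] by (auto simp: algebra_simps less_le)
    then have "eventually (\<lambda>\<delta>. sg u * val P y z + \<delta> * (sg u * grad P y v) \<le> sg u * bnd u y) (at_right 0)"
      by (rule eventually_line_le)
    then show ?thesis
      by (rule eventually_mono) (simp add: val_add grad_scale algebra_simps)
  qed simp
  then have "\<forall>y\<in>primal P. \<forall>u\<in>UNIV.
      eventually (\<lambda>\<delta>. has_bound P u y \<longrightarrow> 0 \<le> sg u * (bnd u y - val P y (z + \<delta> *\<^sub>R v))) (at_right 0)"
    by blast
  then have "eventually (\<lambda>\<delta>. \<forall>y\<in>primal P. \<forall>u\<in>UNIV.
      has_bound P u y \<longrightarrow> 0 \<le> sg u * (bnd u y - val P y (z + \<delta> *\<^sub>R v))) (at_right 0)"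
    by (intro eventually_ball_finite finite_primal ballI finite) blast
  then have "eventually (\<lambda>\<delta>. z + \<delta> *\<^sub>R v \<in> feasible_set P \<and> 0 < \<delta>) (at_right 0)"
    using eventually_at_right_less[of "0::real"]
    by eventually_elim (auto simp: feasible_iff_slack)
  then show ?thesis using eventually_happens'[of "at_right (0::real)"] by (auto simp: trivial_limit_at_right_real)
qed

lemma recession_cone_iff:
  "k \<in> recession_cone (feasible_set P) \<longleftrightarrow>
     (\<forall>y\<in>primal P. \<forall>u. has_bound P u y \<longrightarrow> sg u * grad P y k \<le> 0)"
proof
  assume k: "k \<in> recession_cone (feasible_set P)"
  obtain z where z: "z \<in> feasible_set P" using feasible by auto
  show "\<forall>y\<in>primal P. \<forall>u. has_bound P u y \<longrightarrow> sg u * grad P y k \<le> 0"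
  proof (intro ballI allI impI)
    fix y u assume y: "y \<in> primal P" and u: "has_bound P u y"
    have "- sg u * bnd u y \<le> - sg u * val P y z + t * (- sg u * grad P y k)" if "0 \<le> t" for t
    proof -
      have "z + t *\<^sub>R k \<in> feasible_set P" using k z that by (auto simp: recession_cone_def)
      then have "0 \<le> sg u * (bnd u y - val P y (z + t *\<^sub>R k))" using y u by (auto simp: feasible_iff_slack)
      then show ?thesis by (simp add: val_add grad_scale algebra_simps)
    qed
    then have "0 \<le> - sg u * grad P y k" by (rule ray_bounded_below)
    then show "sg u * grad P y k \<le> 0" by simp
  qed
next
  assume k: "\<forall>y\<in>primal P. \<forall>u. has_bound P u y \<longrightarrow> sg u * grad P y k \<le> 0"
  show "k \<in> recession_cone (feasible_set P)"
    unfolding recession_cone_def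
  proof (intro CollectI ballI allI impI)
    fix x and a :: real assume x: "x \<in> feasible_set P" and a: "0 \<le> a"
    show "x + a *\<^sub>R k \<in> feasible_set P"
      unfolding feasible_iff_slack
    proof (intro ballI allI impI)
      fix y u assume y: "y \<in> primal P" and u: "has_bound P u y"
      have "0 \<le> sg u * (bnd u y - val P y x)" using x y u by (auto simp: feasible_iff_slack)
      moreover have "sg u * grad P y k \<le> 0" using k y u by blast
      then have "a * (sg u * grad P y k) \<le> 0" by (rule mult_nonneg_nonpos[OF a])
      ultimately show "0 \<le> sg u * (bnd u y - val P y (x + a *\<^sub>R k))"
        by (simp add: val_add grad_scale algebra_simps)
    qed
  qed
qed

lemma lex_bound_0: "lex_bound P ord u y 0 = bnd u y"
  by (simp add: lex_bound_def bnd_def)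

end


section \<open>The pivoting path\<close>

text \<open>\<open>B0\<close> is the basis whose variables carry the infinitesimals; its
  independence makes the perturbation nondegenerate, and \<open>redundant\<close> keeps the slacks
  of equations constant.\<close>

locale pivoting = feasible_rep P for P :: "'n::finite rep" +
  fixes M :: "real^'n^'n" and q r :: "real^'n"
    and ord :: "'n var list" and B0 :: "'n var set"
  assumes basis0: "is_basis P M r B0" and compl0: "complementary P B0"
    and ord: "distinct ord" "set ord = B0"
    and redundant: "\<And>i. i < nrows P \<Longrightarrow> fac P i = Zero \<Longrightarrow> Lv i \<notin> B0 \<Longrightarrow>
        rowA P i \<in> span {rowA P k |k. k < nrows P \<and> fac P k = Zero \<and> Lv k \<in> B0}"
begin

text \<open>The invariant of the path. Basic variables are strictly inside their relaxed bounds,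
  while the entering one may sit on a bound. The edge is a complementary set together with
  \<open>Tv\<close>, whichever of its members is entering. The last conjunct freezes the
  equations.\<close>

definition valid :: "'n state \<Rightarrow> bool" where
  "valid s \<longleftrightarrow>
     is_basis P M r (basis s) \<and> entering s \<notin> basis s \<and> entering s \<in> variables P \<and> Tv \<in> edge s \<and>
     complementary P (edge s - {Tv}) \<and>
     solves_system P M q r (\<lambda>y. point s y 0) \<and>
     (\<forall>k. solves_homogeneous P M r (\<lambda>y. point s y (Suc k))) \<and>
     (\<forall>y. y \<notin> edge s \<longrightarrow> point s y = lex_bound P ord (fixed_side P (edge s) y) y) \<and>
     (\<forall>y\<in>basis s. \<forall>u. has_bound P u y \<longrightarrow> lpos (slack P ord (point s) u y)) \<and>
     (\<forall>u. has_bound P u (entering s) \<longrightarrow> lnn (slack P ord (point s) u (entering s))) \<and>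
     \<bar>sense s\<bar> = 1 \<and>
     (\<forall>i<nrows P. fac P i = Zero \<longrightarrow>
        (Sv i \<in> basis s \<longleftrightarrow> Sv i \<in> B0) \<and> (Lv i \<in> basis s \<longleftrightarrow> Lv i \<in> B0))"

text \<open>The entering variable starts at the bound it moves away from, the upper one exactly when
  it decreases. States in which \<open>Tv\<close> enters, at the start and at \<open>t = 0\<close>,
  are excluded.\<close>

definition at_vertex :: "'n state \<Rightarrow> bool" where
  "at_vertex s \<longleftrightarrow> valid s \<and> entering s \<noteq> Tv \<and> has_bound P (sense s < 0) (entering s) \<and>
     point s (entering s) = lex_bound P ord (sense s < 0) (entering s)"

text \<open>The relaxation moves the two bounds apart, by 2 at the level of \<open>y\<close>; so the
  gap is lexicographically nonnegative even if the bounds coincide.\<close>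

lemma lex_bounds_ordered:
  assumes "has_bound P False y" "has_bound P True y"
  shows "lnn (\<lambda>k. lex_bound P ord True y k - lex_bound P ord False y k)"
proof -
  have le: "real_of_ereal (lower P y) \<le> real_of_ereal (upper P y)"
    using lower_le_upper[of y] lower_finite[OF assms(1)] upper_finite[OF assms(2)]
    by (metis ereal_less_eq(3))
  have 1: "(\<lambda>k. lex_bound P ord True y k - lex_bound P ord False y k) =
      case_nat (real_of_ereal (upper P y) - real_of_ereal (lower P y))
        (\<lambda>i. if i < length ord \<and> ord ! i = y then 2 else 0)"
    by (auto simp: fun_eq_iff lex_bound_def split: nat.split)
  have "lnn (\<lambda>i. if i < length ord \<and> ord ! i = y then 2 else 0)"
  proof (cases "\<exists>i<length ord. ord ! i = y")
    case True
    then obtain i where i: "i < length ord" "ord ! i = y" by auto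
    then have "\<forall>l<i. ord ! l \<noteq> y" using ord(1) by (auto simp: nth_eq_iff_index_eq)
    then have "lpos (\<lambda>i. if i < length ord \<and> ord ! i = y then 2 else 0)"
      unfolding lpos_def using i by (intro exI[of _ i]) auto
    then show ?thesis by (rule lpos_imp_lnn)
  next
    case False
    then have "(\<lambda>i. if i < length ord \<and> ord ! i = y then 2 else 0) = (\<lambda>i. 0 :: real)" by auto
    then show ?thesis by simp
  qed
  then show ?thesis unfolding 1 using le by (intro lnn_shift) auto
qed

section \<open>Valid states and their directions\<close>

lemma edge_rows: "valid s \<Longrightarrow> i < nrows P \<Longrightarrow> (Sv i \<in> edge s) \<noteq> (Lv i \<in> edge s)"
  unfolding valid_def complementary_iff by auto

lemma edge_cols:
  "valid s \<Longrightarrow> Zv j \<in> edge s \<and> Wv j \<notin> edge s \<and> Vv j \<notin> edge s \<or>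
     Zv j \<notin> edge s \<and> Wv j \<in> edge s \<and> Vv j \<notin> edge s \<or>
     Zv j \<notin> edge s \<and> Wv j \<notin> edge s \<and> Vv j \<in> edge s"
  unfolding valid_def complementary_iff by auto

lemma edge_variables: "valid s \<Longrightarrow> edge s \<subseteq> variables P"
  unfolding valid_def is_basis_def edge_def by auto

lemma edge_minus_entering: "valid s \<Longrightarrow> edge s - {entering s} = basis s"
  unfolding valid_def edge_def by auto

text \<open>The basis already contains one of \<open>Sv i\<close> and \<open>Lv i\<close>, because
  \<open>B0\<close> does, and the edge has room for only one of them.\<close>

lemma entering_not_equation:
  assumes "valid s" "i < nrows P" "fac P i = Zero"
  shows "entering s \<noteq> Sv i" "entering s \<noteq> Lv i"
proof -
  have "(Sv i \<in> basis s) \<noteq> (Lv i \<in> basis s)"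
    using assms compl0 unfolding valid_def complementary_iff by auto
  moreover have "(Sv i \<in> edge s) \<noteq> (Lv i \<in> edge s)" "entering s \<notin> basis s"
    using edge_rows[OF assms(1,2)] assms(1) by (auto simp: valid_def)
  ultimately show "entering s \<noteq> Sv i" "entering s \<noteq> Lv i"
    unfolding edge_def by (metis insert_iff)+
qed

lemma feasible_tableau:
  assumes s: "valid s" and u: "has_bound P u y"
  shows "lnn (slack P ord (point s) u y)"
proof (cases "y \<in> edge s")
  case True
  then show ?thesis using s u lpos_imp_lnn by (auto simp: valid_def edge_def)
next
  case False
  define v where "v = fixed_side P (edge s) y"
  have X: "point s y = lex_bound P ord v y" using s False by (auto simp: valid_def v_def)
  show ?thesis
  proof (cases "u = v")
    case True
    then have "slack P ord (point s) u y = (\<lambda>k. 0)" using X by (auto simp: slack_def)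
    then show ?thesis by simp
  next
    case uv: False
    show ?thesis
    proof (cases "has_bound P v y")
      case True
      have "slack P ord (point s) u y = (\<lambda>k. lex_bound P ord True y k - lex_bound P ord False y k)"
        using X uv by (cases u) (auto simp: slack_def)
      then show ?thesis using lex_bounds_ordered[of y] u uv True by (cases u) auto
    next
      case nb: False
      \<comment> \<open>The side at which a variable off the edge is fixed has a bound whenever the
        other side has one. For a component of z the multiplier on the edge shows that its bound
        exists.\<close>
      have "False"
      proof (cases y)
        case (Zv j)
        have "Wv j \<in> edge s \<Longrightarrow> lbd P j \<noteq> - \<infinity>" "Vv j \<in> edge s \<Longrightarrow> ubd P j \<noteq> \<infinity>"
          using edge_variables[OF s] by (metis subsetD variables_iff(5,6))+
        then show ?thesis
          using edge_cols[OF s, of j] False nb Zv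
          by (auto simp: v_def fixed_side_def has_bound_def lower_def upper_def split: if_splits)
      qed (use False nb u uv edge_variables[OF s] in
          \<open>auto simp: v_def fixed_side_def has_bound_def lower_def upper_def factor_Nonneg_iff split: if_splits\<close>)
      then show ?thesis ..
    qed
  qed
qed

lemma direction_exists: "valid s \<Longrightarrow> \<exists>d. pivot_direction P M r s d"
  using basis_direction_exists[of P M r "basis s" "entering s" "sense s"]
  unfolding pivot_direction_def valid_def by auto

lemma direction_off_edge: "pivot_direction P M r s d \<Longrightarrow> y \<notin> edge s \<Longrightarrow> d y = 0"
  unfolding pivot_direction_def edge_def by auto

lemma homogeneous_on_edge:
  assumes s: "valid s" and d: "pivot_direction P M r s d"
    and x: "solves_homogeneous P M r x" "\<And>y. y \<notin> edge s \<Longrightarrow> x y = 0"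
  shows "x y = x (entering s) / sense s * d y"
proof -
  have "d (entering s) \<noteq> 0" using s d by (auto simp: valid_def pivot_direction_def)
  then show ?thesis
    using edge_line[of P M r "basis s" "entering s" d x y] s d x
    by (auto simp: valid_def pivot_direction_def edge_def)
qed

lemma direction_unique:
  assumes s: "valid s" and d: "pivot_direction P M r s d" and d': "pivot_direction P M r s d'"
  shows "d = d'"
proof
  fix y
  have "d' y = d' (entering s) / sense s * d y"
    using d' by (intro homogeneous_on_edge[OF s d]) (auto simp: pivot_direction_def edge_def)
  moreover have "d' (entering s) / sense s = 1"
    using d' s by (auto simp: pivot_direction_def valid_def)
  ultimately show "d y = d' y" by simp
qed

text \<open>If \<open>Sv i\<close> is on the edge, the row is a combination of rows of equations
  whose slacks are off the edge and hence do not move.\<close>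

lemma equation_slack_fixed:
  assumes s: "valid s" and d: "pivot_direction P M r s d" and i: "i < nrows P" "fac P i = Zero"
  shows "d (Sv i) = 0"
proof (cases "Sv i \<in> edge s")
  case True
  then have "Sv i \<in> basis s" using entering_not_equation[OF s i] by (auto simp: edge_def)
  then have "Lv i \<notin> B0" using s i compl0 unfolding valid_def complementary_iff by auto
  then have "rowA P i \<in> span {rowA P k |k. k < nrows P \<and> fac P k = Zero \<and> Lv k \<in> B0}"
    using redundant i by blast
  then have "rowA P i \<bullet> zpart d = 0"
  proof (rule span_induct)
    show "subspace {a. a \<bullet> zpart d = 0}"
      by (auto simp: subspace_def inner_add_left)
  next
    fix a assume "a \<in> {rowA P k |k. k < nrows P \<and> fac P k = Zero \<and> Lv k \<in> B0}"
    then obtain k where k: "a = rowA P k" "k < nrows P" "fac P k = Zero" "Lv k \<in> B0" by auto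
    then have "Lv k \<in> edge s" using s by (auto simp: valid_def edge_def)
    then have "d (Sv k) = 0"
      using edge_rows[OF s k(2)] direction_off_edge[OF d] by blast
    then show "a \<bullet> zpart d = 0"
      using d k by (auto simp: pivot_direction_def solves_homogeneous_def)
  qed
  then show ?thesis using d i by (auto simp: pivot_direction_def solves_homogeneous_def)
qed (use direction_off_edge[OF d] in blast)

text \<open>The slack of an equation stands still, and its multiplier has no bound.\<close>

lemma blocking_not_equation:
  assumes s: "valid s" and d: "pivot_direction P M r s d" and b: "blocking P d y"
    and i: "i < nrows P" "fac P i = Zero"
  shows "y \<noteq> Sv i" "y \<noteq> Lv i"
  using equation_slack_fixed[OF s d i] b i
  by (auto simp: blocking_iff has_bound_def lower_def upper_def split: if_splits)

text \<open>A state sits at one end of its edge; \<open>opposite\<close> is the same edge seen from the other end.\<close>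

definition opposite :: "'n state \<Rightarrow> ('n var \<Rightarrow> real) \<Rightarrow> 'n var \<Rightarrow> 'n state" where
  "opposite s d y =
     \<lparr>basis = edge s - {y}, point = (\<lambda>x k. point s x k + ratio P ord (point s) d y k * d x),
      entering = y, sense = - sgn (d y)\<rparr>"

definition traverse :: "'n state \<Rightarrow> 'n state \<Rightarrow> bool" where
  "traverse s s' \<longleftrightarrow> (\<exists>d y. pivot_direction P M r s d \<and> leaves P ord (point s) d y \<and> s' = opposite s d y)"

definition switch :: "'n state \<Rightarrow> 'n state" where
  "switch s = s\<lparr>entering := fst (complement P (sense s < 0) (entering s)),
                sense := snd (complement P (sense s < 0) (entering s))\<rparr>"

context
  fixes s d y
  assumes s: "valid s" and d: "pivot_direction P M r s d" and y: "leaves P ord (point s) d y"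
begin

lemma leaving: "blocking P d y" "d y \<noteq> 0" "has_bound P (0 < d y) y" "y \<in> edge s" "y \<in> variables P"
proof -
  show b: "blocking P d y" using y by (simp add: leaves_def)
  then show 0: "d y \<noteq> 0" "has_bound P (0 < d y) y" by (auto simp: blocking_iff)
  then show "y \<in> edge s" using direction_off_edge[OF d] by blast
  then show "y \<in> variables P" using edge_variables[OF s] by blast
qed

lemma ratio_lnn:
  assumes "blocking P d x" shows "lnn (ratio P ord (point s) d x)"
proof -
  have x: "d x \<noteq> 0" "has_bound P (0 < d x) x" using assms by (auto simp: blocking_iff)
  have "lnn (slack P ord (point s) (0 < d x) x)" using feasible_tableau[OF s x(2)] .
  then have "lnn (\<lambda>k. (1 / \<bar>d x\<bar>) * slack P ord (point s) (0 < d x) x k)"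
    by (rule lnn_scale) simp
  then show ?thesis using x by (simp add: slack_eq_ratio)
qed

lemma ratio_lpos:
  assumes "blocking P d x" "x \<in> basis s" shows "lpos (ratio P ord (point s) d x)"
proof -
  have x: "d x \<noteq> 0" "has_bound P (0 < d x) x" using assms by (auto simp: blocking_iff)
  have "lpos (slack P ord (point s) (0 < d x) x)" using s x(2) assms(2) by (auto simp: valid_def)
  then have "lpos (\<lambda>k. (1 / \<bar>d x\<bar>) * slack P ord (point s) (0 < d x) x k)"
    by (rule lpos_scale) (use x in simp)
  then show ?thesis using x by (simp add: slack_eq_ratio)
qed

lemma opposite_basis: "is_basis P M r (edge s - {y})"
  unfolding edge_def
  by (rule basis_exchange[where d = d])
     (use s d leaving in \<open>auto simp: valid_def pivot_direction_def\<close>)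

lemma opposite_edge: "edge (opposite s d y) = edge s"
  using leaving by (auto simp: edge_def opposite_def)

lemma opposite_leaving: "point (opposite s d y) y = lex_bound P ord (0 < d y) y"
  using leaving by (auto simp: opposite_def ratio_def)

lemma opposite_off_edge:
  "x \<notin> edge s \<Longrightarrow> point (opposite s d y) x = lex_bound P ord (fixed_side P (edge s) x) x"
  using direction_off_edge[OF d] s by (auto simp: opposite_def valid_def)

lemma opposite_homogeneous: "solves_homogeneous P M r (\<lambda>x. point (opposite s d y) x (Suc k))"
  using solves_homogeneous_lincomb[of P M r "\<lambda>x. point s x (Suc k)" d 1] s d
  by (auto simp: opposite_def valid_def pivot_direction_def)

text \<open>A tie would put a second variable on its relaxed bound at the other end of the edge,
  where \<open>perturbation_nondegenerate\<close> applies to the basis without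
  \<open>y\<close>.\<close>

lemma no_ties:
  assumes "blocking P d x" "x \<noteq> y"
  shows "lpos (\<lambda>k. ratio P ord (point s) d x k - ratio P ord (point s) d y k)"
proof (rule ccontr)
  assume "\<not> ?thesis"
  moreover have "\<not> lpos (\<lambda>k. ratio P ord (point s) d y k - ratio P ord (point s) d x k)"
    using y assms(1) by (auto simp: leaves_def lex_less_iff_lpos)
  ultimately have eq: "ratio P ord (point s) d x k = ratio P ord (point s) d y k" for k
    using not_lpos_antisym[of "\<lambda>k. ratio P ord (point s) d x k - ratio P ord (point s) d y k" k] by simp
  have x: "d x \<noteq> 0" "x \<in> edge s"
    using assms(1) direction_off_edge[OF d] by (auto simp: blocking_iff)
  have "point (opposite s d y) x = lex_bound P ord (0 < d x) x"
  proof
    fix k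
    have "ratio P ord (point s) d y k * d x = ratio P ord (point s) d x k * d x" using eq by simp
    then show "point (opposite s d y) x k = lex_bound P ord (0 < d x) x k"
      using x by (auto simp: opposite_def ratio_def)
  qed
  moreover have "point (opposite s d y) x \<noteq> lex_bound P ord (0 < d x) x"
  proof (rule perturbation_nondegenerate[where X = "point (opposite s d y)",
        OF opposite_basis ord basis0 opposite_homogeneous])
    fix z assume "z \<notin> edge s - {y}"
    then show "\<exists>u. point (opposite s d y) z = lex_bound P ord u z"
      using opposite_off_edge opposite_leaving by (cases "z = y") auto
  qed (use x assms in auto)
  ultimately show False by blast
qed

text \<open>Towards a bound the step is strictly shorter than the ratio of \<open>x\<close>; away
  from it the slack cannot shrink. The old entering variable may start on the bound, but then
  \<open>y\<close> was basic and the step is strictly positive.\<close>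

lemma opposite_inside:
  assumes x: "x \<in> edge s - {y}" and u: "has_bound P u x"
  shows "lpos (slack P ord (point (opposite s d y)) u x)"
proof -
  define \<rho> where "\<rho> = ratio P ord (point s) d y"
  have sl: "slack P ord (point (opposite s d y)) u x k = slack P ord (point s) u x k - \<rho> k * (sg u * d x)" for k
    by (simp add: opposite_def slack_move \<rho>_def)
  have \<rho>: "lnn \<rho>" using ratio_lnn leaving by (simp add: \<rho>_def)
  show ?thesis
  proof (cases "0 < sg u * d x")
    case True
    then have b: "blocking P d x" "(0 < d x) = u" using blocking_side[OF u, of d] by auto
    have "slack P ord (point (opposite s d y)) u x =
        (\<lambda>k. \<bar>d x\<bar> * (ratio P ord (point s) d x k - \<rho> k))"
    proof
      fix k
      have "slack P ord (point s) u x k = \<bar>d x\<bar> * ratio P ord (point s) d x k"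
        using slack_eq_ratio[of d x P ord "point s" k] b by (auto simp: blocking_iff)
      moreover have "sg u * d x = \<bar>d x\<bar>" using True by (cases u) auto
      ultimately show "slack P ord (point (opposite s d y)) u x k =
          \<bar>d x\<bar> * (ratio P ord (point s) d x k - \<rho> k)" by (simp add: sl algebra_simps)
    qed
    moreover have "lpos (\<lambda>k. \<bar>d x\<bar> * (ratio P ord (point s) d x k - \<rho> k))"
      by (rule lpos_scale) (use no_ties[of x] b x in \<open>auto simp: \<rho>_def blocking_iff\<close>)
    ultimately show ?thesis by simp
  next
    case False
    have eq: "slack P ord (point (opposite s d y)) u x =
        (\<lambda>k. slack P ord (point s) u x k + (- (sg u * d x)) * \<rho> k)"
      by (auto simp: sl)
    have le: "lnn (\<lambda>k. (- (sg u * d x)) * \<rho> k)" using False \<rho> by (intro lnn_scale) auto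
    show ?thesis
    proof (cases "x \<in> basis s")
      case True
      then have "lpos (slack P ord (point s) u x)" using s u by (auto simp: valid_def)
      then show ?thesis unfolding eq using le by (rule lpos_add_lnn)
    next
      case nb: False
      then have xe: "x = entering s" "y \<in> basis s" using x leaving by (auto simp: edge_def)
      then have "d x \<noteq> 0" using s d by (auto simp: valid_def pivot_direction_def)
      then have "lpos (\<lambda>k. (- (sg u * d x)) * \<rho> k)"
        using False ratio_lpos[of y] leaving xe by (intro lpos_scale) (auto simp: \<rho>_def sg_def)
      then have "lpos (\<lambda>k. (- (sg u * d x)) * \<rho> k + slack P ord (point s) u x k)"
        using feasible_tableau[OF s u] by (rule lpos_add_lnn)
      then show ?thesis unfolding eq by (simp add: add.commute)
    qed
  qed
qed

lemma valid_opposite: "valid (opposite s d y)"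
proof -
  let ?s = "opposite s d y"
  have "solves_system P M q r (\<lambda>x. point ?s x 0)"
    using solves_system_add_homogeneous[of P M q r "\<lambda>x. point s x 0" d "ratio P ord (point s) d y 0"]
      s d by (auto simp: opposite_def valid_def pivot_direction_def)
  moreover have "lnn (slack P ord (point ?s) u y)" if u: "has_bound P u y" for u
  proof (cases "u = (0 < d y)")
    case True
    then have "slack P ord (point ?s) u y = (\<lambda>k. 0)" using opposite_leaving by (auto simp: slack_def)
    then show ?thesis by simp
  next
    case False
    \<comment> \<open>On the side opposite to the bound just reached, the slack is the gap between
      the two relaxed bounds.\<close>
    then have "sg u = - sg (0 < d y)" by (cases u) auto
    then have "slack P ord (point ?s) u y =
        (\<lambda>k. lex_bound P ord True y k - lex_bound P ord False y k)"
      using opposite_leaving False by (auto simp: slack_def sg_def fun_eq_iff)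
    then show ?thesis using lex_bounds_ordered[of y] u False leaving(3) by (cases u) auto
  qed
  moreover have "(Sv i \<in> edge s - {y} \<longleftrightarrow> Sv i \<in> B0) \<and> (Lv i \<in> edge s - {y} \<longleftrightarrow> Lv i \<in> B0)"
    if i: "i < nrows P" "fac P i = Zero" for i
  proof -
    have "(Sv i \<in> basis s \<longleftrightarrow> Sv i \<in> B0) \<and> (Lv i \<in> basis s \<longleftrightarrow> Lv i \<in> B0)"
      using s i by (simp add: valid_def)
    moreover have "y \<noteq> Sv i" "y \<noteq> Lv i" using blocking_not_equation[OF s d leaving(1) i] by auto
    ultimately show ?thesis using entering_not_equation[OF s i] unfolding edge_def by auto
  qed
  moreover have "basis ?s = edge s - {y}" "entering ?s = y" "\<bar>sense ?s\<bar> = 1"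
    using leaving(2) by (auto simp: opposite_def sgn_if)
  moreover have "Tv \<in> edge s" "complementary P (edge s - {Tv})" using s by (auto simp: valid_def)
  ultimately show ?thesis
    unfolding valid_def opposite_edge
    using opposite_basis opposite_homogeneous opposite_off_edge opposite_inside leaving by simp
qed

lemma at_vertex_opposite: "y \<noteq> Tv \<Longrightarrow> at_vertex (opposite s d y)"
proof -
  assume "y \<noteq> Tv"
  moreover have "entering (opposite s d y) = y" "(sense (opposite s d y) < 0) = (0 < d y)"
    using leaving by (auto simp: opposite_def sgn_if)
  ultimately show ?thesis
    unfolding at_vertex_def using valid_opposite opposite_leaving leaving by simp
qed

lemma leaving_unique: "leaves P ord (point s) d x \<Longrightarrow> x = y"
  using no_ties[of x] leaving(1) unfolding leaves_def lex_less_iff_lpos by blast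

end

text \<open>\<open>opposite\<close> records the sense of the way back, so a negative sense there is
  the flag that \<open>complement\<close> expects: the leaving variable has stopped at its upper
  bound.\<close>

lemma pivot_iff:
  "pivot P M r ord s s' \<longleftrightarrow> point s Tv 0 \<noteq> 0 \<and> (\<exists>s''. traverse s s'' \<and> s' = switch s'')" if "valid s"
proof -
  have eq: "(s' = switch (opposite s d y)) \<longleftrightarrow>
      basis s' = insert (entering s) (basis s) - {y} \<and>
      point s' = (\<lambda>x k. point s x k + ratio P ord (point s) d y k * d x) \<and>
      (entering s', sense s') = complement P (0 < d y) y" if "leaves P ord (point s) d y" for d y
  proof -
    have "d y \<noteq> 0" using that by (auto simp: leaves_def blocking_iff)
    then have "(- sgn (d y) < 0) = (0 < d y)" by (auto simp: sgn_if)
    then have sw: "switch (opposite s d y) = \<lparr>basis = edge s - {y},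
        point = (\<lambda>x k. point s x k + ratio P ord (point s) d y k * d x),
        entering = fst (complement P (0 < d y) y), sense = snd (complement P (0 < d y) y)\<rparr>"
      by (simp add: switch_def opposite_def)
    show ?thesis unfolding sw edge_def by (cases s') (auto simp: prod_eq_iff)
  qed
  show ?thesis
    unfolding pivot_def traverse_def using eq by blast
qed

section \<open>The two involutions and the ends of an edge\<close>

lemma traverse_unique: "valid s \<Longrightarrow> traverse s s' \<Longrightarrow> traverse s s'' \<Longrightarrow> s' = s''"
  unfolding traverse_def using direction_unique leaving_unique by metis

lemma traverse_valid: "valid s \<Longrightarrow> traverse s s' \<Longrightarrow> valid s'"
  unfolding traverse_def using valid_opposite by blast

lemma traverse_edge: "valid s \<Longrightarrow> traverse s s' \<Longrightarrow> edge s' = edge s"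
  unfolding traverse_def using opposite_edge by blast

lemma traverse_at_vertex: "valid s \<Longrightarrow> traverse s s' \<Longrightarrow> entering s' \<noteq> Tv \<Longrightarrow> at_vertex s'"
  unfolding traverse_def using at_vertex_opposite by (auto simp: opposite_def)

text \<open>Two edges meet at a vertex, with the same basis and the same tableau: one releases
  \<open>entering s\<close> from its bound, the other the complement. Each of the two variables is
  fixed at a bound on the edge of the other.\<close>

lemma switch_switch_at_vertex:
  assumes s: "at_vertex s"
  shows "at_vertex (switch s)" and "switch (switch s) = s" and "entering (switch s) \<noteq> entering s"
proof -
  have i: "valid s" and e: "entering s \<noteq> Tv" "has_bound P (sense s < 0) (entering s)"
    "point s (entering s) = lex_bound P ord (sense s < 0) (entering s)"
    using s by (auto simp: at_vertex_def)
  have b: "is_basis P M r (basis s)" "entering s \<notin> basis s" "Tv \<in> edge s" "entering s \<in> variables P"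
      and sense: "sense s = 1 \<or> sense s = - 1"
    using i by (auto simp: valid_def)
  have TB: "Tv \<in> basis s" using b e by (auto simp: edge_def)
  define e' where "e' = entering (switch s)"
  have sw: "switch s = s\<lparr>entering := e', sense := sense (switch s)\<rparr>"
    by (simp add: switch_def e'_def)
  have edge': "edge (switch s) = insert e' (basis s)" by (subst sw) (simp add: edge_def)
  have rows: "(Sv i \<in> edge s) \<noteq> (Lv i \<in> edge s)" if "i < nrows P" for i
    using edge_rows[OF i that] .
  have cols: "Zv j \<in> edge s \<and> Wv j \<notin> edge s \<and> Vv j \<notin> edge s \<or>
     Zv j \<notin> edge s \<and> Wv j \<in> edge s \<and> Vv j \<notin> edge s \<or>
     Zv j \<notin> edge s \<and> Wv j \<notin> edge s \<and> Vv j \<in> edge s" for j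
    using edge_cols[OF i] .
  \<comment> \<open>For an equation there is nothing to exchange: the multiplier has no bound at
    which it could be held.\<close>
  have ne: "fac P i \<noteq> Zero" if "entering s = Sv i \<or> entering s = Lv i" for i
  proof
    assume "fac P i = Zero"
    moreover have "i < nrows P" using that b(4) by auto
    ultimately show False using that entering_not_equation[OF i] by blast
  qed
  have off: "point s e' = lex_bound P ord (fixed_side P (edge s) e') e'" if "e' \<notin> edge s"
    using that i unfolding valid_def by blast
  have colB: "Zv j \<notin> basis s \<and> Wv j \<notin> basis s \<and> Vv j \<notin> basis s"
    if "entering s \<in> {Zv j, Wv j, Vv j}" for j
    using that cols[of j] b(2) unfolding edge_def insert_iff by (metis empty_iff var.distinct)
  have rowB: "Sv l \<notin> basis s \<and> Lv l \<notin> basis s" if "entering s \<in> {Sv l, Lv l}" for l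
  proof -
    have "l < nrows P" using that b(4) by auto
    then show ?thesis
      using that rows[of l] b(2) unfolding edge_def insert_iff by (metis empty_iff var.distinct)
  qed
  have comp: "complementary P (insert e' (basis s) - {Tv})"
    if g: "(\<exists>i. {entering s, e'} \<subseteq> {Sv i, Lv i}) \<or> (\<exists>j. {entering s, e'} \<subseteq> {Zv j, Wv j, Vv j})"
      and e': "e' \<notin> basis s"
    unfolding complementary_iff
  proof (intro conjI allI impI)
    fix l assume l: "l < nrows P"
    have g': "entering s \<in> {Sv l, Lv l} \<longleftrightarrow> e' \<in> {Sv l, Lv l}" using g by fastforce
    have "(Sv l \<in> insert e' (basis s)) \<noteq> (Lv l \<in> insert e' (basis s))"
    proof (cases "entering s \<in> {Sv l, Lv l}")
      case True
      then show ?thesis using g' rowB[of l] by auto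
    next
      case False
      then show ?thesis using g' rows[OF l] by (auto simp: edge_def)
    qed
    then show "(Sv l \<in> insert e' (basis s) - {Tv}) \<noteq> (Lv l \<in> insert e' (basis s) - {Tv})" by simp
  next
    fix l
    let ?B = "insert e' (basis s)"
    have g': "entering s \<in> {Zv l, Wv l, Vv l} \<longleftrightarrow> e' \<in> {Zv l, Wv l, Vv l}" using g by fastforce
    have "Zv l \<in> ?B \<and> Wv l \<notin> ?B \<and> Vv l \<notin> ?B \<or> Zv l \<notin> ?B \<and> Wv l \<in> ?B \<and> Vv l \<notin> ?B \<or>
       Zv l \<notin> ?B \<and> Wv l \<notin> ?B \<and> Vv l \<in> ?B"
    proof (cases "entering s \<in> {Zv l, Wv l, Vv l}")
      case True
      then show ?thesis using g' colB[of l] by auto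
    next
      case False
      then show ?thesis using g' cols[of l] by (auto simp: edge_def)
    qed
    then show "Zv l \<in> ?B - {Tv} \<and> Wv l \<notin> ?B - {Tv} \<and> Vv l \<notin> ?B - {Tv} \<or>
       Zv l \<notin> ?B - {Tv} \<and> Wv l \<in> ?B - {Tv} \<and> Vv l \<notin> ?B - {Tv} \<or>
       Zv l \<notin> ?B - {Tv} \<and> Wv l \<notin> ?B - {Tv} \<and> Vv l \<in> ?B - {Tv}" by simp
  qed simp
  \<comment> \<open>A multiplier or slack of an inequality is bounded on one side only, which
    determines its sense; for a component of z the sense tells which of the two bound multipliers is
    its partner.\<close>
  have main: "(e' \<noteq> entering s \<and> e' \<notin> basis s \<and> e' \<in> variables P \<and> e' \<noteq> Tv) \<and>
      complementary P (insert e' (basis s) - {Tv}) \<and>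
      has_bound P (sense (switch s) < 0) e' \<and> (sense (switch s) = 1 \<or> sense (switch s) = -1) \<and>
      (sense (switch s) < 0) = fixed_side P (edge s) e' \<and>
      (sense s < 0) = fixed_side P (insert e' (basis s)) (entering s) \<and>
      complement P (sense (switch s) < 0) e' = (entering s, sense s)"
  proof (cases "entering s")
    case (Zv j)
    have e': "e' = (if sense s < 0 then Vv j else Wv j)" "sense (switch s) = 1"
      using Zv by (auto simp: e'_def switch_def)
    have 1: "e' \<noteq> entering s \<and> e' \<notin> basis s \<and> e' \<in> variables P \<and> e' \<noteq> Tv"
      using colB[of j] Zv e' e(2) by (auto simp: has_bound_def lower_def upper_def)
    have 2: "complementary P (insert e' (basis s) - {Tv})" using 1 Zv e' by (intro comp) auto
    show ?thesis using colB[of j] Zv e' 1 2 sense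
      by (auto simp: has_bound_def lower_def upper_def fixed_side_def)
  next
    case (Wv j)
    have s1: "sense s = 1"
      using Wv e(2) b(4) sense by (auto simp: has_bound_def upper_def)
    have e': "e' = Zv j" "sense (switch s) = 1"
      using Wv by (auto simp: e'_def switch_def)
    have 1: "e' \<noteq> entering s \<and> e' \<notin> basis s \<and> e' \<in> variables P \<and> e' \<noteq> Tv"
      using colB[of j] Wv e' by auto
    have 2: "complementary P (insert e' (basis s) - {Tv})" using 1 Wv e' by (intro comp) auto
    show ?thesis using colB[of j] Wv e' 1 2 s1 b(4)
      by (auto simp: has_bound_def lower_def upper_def fixed_side_def edge_def)
  next
    case (Vv j)
    have s1: "sense s = 1"
      using Vv e(2) b(4) sense by (auto simp: has_bound_def upper_def)
    have e': "e' = Zv j" "sense (switch s) = -1"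
      using Vv by (auto simp: e'_def switch_def)
    have 1: "e' \<noteq> entering s \<and> e' \<notin> basis s \<and> e' \<in> variables P \<and> e' \<noteq> Tv"
      using colB[of j] Vv e' by auto
    have 2: "complementary P (insert e' (basis s) - {Tv})" using 1 Vv e' by (intro comp) auto
    show ?thesis using colB[of j] Vv e' 1 2 s1 b(4)
      by (auto simp: has_bound_def lower_def upper_def fixed_side_def edge_def)
  next
    case (Sv l)
    have e': "e' = Lv l" "sense (switch s) = (if fac P l = Nonpos then -1 else 1)"
      using Sv by (auto simp: e'_def switch_def)
    have l: "l < nrows P" "fac P l \<noteq> Zero" using Sv b(4) ne by auto
    have s1: "sense s = (if fac P l = Nonpos then -1 else 1)"
      using Sv e(2) l sense by (cases "fac P l") (auto simp: has_bound_def lower_def upper_def)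
    have 1: "e' \<noteq> entering s \<and> e' \<notin> basis s \<and> e' \<in> variables P \<and> e' \<noteq> Tv"
      using rowB[of l] Sv e' l by auto
    have 2: "complementary P (insert e' (basis s) - {Tv})" using 1 Sv e' by (intro comp) auto
    show ?thesis using Sv e' 1 2 s1 l
      by (cases "fac P l") (simp_all add: has_bound_def lower_def upper_def fixed_side_def)
  next
    case (Lv l)
    have e': "e' = Sv l" "sense (switch s) = (if fac P l = Nonpos then -1 else 1)"
      using Lv by (auto simp: e'_def switch_def)
    have l: "l < nrows P" "fac P l \<noteq> Zero" using Lv b(4) ne by auto
    have s1: "sense s = (if fac P l = Nonpos then -1 else 1)"
      using Lv e(2) l sense by (cases "fac P l") (auto simp: has_bound_def lower_def upper_def)
    have 1: "e' \<noteq> entering s \<and> e' \<notin> basis s \<and> e' \<in> variables P \<and> e' \<noteq> Tv"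
      using rowB[of l] Lv e' l by auto
    have 2: "complementary P (insert e' (basis s) - {Tv})" using 1 Lv e' by (intro comp) auto
    show ?thesis using Lv e' 1 2 s1 l
      by (cases "fac P l") (simp_all add: has_bound_def lower_def upper_def fixed_side_def)
  qed (use e in simp)
  have e'E: "e' \<notin> edge s" using main by (auto simp: edge_def)
  have pe': "point s e' = lex_bound P ord (sense (switch s) < 0) e'" using off[OF e'E] main by simp
  show "entering (switch s) \<noteq> entering s" using main by (simp add: e'_def)
  show "switch (switch s) = s"
  proof -
    have c: "complement P (sense (switch s) < 0) (entering (switch s)) = (entering s, sense s)"
      using main unfolding e'_def by blast
    have "switch (switch s) = (switch s)\<lparr>entering := entering s, sense := sense s\<rparr>"
      unfolding switch_def[of "switch s"] c by simp
    then show ?thesis by (simp add: switch_def)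
  qed
  have same: "basis (switch s) = basis s" "point (switch s) = point s" by (simp_all add: switch_def)
  have valid': "valid (switch s)"
    unfolding valid_def same e'_def[symmetric] edge'
  proof (intro conjI allI impI ballI)
    fix y assume y: "y \<notin> insert e' (basis s)"
    show "point s y = lex_bound P ord (fixed_side P (insert e' (basis s)) y) y"
    proof (cases "y = entering s")
      case True
      then show ?thesis using e main by simp
    next
      case False
      then have yE: "y \<notin> edge s" using y by (auto simp: edge_def)
      \<comment> \<open>Only the side of a component of z depends on the edge, through
        \<open>Vv j\<close>; an exchange that involves \<open>Vv j\<close> involves
        \<open>Zv j\<close> itself.\<close>
      have "fixed_side P (insert e' (basis s)) y = fixed_side P (edge s) y"
      proof (cases y)
        case (Zv j)
        have "entering s \<noteq> Vv j"
          using y Zv by (auto simp: e'_def switch_def)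
        moreover have "e' \<noteq> Vv j"
        proof
          assume "e' = Vv j"
          moreover have "complement P (sense (switch s) < 0) e' = (entering s, sense s)"
            using main by blast
          ultimately show False using False Zv by simp
        qed
        ultimately show ?thesis using Zv by (auto simp: fixed_side_def edge_def)
      qed (auto simp: fixed_side_def)
      then show ?thesis using yE i by (auto simp: valid_def)
    qed
  next
    fix u assume "has_bound P u e'"
    then show "lnn (slack P ord (point s) u e')" using feasible_tableau[OF i] by blast
  next
    show "\<bar>sense (switch s)\<bar> = 1" using main by auto
  qed (use i main TB in \<open>auto simp: valid_def\<close>)
  then show "at_vertex (switch s)"
    unfolding at_vertex_def same e'_def[symmetric] using main pe' by blast
qed

text \<open>The reversed direction, rescaled so that the variable now entering has speed 1.\<close>

lemma opposite_direction:
  assumes i: "valid s" and d: "pivot_direction P M r s d" and l: "leaves P ord (point s) d y"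
  shows "pivot_direction P M r (opposite s d y) (\<lambda>x. - d x / \<bar>d y\<bar>)"
  unfolding pivot_direction_def
proof (intro conjI allI impI)
  note L = leaving[OF i d l]
  show "solves_homogeneous P M r (\<lambda>x. - d x / \<bar>d y\<bar>)"
    using solves_homogeneous_scale[of P M r d "- 1 / \<bar>d y\<bar>"] d by (simp add: pivot_direction_def)
  show "- d (entering (opposite s d y)) / \<bar>d y\<bar> = sense (opposite s d y)"
    using L(2) by (simp add: opposite_def sgn_if abs_if)
  fix x assume "x \<notin> insert (entering (opposite s d y)) (basis (opposite s d y))"
  then have "x \<notin> edge s" using L(4) by (auto simp: opposite_def)
  then show "- d x / \<bar>d y\<bar> = 0" using direction_off_edge[OF d] by simp
qed

text \<open>On the way back the old entering variable returns to its bound after the same step. No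
  other variable can block sooner, because its slack at the original end is lexicographically
  nonnegative.\<close>

lemma traverse_symmetric:
  assumes s: "at_vertex s" and t: "traverse s s'" and y: "entering s' \<noteq> Tv"
  shows "traverse s' s"
proof -
  have i: "valid s" using s by (simp add: at_vertex_def)
  obtain d y where d: "pivot_direction P M r s d" and l: "leaves P ord (point s) d y"
    and s': "s' = opposite s d y"
    using t unfolding traverse_def by blast
  note L = leaving[OF i d l]
  define \<rho> where "\<rho> = ratio P ord (point s) d y"
  define d' where "d' = (\<lambda>x. - d x / \<bar>d y\<bar>)"
  define e where "e = entering s"
  have de: "d e = sense s" "sense s = 1 \<or> sense s = - 1"
    using d i by (auto simp: pivot_direction_def valid_def e_def)
  have proj: "basis s' = edge s - {y}" "point s' = (\<lambda>x k. point s x k + \<rho> k * d x)"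
    "entering s' = y" "sense s' = - sgn (d y)"
    by (auto simp: s' opposite_def \<rho>_def)
  have "edge s' = edge s" using traverse_edge[OF i t] .
  have d': "pivot_direction P M r s' d'"
    using opposite_direction[OF i d l] by (simp add: s' d'_def)
  have d'e: "d' e \<noteq> 0" "(0 < d' e) = (sense s < 0)"
    using de L(2) by (auto simp: d'_def divide_less_0_iff)
  have reverse: "ratio P ord (point s') d' e k = \<rho> k * \<bar>d y\<bar>" for k
  proof -
    have "ratio P ord (point s') d' e k = (point s e k - (point s e k + \<rho> k * d e)) / d' e"
      unfolding ratio_def proj d'e(2) using s by (simp add: at_vertex_def e_def)
    also have "\<dots> = \<rho> k * \<bar>d y\<bar>" using de L(2) by (auto simp: d'_def)
    finally show ?thesis .
  qed
  have "leaves P ord (point s') d' e"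
    unfolding leaves_def lex_less_iff_lpos
  proof (intro conjI allI impI)
    show "blocking P d' e"
      unfolding blocking_iff using d'e s by (simp add: at_vertex_def e_def)
    fix x assume x: "blocking P d' x"
    then have x': "d' x \<noteq> 0" "has_bound P (0 < d' x) x" by (auto simp: blocking_iff)
    \<comment> \<open>The way to a bound of \<open>x\<close> consists of the way back to the
      original end and the slack that \<open>x\<close> has there.\<close>
    have "ratio P ord (point s') d' x k = \<rho> k * \<bar>d y\<bar> + slack P ord (point s) (0 < d' x) x k / \<bar>d' x\<bar>" for k
    proof -
      have "\<bar>d' x\<bar> * ratio P ord (point s') d' x k =
          slack P ord (point s) (0 < d' x) x k - \<rho> k * (sg (0 < d' x) * d x)"
        using slack_eq_ratio[of d' x P ord "point s'" k] x'(1)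
        by (simp add: proj slack_move)
      moreover have "sg (0 < d' x) * d x = - \<bar>d' x\<bar> * \<bar>d y\<bar>"
        using x'(1) L(2) by (auto simp: d'_def sg_def abs_if field_simps split: if_splits)
      ultimately show ?thesis using x'(1) by (simp add: field_simps)
    qed
    then have "(\<lambda>k. ratio P ord (point s') d' e k - ratio P ord (point s') d' x k) =
        (\<lambda>k. - ((1 / \<bar>d' x\<bar>) * slack P ord (point s) (0 < d' x) x k))"
      by (simp add: reverse)
    moreover have "lnn (\<lambda>k. (1 / \<bar>d' x\<bar>) * slack P ord (point s) (0 < d' x) x k)"
      using feasible_tableau[OF i x'(2)] by (rule lnn_scale) simp
    ultimately show "\<not> lpos (\<lambda>k. ratio P ord (point s') d' e k - ratio P ord (point s') d' x k)"
      by (simp add: not_lpos_iff)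
  qed
  moreover have "s = opposite s' d' e"
  proof -
    have 1: "edge s' - {e} = basis s"
      using edge_minus_entering[OF i] \<open>edge s' = edge s\<close> by (simp add: e_def)
    have 2: "- sgn (d' e) = sense s" using de L(2) by (auto simp: d'_def sgn_if)
    have 3: "(\<lambda>x k. point s' x k + ratio P ord (point s') d' e k * d' x) = point s"
    proof (intro ext)
      fix x k
      show "point s' x k + ratio P ord (point s') d' e k * d' x = point s x k"
        unfolding reverse using L(2) by (simp add: d'_def proj(2))
    qed
    show ?thesis unfolding opposite_def 1 2 3 by (simp add: e_def)
  qed
  ultimately show ?thesis unfolding traverse_def using d' by blast
qed

lemma traverse_neq:
  assumes "valid s" "traverse s s'" shows "s' \<noteq> s"
proof
  assume eq: "s' = s"
  obtain d y where d: "pivot_direction P M r s d" and l: "leaves P ord (point s) d y"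
    and s': "s = opposite s d y"
    using assms(2) eq unfolding traverse_def by metis
  have "entering s = y" "sense s = - sgn (d y)" by (subst s', simp add: opposite_def)+
  moreover have "d (entering s) = sense s" using d by (simp add: pivot_direction_def)
  ultimately have "sense s = - sgn (sense s)" by simp
  then show False using assms(1) by (auto simp: valid_def sgn_if split: if_splits)
qed

text \<open>A vertex state moves away from the bound of its entering variable, so it is the hindmost
  feasible point of the edge in its direction. Two such points on one edge coincide, and
  nondegeneracy then identifies the entering variables.\<close>

lemma edge_end_unique:
  assumes s: "at_vertex s" and s': "at_vertex s'" and E: "edge s = edge s'"
    and d: "pivot_direction P M r s d" and d': "pivot_direction P M r s' d'"
    and c: "0 < c" "\<And>y. d' y = c * d y"
  shows "s = s'"
proof -
  have i: "valid s" "valid s'" using s s' by (auto simp: at_vertex_def)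
  have off: "point s y = point s' y" if "y \<notin> edge s" for y
    using that i E by (auto simp: valid_def)
  define e where "e = entering s"
  define \<rho> where "\<rho> k = (point s' e k - point s e k) / sense s" for k
  have line: "point s' y k = point s y k + \<rho> k * d y" for y k
  proof -
    have h: "solves_homogeneous P M r (\<lambda>y. point s' y k - point s y k)"
    proof (cases k)
      case 0
      then show ?thesis using i solves_system_diff by (auto simp: valid_def)
    next
      case (Suc l)
      then show ?thesis
        using i solves_homogeneous_lincomb[of P M r "\<lambda>y. point s' y k" "\<lambda>y. point s y k" 1 "-1"]
        by (simp add: valid_def)
    qed
    have "point s' y k - point s y k = (point s' e k - point s e k) / sense s * d y"
      unfolding e_def using off by (intro homogeneous_on_edge[OF i(1) d h]) auto
    then show ?thesis by (simp add: \<rho>_def)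
  qed
  \<comment> \<open>If \<open>t'\<close> were ahead of \<open>t\<close>, the entering variable of
    \<open>t'\<close> would be beyond its bound at \<open>t\<close>.\<close>
  have no: "\<not> lpos \<rho>'"
    if "at_vertex t" "at_vertex t'" "edge t = edge t'" "pivot_direction P M r t' f'" "0 < b"
      "\<And>y k. point t' y k = point t y k + \<rho>' k * (b * f' y)" for t t' f' b \<rho>'
  proof
    assume "lpos \<rho>'"
    define x where "x = entering t'"
    define u where "u = (sense t' < 0)"
    have u: "has_bound P u x" "point t' x = lex_bound P ord u x" and "valid t'" "valid t"
      using that by (auto simp: at_vertex_def x_def u_def)
    have fx: "sg u * f' x = - 1"
      using that(4) \<open>valid t'\<close> unfolding pivot_direction_def valid_def x_def u_def sg_def by auto
    have "slack P ord (point t) u x = (\<lambda>k. - (b * \<rho>' k))"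
    proof
      fix k
      have "slack P ord (point t) u x k = sg u * (\<rho>' k * (b * f' x))"
        using u(2) that(6)[of x k] by (simp add: slack_def)
      also have "\<dots> = \<rho>' k * b * (sg u * f' x)" by (simp add: ac_simps)
      finally show "slack P ord (point t) u x k = - (b * \<rho>' k)" using fx by simp
    qed
    then have "lnn (\<lambda>k. - (b * \<rho>' k))" using feasible_tableau[OF \<open>valid t\<close> u(1)] by simp
    then show False using lpos_not_neg lpos_scale[OF \<open>lpos \<rho>'\<close> that(5)] by blast
  qed
  have "\<not> lpos \<rho>"
    using no[OF s s' E d', of "1 / c" \<rho>] line c by simp
  moreover have "\<not> lpos (\<lambda>k. - \<rho> k)"
    using no[OF s' s E[symmetric] d, of 1 "\<lambda>k. - \<rho> k"] line by simp
  ultimately have 0: "\<rho> k = 0" for k by (rule not_lpos_antisym)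
  have P: "point s = point s'" using line 0 by (auto simp: fun_eq_iff)
  have ee: "entering s = entering s'"
  proof (rule ccontr)
    assume ne: "entering s \<noteq> entering s'"
    have "entering s' \<in> edge s" unfolding E by (simp add: edge_def)
    then have "entering s' \<in> basis s" using ne by (simp add: edge_def)
    then have "lpos (slack P ord (point s) (sense s' < 0) (entering s'))"
      using i s' by (auto simp: valid_def at_vertex_def)
    moreover have "slack P ord (point s) (sense s' < 0) (entering s') = (\<lambda>k. 0)"
      using s' by (auto simp: P slack_def at_vertex_def)
    ultimately show False by simp
  qed
  have B: "basis s = basis s'" using edge_minus_entering[OF i(1)] edge_minus_entering[OF i(2)] E ee by simp
  have "sense s' = c * sense s" using d d' c(2)[of "entering s"] ee by (simp add: pivot_direction_def)
  then have "sense s = sense s'" using i c(1) by (auto simp: valid_def abs_if split: if_splits)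
  then show ?thesis using P ee B by simp
qed

text \<open>States carry real tableaux, so finiteness comes from the combinatorial data, which
  determine the state by \<open>edge_end_unique\<close>.\<close>

lemma finite_at_vertex: "finite {s. at_vertex s}"
proof -
  let ?f = "\<lambda>s. (edge s, entering s, sense s)"
  have "?f ` {s. at_vertex s} \<subseteq> Pow (variables P) \<times> variables P \<times> {1, -1}"
  proof (rule image_subsetI)
    fix s assume "s \<in> {s. at_vertex s}"
    then have i: "valid s" by (simp add: at_vertex_def)
    then have "entering s \<in> variables P" "sense s = 1 \<or> sense s = - 1" by (auto simp: valid_def)
    then show "?f s \<in> Pow (variables P) \<times> variables P \<times> {1, -1}" using edge_variables[OF i] by simp
  qed
  then have "finite (?f ` {s. at_vertex s})"
    by (rule finite_subset) (simp add: finite_variables)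
  moreover have "inj_on ?f {s. at_vertex s}"
  proof (rule inj_onI, clarsimp)
    fix s s' assume s: "at_vertex s" "at_vertex s'" and eq: "edge s = edge s'"
      "entering s = entering s'" "sense s = sense s'"
    have i: "valid s" "valid s'" using s by (auto simp: at_vertex_def)
    obtain d where d: "pivot_direction P M r s d" using direction_exists[OF i(1)] by blast
    have "basis s = basis s'" using edge_minus_entering[OF i(1)] edge_minus_entering[OF i(2)] eq by simp
    then have "pivot_direction P M r s' d" using d eq by (simp add: pivot_direction_def)
    then show "s = s'" using edge_end_unique[OF s eq(1) d, of d 1] by simp
  qed
  ultimately show ?thesis using finite_imageD by blast
qed

text \<open>As \<open>t\<close> has no upper bound, it can leave only at its lower bound 0.\<close>

lemma traverse_to_T:
  assumes i: "valid s" and t: "traverse s s'" and T: "entering s' = Tv"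
  shows "valid (switch s')" and "point (switch s') Tv 0 = 0"
proof -
  obtain d where d: "pivot_direction P M r s d" and l: "leaves P ord (point s) d Tv"
    and s': "s' = opposite s d Tv"
    using t T unfolding traverse_def by (auto simp: opposite_def)
  have sw: "switch s' = s'\<lparr>sense := 1\<rparr>" using T by (simp add: switch_def)
  show "valid (switch s')"
    using traverse_valid[OF i t] unfolding sw valid_def edge_def by simp
  have "\<not> 0 < d Tv" using leaving(3)[OF i d l] by (auto simp: has_bound_def upper_def)
  then have "point s' Tv 0 = 0"
    using opposite_leaving[OF i d l] by (simp add: s' lex_bound_lower lower_def)
  then show "point (switch s') Tv 0 = 0" by (simp add: switch_def)
qed

lemma pivot_valid: "valid s \<Longrightarrow> pivot P M r ord s s' \<Longrightarrow> valid s'"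
  using traverse_to_T traverse_at_vertex switch_switch_at_vertex(1)
  by (metis at_vertex_def pivot_iff)

lemma pivot_at_vertex:
  assumes "valid s" "pivot P M r ord s s'" "point s' Tv 0 \<noteq> 0"
  obtains s'' where "traverse s s''" "at_vertex s''" "s' = switch s''"
  using assms traverse_to_T(2) traverse_at_vertex by (metis pivot_iff)

lemma pivot_exists:
  assumes i: "valid s" and t: "point s Tv 0 \<noteq> 0" and d: "pivot_direction P M r s d" and b: "blocking P d y"
  shows "\<exists>s'. pivot P M r ord s s'"
proof -
  have "{y. blocking P d y} \<subseteq> edge s" using direction_off_edge[OF d] by (auto simp: blocking_iff)
  moreover have "finite (edge s)" using i is_basis_finite by (auto simp: valid_def edge_def)
  ultimately have "finite {y. blocking P d y}" by (rule finite_subset)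
  then obtain y where "leaves P ord (point s) d y"
    using lex_less_minimal_exists[of "{y. blocking P d y}" "ratio P ord (point s) d"] b
    by (auto simp: leaves_def)
  then show ?thesis using pivot_iff[OF i] t d unfolding traverse_def by blast
qed

end

section \<open>Normal vectors, projection, and the solution at t = 0\<close>

lemma mpart_inner:
  "mpart P x \<bullet> v = (\<Sum>i<nrows P. - x (Lv i) * (rowA P i \<bullet> v)) + (\<Sum>j\<in>UNIV. (x (Vv j) - x (Wv j)) * v $ j)"
proof -
  have "mpart P x = (\<Sum>i<nrows P. (- x (Lv i)) *\<^sub>R rowA P i) + (\<chi> j. x (Vv j) - x (Wv j))"
    by (simp add: vec_eq_iff mpart_def sum_negf)
  then have "mpart P x \<bullet> v = (\<Sum>i<nrows P. (- x (Lv i)) *\<^sub>R rowA P i) \<bullet> v + (\<chi> j. x (Vv j) - x (Wv j)) \<bullet> v"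
    by (simp add: inner_add_left)
  also have "(\<Sum>i<nrows P. (- x (Lv i)) *\<^sub>R rowA P i) \<bullet> v = (\<Sum>i<nrows P. - x (Lv i) * (rowA P i \<bullet> v))"
    by (simp add: inner_sum_left)
  also have "(\<chi> j. x (Vv j) - x (Wv j)) \<bullet> v = (\<Sum>j\<in>UNIV. (x (Vv j) - x (Wv j)) * v $ j)"
    by (simp add: inner_vec_def)
  finally show ?thesis .
qed

lemma feasible_set_Inter:
  "feasible_set P = (\<Inter>i\<in>{..<nrows P}. {z. rowA P i \<bullet> z - rhs P i \<in> factor_set (fac P i)}) \<inter>
     (\<Inter>j. {z. lbd P j \<le> ereal (z $ j)}) \<inter> (\<Inter>j. {z. ereal (z $ j) \<le> ubd P j})"
  by (auto simp: feasible_set_def)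

lemma closed_factor_set: "closed (factor_set F)"
  by (cases F) auto

lemma convex_factor_set: "convex (factor_set F)"
  by (cases F) auto

lemma closed_feasible_set: "closed (feasible_set P)"
proof -
  have 1: "closed {z. rowA P i \<bullet> z - rhs P i \<in> factor_set (fac P i)}" for i
  proof -
    have "{z. rowA P i \<bullet> z - rhs P i \<in> factor_set (fac P i)} =
        (\<lambda>z. rowA P i \<bullet> z - rhs P i) -` factor_set (fac P i)" by auto
    then show ?thesis by (auto intro!: closed_vimage closed_factor_set continuous_intros)
  qed
  have 2: "closed {z. lbd P j \<le> ereal (z $ j)}" "closed {z. ereal (z $ j) \<le> ubd P j}" for j
    by (auto intro!: closed_Collect_le continuous_intros)
  show ?thesis unfolding feasible_set_Inter using 1 2 by (intro closed_Int closed_INT) auto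
qed

lemma convex_feasible_set: "convex (feasible_set (P :: 'n::finite rep))"
proof (rule convexI)
  fix x y and u v :: real
  assume xy: "x \<in> feasible_set P" "y \<in> feasible_set P" and uv: "0 \<le> u" "0 \<le> v" "u + v = 1"
  show "u *\<^sub>R x + v *\<^sub>R y \<in> feasible_set P"
    unfolding feasible_set_def
  proof (intro CollectI conjI allI impI)
    fix i assume i: "i < nrows P"
    have "rowA P i \<bullet> (u *\<^sub>R x + v *\<^sub>R y) - rhs P i =
        u *\<^sub>R (rowA P i \<bullet> x - rhs P i) + v *\<^sub>R (rowA P i \<bullet> y - rhs P i)"
    proof -
      have "rhs P i = u * rhs P i + v * rhs P i" using uv by (metis distrib_right mult_1)
      then show ?thesis by (simp add: inner_add_right algebra_simps)
    qed
    also have "\<dots> \<in> factor_set (fac P i)"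
      using xy i uv convex_factor_set[of "fac P i"] by (auto simp: feasible_set_def convex_def)
    finally show "rowA P i \<bullet> (u *\<^sub>R x + v *\<^sub>R y) - rhs P i \<in> factor_set (fac P i)" .
  next
    fix j
    have l: "lbd P j \<le> ereal (x $ j)" "lbd P j \<le> ereal (y $ j)" and
      up: "ereal (x $ j) \<le> ubd P j" "ereal (y $ j) \<le> ubd P j"
      using xy by (auto simp: feasible_set_def)
    have conv: "min a b \<le> u * a + v * b \<and> u * a + v * b \<le> max a b" for a b :: real
    proof -
      have "u * min a b + v * min a b \<le> u * a + v * b" "u * a + v * b \<le> u * max a b + v * max a b"
        using uv by (auto intro!: add_mono mult_left_mono)
      then show ?thesis using uv(3) by (metis distrib_right mult_1)
    qed
    have "lbd P j \<le> ereal (min (x $ j) (y $ j))" "ereal (max (x $ j) (y $ j)) \<le> ubd P j"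
      using l up by (auto simp: min_def max_def)
    moreover have "(u *\<^sub>R x + v *\<^sub>R y) $ j = u * x $ j + v * y $ j" by simp
    ultimately show "lbd P j \<le> ereal ((u *\<^sub>R x + v *\<^sub>R y) $ j)" "ereal ((u *\<^sub>R x + v *\<^sub>R y) $ j) \<le> ubd P j"
      using conv[of "x $ j" "y $ j"] by (metis ereal_less_eq(3) order_trans)+
  qed
qed

lemma avi_solution_iff: "avi_solution C q M z \<longleftrightarrow> z \<in> C \<and> - (M *v z + q) \<in> normal_cone C z"
  by (auto simp: avi_solution_def normal_cone_def inner_minus_left simp del: minus_add_distrib)

lemma closest_point_add_normal:
  assumes "convex C" "closed C" "z \<in> C" "y \<in> normal_cone C z"
  shows "closest_point C (z + y) = z"
proof (rule closest_point_unique[symmetric, OF assms(1-3)], intro ballI)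
  fix c assume c: "c \<in> C"
  have "y \<bullet> (c - z) \<le> 0" "0 \<le> (norm (c - z))\<^sup>2"
    using assms(4) c by (auto simp: normal_cone_def)
  then have "(norm y)\<^sup>2 \<le> (norm y)\<^sup>2 - 2 * (y \<bullet> (c - z)) + (norm (c - z))\<^sup>2" by linarith
  also have "\<dots> = (norm (y - (c - z)))\<^sup>2"
    by (simp add: power2_norm_eq_inner inner_diff_left inner_diff_right inner_commute)
  finally have "norm y \<le> norm (y - (c - z))" by (simp add: power2_le_iff_abs_le)
  then show "dist (z + y) z \<le> dist (z + y) c" by (simp add: dist_norm algebra_simps)
qed

context pivoting
begin

text \<open>For the free multiplier of an equation the value 0 comes from
  \<open>real_of_ereal\<close> of an infinite bound.\<close>

lemma fixed_bound_zero:
  "y \<notin> range Zv \<Longrightarrow> lex_bound P ord (fixed_side P E y) y 0 = 0"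
  by (cases y) (auto simp: lex_bound_def fixed_side_def lower_def upper_def)

lemma off_edge_zero: "valid s \<Longrightarrow> y \<notin> edge s \<Longrightarrow> y \<notin> range Zv \<Longrightarrow> point s y 0 = 0"
  by (auto simp: valid_def fixed_bound_zero)

lemma level0_bounds:
  assumes s: "valid s" shows "within_bounds P (\<lambda>y. point s y 0)"
  unfolding within_bounds_def
proof (intro allI conjI)
  fix y
  show "lower P y \<le> ereal (point s y 0)"
  proof (cases "lower P y = - \<infinity>")
    case False
    then have b: "has_bound P False y" by (simp add: has_bound_def)
    have "0 \<le> slack P ord (point s) False y 0" using feasible_tableau[OF s b] lnn_first by blast
    then show ?thesis using lower_finite[OF b] by (metis slack_def sg_simps(2) lex_bound_lower
        ereal_less_eq(3) minus_diff_eq mult_minus1 diff_ge_0_iff_ge)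
  qed simp
  show "ereal (point s y 0) \<le> upper P y"
  proof (cases "upper P y = \<infinity>")
    case False
    then have b: "has_bound P True y" by (simp add: has_bound_def)
    have "0 \<le> slack P ord (point s) True y 0" using feasible_tableau[OF s b] lnn_first by blast
    then show ?thesis using upper_finite[OF b] by (metis slack_def sg_simps(1) lex_bound_upper
        ereal_less_eq(3) mult_1 diff_ge_0_iff_ge)
  qed simp
qed

lemma off_edge_Z:
  assumes s: "valid s"
  shows "Wv j \<in> edge s \<Longrightarrow> point s (Zv j) = lex_bound P ord False (Zv j)"
    and "Vv j \<in> edge s \<Longrightarrow> point s (Zv j) = lex_bound P ord True (Zv j)"
  using s edge_cols[OF s, of j] unfolding valid_def by (auto simp: fixed_side_def)

lemma level0_Z:
  assumes s: "valid s"
  shows "Wv j \<in> edge s \<Longrightarrow> ereal (point s (Zv j) 0) = lbd P j"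
    and "Vv j \<in> edge s \<Longrightarrow> ereal (point s (Zv j) 0) = ubd P j"
proof -
  have "Wv j \<in> edge s \<Longrightarrow> lbd P j \<noteq> - \<infinity>" "Vv j \<in> edge s \<Longrightarrow> ubd P j \<noteq> \<infinity>"
    using edge_variables[OF s] by (metis subsetD variables_iff(5,6))+
  then show "Wv j \<in> edge s \<Longrightarrow> ereal (point s (Zv j) 0) = lbd P j"
    "Vv j \<in> edge s \<Longrightarrow> ereal (point s (Zv j) 0) = ubd P j"
    using off_edge_Z[OF s, of j] lower_finite[of "Zv j"] upper_finite[of "Zv j"]
    by (auto simp: lex_bound_lower lex_bound_upper has_bound_def lower_def upper_def)
qed

lemma level0_feasible:
  assumes s: "valid s" shows "zpart (\<lambda>y. point s y 0) \<in> feasible_set P"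
proof -
  let ?x = "\<lambda>y. point s y 0"
  have b: "lower P y \<le> ereal (?x y)" "ereal (?x y) \<le> upper P y" for y
    using level0_bounds[OF s] by (auto simp: within_bounds_def)
  have sys: "\<forall>i<nrows P. rowA P i \<bullet> zpart ?x - rhs P i = ?x (Sv i)"
    using s by (auto simp: valid_def solves_system_def)
  have "?x (Sv i) \<in> factor_set (fac P i)" if "i < nrows P" for i
    using b[of "Sv i"] that by (cases "fac P i") (auto simp: lower_def upper_def)
  moreover have "lbd P j \<le> ereal (?x (Zv j)) \<and> ereal (?x (Zv j)) \<le> ubd P j" for j
    using b[of "Zv j"] by (auto simp: lower_def upper_def)
  ultimately show ?thesis using sys by (auto simp: feasible_set_def)
qed

text \<open>Every product of a multiplier and a constraint gap has the right sign: a multiplier off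
  the edge vanishes at level 0, and one on the edge belongs to an active constraint.\<close>

lemma level0_normal:
  assumes s: "valid s"
  shows "mpart P (\<lambda>y. point s y 0) \<in> normal_cone (feasible_set P) (zpart (\<lambda>y. point s y 0))"
  unfolding normal_cone_def
proof (intro CollectI ballI)
  let ?x = "\<lambda>y. point s y 0"
  fix z assume z: "z \<in> feasible_set P"
  have b: "lower P y \<le> ereal (?x y)" "ereal (?x y) \<le> upper P y" for y
    using level0_bounds[OF s] by (auto simp: within_bounds_def)
  have "- ?x (Lv i) * (rowA P i \<bullet> (z - zpart ?x)) \<le> 0" if i: "i < nrows P" for i
  proof (cases "Lv i \<in> edge s")
    case True
    then have "?x (Sv i) = 0" using edge_rows[OF s i] by (intro off_edge_zero[OF s]) auto
    then have r: "rowA P i \<bullet> (z - zpart ?x) = rowA P i \<bullet> z - rhs P i"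
      using s i by (auto simp: valid_def solves_system_def inner_diff_right)
    have "rowA P i \<bullet> z - rhs P i \<in> factor_set (fac P i)" using z i by (auto simp: feasible_set_def)
    then show ?thesis
      unfolding r using b[of "Lv i"] i
      by (cases "fac P i") (auto simp: lower_def upper_def mult_nonneg_nonneg mult_nonpos_nonpos)
  next
    case False
    then have "?x (Lv i) = 0" by (intro off_edge_zero[OF s]) auto
    then show ?thesis by simp
  qed
  moreover have "(?x (Vv j) - ?x (Wv j)) * (z - zpart ?x) $ j \<le> 0" for j
  proof -
    have z': "lbd P j \<le> ereal (z $ j)" "ereal (z $ j) \<le> ubd P j" using z by (auto simp: feasible_set_def)
    have nn: "0 \<le> ?x (Vv j)" "0 \<le> ?x (Wv j)" using b[of "Vv j"] b[of "Wv j"] by (auto simp: lower_def)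
    consider "Zv j \<in> edge s" | "Wv j \<in> edge s" | "Vv j \<in> edge s" using edge_cols[OF s, of j] by blast
    then show ?thesis
    proof cases
      case 1
      then have "?x (Vv j) = 0" "?x (Wv j) = 0"
        using edge_cols[OF s, of j] by (auto intro!: off_edge_zero[OF s])
      then show ?thesis by simp
    next
      case 2
      then have "?x (Vv j) = 0" using edge_cols[OF s, of j] by (auto intro!: off_edge_zero[OF s])
      moreover have "?x (Zv j) \<le> z $ j" using level0_Z(1)[OF s 2] z' by (metis ereal_less_eq(3))
      ultimately show ?thesis using nn by (simp add: mult_nonpos_nonneg)
    next
      case 3
      then have "?x (Wv j) = 0" using edge_cols[OF s, of j] by (auto intro!: off_edge_zero[OF s])
      moreover have "z $ j \<le> ?x (Zv j)" using level0_Z(2)[OF s 3] z' by (metis ereal_less_eq(3))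
      ultimately show ?thesis using nn by (simp add: mult_nonneg_nonpos)
    qed
  qed
  ultimately show "mpart P ?x \<bullet> (z - zpart ?x) \<le> 0"
    unfolding mpart_inner by (intro add_nonpos_nonpos sum_nonpos) auto
qed

lemma stops_at_t_zero:
  assumes s: "valid s" and t: "point s Tv 0 = 0"
  shows "stops_at_solution P M q s"
proof -
  let ?x = "\<lambda>y. point s y 0"
  have "M *v zpart ?x + q + mpart P ?x = 0" using s t by (auto simp: valid_def solves_system_def)
  then have "mpart P ?x = - (M *v zpart ?x + q)" by (simp add: add_eq_0_iff)
  then have "avi_solution (feasible_set P) q M (zpart ?x)"
    unfolding avi_solution_iff using level0_feasible[OF s] level0_normal[OF s] by simp
  moreover have "closest_point (feasible_set P) (zpart ?x + mpart P ?x) = zpart ?x"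
    by (intro closest_point_add_normal convex_feasible_set closed_feasible_set level0_feasible[OF s]
        level0_normal[OF s])
  ultimately show ?thesis using t by (simp add: stops_at_solution_def)
qed

end

section \<open>A run from the starting ray\<close>

locale pathavi_run =
  fixes P :: "'n::finite rep" and M :: "real^'n^'n" and q zbar r :: "real^'n"
    and ord :: "'n var list" and s0 :: "'n state"
  assumes start: "start P M q zbar r ord s0"
    and zbar: "zbar \<in> feasible_set P"
    and r_interior: "r \<in> interior (normal_cone (feasible_set P) zbar)"
    and lin: "lineality_space (feasible_set P) = {0}"
    and semi: "semimonotone M (recession_cone (feasible_set P))"
    and copositive: "\<And>z. z \<noteq> 0 \<Longrightarrow> z \<in> recession_cone (feasible_set P) \<Longrightarrow>
        M *v z \<in> dual_cone (recession_cone (feasible_set P)) \<Longrightarrow> z \<bullet> (M *v z) = 0 \<Longrightarrow>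
        \<forall>z'\<in>feasible_set P. 0 \<le> z \<bullet> (M *v z' + q)"

sublocale pathavi_run \<subseteq> pivoting P M q r ord "basis s0"
proof
  show "is_basis P M r (basis s0)" "complementary P (basis s0)" "distinct ord" "set ord = basis s0"
    using start by (auto simp: start_def vertex_basis_def)
  show "\<And>i. i < nrows P \<Longrightarrow> fac P i = Zero \<Longrightarrow> Lv i \<notin> basis s0 \<Longrightarrow>
        rowA P i \<in> span {rowA P k |k. k < nrows P \<and> fac P k = Zero \<and> Lv k \<in> basis s0}"
    using start unfolding start_def vertex_basis_def by blast
  show "feasible_set P \<noteq> {}" using zbar by auto
qed

context pathavi_run
begin

abbreviation "C \<equiv> feasible_set P"
abbreviation "B0 \<equiv> basis s0"

text \<open>As r is interior, r + c v is still normal for a small c > 0; pairing it with v leaves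
  the margin c |v|^2.\<close>

lemma r_strict:
  assumes v: "zbar + \<delta> *\<^sub>R v \<in> C" "0 < \<delta>" "v \<noteq> 0" shows "r \<bullet> v < 0"
proof -
  obtain e where e: "0 < e" "cball r e \<subseteq> normal_cone C zbar"
    using r_interior by (auto simp: mem_interior_cball)
  define c where "c = e / norm v"
  have c: "0 < c" using e v by (simp add: c_def)
  have "dist r (r + c *\<^sub>R v) \<le> e" using e v by (simp add: dist_norm c_def)
  then have "r + c *\<^sub>R v \<in> normal_cone C zbar" using e by auto
  then have "(r + c *\<^sub>R v) \<bullet> (\<delta> *\<^sub>R v) \<le> 0" using v by (fastforce simp: normal_cone_def)
  then have "r \<bullet> v + c * (v \<bullet> v) \<le> 0"
    using v(2) by (simp add: inner_add_left mult_le_0_iff)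
  moreover have "0 < c * (v \<bullet> v)" using c v by simp
  ultimately show ?thesis by linarith
qed

lemma recession_add: "k \<in> recession_cone C \<Longrightarrow> x \<in> C \<Longrightarrow> x + 1 *\<^sub>R k \<in> C"
  unfolding recession_cone_def by (metis (mono_tags, lifting) mem_Collect_eq zero_le_one)

lemma r_recession: "k \<in> recession_cone C \<Longrightarrow> k \<noteq> 0 \<Longrightarrow> r \<bullet> k < 0"
  using r_strict[of 1 k] recession_add[OF _ zbar] by simp

text \<open>Scaling by \<open>- t\<close> maps the open interior of the normal cone into the dual
  cone, so the image of r is interior to it.\<close>

lemma minus_r_dual: assumes "0 < t" shows "- t *\<^sub>R r \<in> rel_interior (dual_cone (recession_cone C))"
proof -
  let ?N = "interior (normal_cone C zbar)"
  have "(\<lambda>y. (- t) *\<^sub>R y) ` ?N \<subseteq> dual_cone (recession_cone C)"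
  proof (rule image_subsetI)
    fix y assume "y \<in> ?N"
    then have y: "y \<in> normal_cone C zbar" using interior_subset by blast
    have "y \<bullet> k \<le> 0" if "k \<in> recession_cone C" for k
    proof -
      have "zbar + 1 *\<^sub>R k \<in> C" using recession_add[OF that zbar] .
      then show ?thesis using y by (fastforce simp: normal_cone_def)
    qed
    then show "(- t) *\<^sub>R y \<in> dual_cone (recession_cone C)"
      using assms by (auto simp: dual_cone_def mult_nonneg_nonpos)
  qed
  moreover have "open ((\<lambda>y. (- t) *\<^sub>R y) ` ?N)" using assms by (intro open_scaling) auto
  ultimately have "(\<lambda>y. (- t) *\<^sub>R y) ` ?N \<subseteq> interior (dual_cone (recession_cone C))"
    by (rule interior_maximal)
  then have "(- t) *\<^sub>R r \<in> interior (dual_cone (recession_cone C))" using r_interior by blast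
  then show ?thesis using interior_subset_rel_interior by blast
qed

text \<open>0 belongs to the recession cone, so every recession direction of that cone is a member
  of it.\<close>

lemma lineality_recession: "lineality_space (recession_cone C) \<subseteq> {0}"
proof -
  have "0 \<in> recession_cone C" by (auto simp: recession_cone_def)
  then have "recession_cone (recession_cone C) \<subseteq> recession_cone C"
    unfolding recession_cone_def[of "recession_cone C"] by (auto dest!: bspec[of _ _ 0] spec[of _ 1])
  then have "lineality_space (recession_cone C) \<subseteq> lineality_space C"
    unfolding lineality_space_def by auto
  then show ?thesis using lin by simp
qed

lemma start_system:
  "solves_system P M q r (\<lambda>y. point s0 y 0)" "within_bounds P (\<lambda>y. point s0 y 0)"
  "zpart (\<lambda>y. point s0 y 0) = zbar"
  "\<And>y. y \<notin> B0 \<Longrightarrow> y \<noteq> Tv \<Longrightarrow> y \<notin> range Zv \<Longrightarrow> point s0 y 0 = 0"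
  "\<And>j. Wv j \<in> B0 \<Longrightarrow> ereal (point s0 (Zv j) 0) = lbd P j"
  "\<And>j. Vv j \<in> B0 \<Longrightarrow> ereal (point s0 (Zv j) 0) = ubd P j"
  "\<And>y k. point s0 y (Suc k) = 0" "entering s0 = Tv" "sense s0 = - 1"
  using start by (auto simp: start_def starting_ray_point_def)

lemma B0_rows: "i < nrows P \<Longrightarrow> (Sv i \<in> B0) \<noteq> (Lv i \<in> B0)"
  using compl0 by (auto simp: complementary_iff)

lemma B0_cols: "Zv j \<in> B0 \<and> Wv j \<notin> B0 \<and> Vv j \<notin> B0 \<or> Zv j \<notin> B0 \<and> Wv j \<in> B0 \<and> Vv j \<notin> B0 \<or>
    Zv j \<notin> B0 \<and> Wv j \<notin> B0 \<and> Vv j \<in> B0"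
  using compl0 by (auto simp: complementary_iff)

lemma Tv_notin_B0: "Tv \<notin> B0"
  using compl0 by (auto simp: complementary_iff)

lemma start_bounds:
  assumes "has_bound P u y" shows "0 \<le> sg u * (bnd u y - point s0 y 0)"
proof -
  have "lower P y \<le> ereal (point s0 y 0)" "ereal (point s0 y 0) \<le> upper P y"
    using start_system(2) by (auto simp: within_bounds_def)
  then show ?thesis using assms unfolding bound_iff by (cases u) auto
qed

lemma valid_start: "valid s0"
proof -
  have E: "edge s0 = insert Tv B0" by (simp add: edge_def start_system)
  have hom: "solves_homogeneous P M r (\<lambda>y. point s0 y (Suc k))" for k
    using start_system(7) by simp
  have off: "point s0 y = lex_bound P ord (fixed_side P (edge s0) y) y" if y: "y \<notin> edge s0" for y
  proof
    fix k
    have yB: "y \<notin> B0" "y \<noteq> Tv" using y E by auto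
    show "point s0 y k = lex_bound P ord (fixed_side P (edge s0) y) y k"
    proof (cases k)
      case (Suc l)
      then show ?thesis using yB ord by (simp add: start_system lex_bound_notin)
    next
      case 0
      show ?thesis
      proof (cases "y \<in> range Zv")
        case True
        then obtain j where j: "y = Zv j" by auto
        have "Wv j \<in> B0 \<and> Vv j \<notin> B0 \<or> Vv j \<in> B0" using B0_cols[of j] yB j by auto
        then show ?thesis
          using start_system(5,6)[of j] 0 j
          by (auto simp: E fixed_side_def lex_bound_lower lex_bound_upper lower_def upper_def
              dest!: arg_cong[of "ereal _" _ real_of_ereal])
      next
        case False
        then show ?thesis using yB 0 by (simp add: start_system fixed_bound_zero)
      qed
    qed
  qed
  \<comment> \<open>The tableau starts without infinitesimals. A basic variable at its bound gets
    its positive slack from the relaxation of that bound, at its own position in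
    \<open>ord\<close>.\<close>
  have inside: "lpos (slack P ord (point s0) u y)" if y: "y \<in> B0" and u: "has_bound P u y" for y u
  proof -
    have eq: "slack P ord (point s0) u y =
        case_nat (sg u * (bnd u y - point s0 y 0)) (\<lambda>k. if k < length ord \<and> ord ! k = y then 1 else 0)"
      by (auto simp: fun_eq_iff slack_def lex_bound_0 lex_bound_Suc start_system sg_def split: nat.split)
    obtain l where l: "l < length ord" "ord ! l = y" using y ord by (metis in_set_conv_nth)
    then have "lpos (\<lambda>k. if k < length ord \<and> ord ! k = y then 1 else 0)"
      unfolding lpos_def using ord(1) by (intro exI[of _ l]) (auto simp: nth_eq_iff_index_eq)
    then show ?thesis unfolding eq using start_bounds[OF u] by (rule lpos_shift[rotated])
  qed
  have T: "lnn (slack P ord (point s0) u Tv)" if u: "has_bound P u Tv" for u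
  proof -
    have "slack P ord (point s0) u Tv = case_nat (sg u * (bnd u Tv - point s0 Tv 0)) (\<lambda>k. 0)"
      using Tv_notin_B0 ord by (auto simp: fun_eq_iff slack_def lex_bound_0 lex_bound_notin start_system split: nat.split)
    then show ?thesis using start_bounds[OF u] lnn_shift by simp
  qed
  show ?thesis
    unfolding valid_def
  proof (intro conjI)
    have "insert Tv B0 - {Tv} = B0" using Tv_notin_B0 by auto
    then show "complementary P (edge s0 - {Tv})" using compl0 by (simp add: E)
  qed (use basis0 Tv_notin_B0 start_system hom off inside T in \<open>auto simp: E\<close>)
qed

lemma start_edge: "edge s0 = insert Tv B0"
  by (simp add: edge_def start_system)

text \<open>\<open>a0\<close> is the direction of the starting ray per unit of \<open>t\<close>. The
  ray has points for all larger \<open>t\<close>, so no bound stops it, and it stays over one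
  extreme point, so z does not move.\<close>

lemma start_ray:
  "\<exists>a0. solves_homogeneous P M r a0 \<and> a0 Tv = 1 \<and> zpart a0 = 0 \<and>
     (\<forall>y. y \<notin> insert Tv B0 \<longrightarrow> a0 y = 0) \<and> (\<forall>y u. has_bound P u y \<longrightarrow> sg u * a0 y \<le> 0) \<and>
     pivot_direction P M r s0 (\<lambda>y. - a0 y)"
proof -
  obtain d0 where d0: "pivot_direction P M r s0 d0" using direction_exists[OF valid_start] by blast
  define a0 where "a0 = (\<lambda>y. - d0 y)"
  define x0 where "x0 = (\<lambda>y. point s0 y 0)"
  have ray: "\<exists>x. starting_ray_point P M q zbar r B0 x \<and> (\<forall>y. x y = x0 y + a * a0 y)" if a: "0 \<le> a" for a
  proof -
    have "point s0 Tv 0 \<le> point s0 Tv 0 + a" using a by simp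
    then obtain x where x: "starting_ray_point P M q zbar r B0 x" "x Tv = x0 Tv + a"
      using start unfolding start_def x0_def by blast
    have sx: "solves_system P M q r x" "zpart x = zbar" using x by (auto simp: starting_ray_point_def)
    have Z: "x (Zv j) = x0 (Zv j)" for j
      using sx(2) start_system(3) by (metis zpart_nth x0_def)
    have h: "solves_homogeneous P M r (\<lambda>y. x y - x0 y)"
      using solves_system_diff[OF sx(1)] start_system(1) by (simp add: x0_def)
    have "x y - x0 y = (x Tv - x0 Tv) / sense s0 * d0 y" for y
      unfolding start_system(8)[symmetric]
    proof (rule homogeneous_on_edge[OF valid_start d0 h])
      fix y assume "y \<notin> edge s0"
      then have y: "y \<notin> B0" "y \<noteq> Tv" by (auto simp: start_edge)
      show "x y - x0 y = 0"
      proof (cases "y \<in> range Zv")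
        case False
        then have "x y = 0" using x y by (auto simp: starting_ray_point_def)
        then show ?thesis using start_system(4)[OF y False] by (simp add: x0_def)
      qed (use Z in auto)
    qed
    then have "x y = x0 y + a * a0 y" for y
      using x(2) start_system(9) by (simp add: a0_def algebra_simps)
    then show ?thesis using x by blast
  qed
  have 1: "solves_homogeneous P M r a0"
    using d0 solves_homogeneous_scale[of P M r d0 "-1"] by (simp add: a0_def pivot_direction_def)
  have 2: "a0 Tv = 1" using d0 start_system by (simp add: a0_def pivot_direction_def)
  have 3: "zpart a0 = 0"
  proof -
    obtain x where x: "zpart x = zbar" "\<And>y. x y = x0 y + 1 * a0 y"
      using ray[of 1] by (auto simp: starting_ray_point_def)
    have "a0 (Zv j) = 0" for j
      using x(2)[of "Zv j"] x(1) start_system(3) by (metis zpart_nth x0_def add_cancel_right_right mult_1)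
    then show ?thesis by (simp add: vec_eq_iff)
  qed
  have 4: "a0 y = 0" if "y \<notin> insert Tv B0" for y
    using direction_off_edge[OF d0] that by (simp add: a0_def start_edge)
  have 5: "sg u * a0 y \<le> 0" if u: "has_bound P u y" for u y
  proof -
    have "- sg u * bnd u y \<le> - sg u * x0 y + t * (- sg u * a0 y)" if t: "0 \<le> t" for t
    proof -
      obtain x where x: "within_bounds P x" "\<And>y. x y = x0 y + t * a0 y"
        using ray[OF t] by (auto simp: starting_ray_point_def)
      then have "lower P y \<le> ereal (x y)" "ereal (x y) \<le> upper P y" by (auto simp: within_bounds_def)
      then have "0 \<le> sg u * (bnd u y - x y)" using u unfolding bound_iff by (cases u) auto
      then show ?thesis by (simp add: x(2) algebra_simps)
    qed
    then have "0 \<le> - sg u * a0 y" by (rule ray_bounded_below)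
    then show ?thesis by simp
  qed
  show ?thesis using 1 2 3 4 5 d0 by (intro exI[of _ a0]) (simp add: a0_def)
qed

text \<open>The columns of the multipliers in \<open>B0\<close> are independent. Of the two bound
  multipliers of a component \<open>mpart\<close> shows only the difference, hence the form of the
  second conclusion.\<close>

lemma mpart_inj:
  assumes eq: "mpart P x = mpart P x'"
    and L: "\<And>i. i < nrows P \<Longrightarrow> Lv i \<notin> B0 \<Longrightarrow> x (Lv i) = x' (Lv i)"
    and Z: "\<And>j. Zv j \<in> B0 \<Longrightarrow> x (Vv j) - x (Wv j) = x' (Vv j) - x' (Wv j)"
  shows "i < nrows P \<Longrightarrow> x (Lv i) = x' (Lv i)" and "x (Vv j) - x (Wv j) = x' (Vv j) - x' (Wv j)"
proof -
  define D where "D j = (x (Vv j) - x (Wv j)) - (x' (Vv j) - x' (Wv j))" for j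
  \<comment> \<open>The difference of the two multiplier vectors, moved onto the members of
    \<open>B0\<close>; \<open>Wv j\<close> enters \<open>mpart\<close> with a minus sign.\<close>
  define w where "w y = (case y of
      Lv i \<Rightarrow> if i < nrows P then x (Lv i) - x' (Lv i) else 0
    | Wv j \<Rightarrow> if Wv j \<in> B0 then - D j else 0
    | Vv j \<Rightarrow> if Vv j \<in> B0 then D j else 0
    | _ \<Rightarrow> 0)" for y
  have "mpart P w = mpart P x - mpart P x'"
  proof (rule vec_eq_iff[THEN iffD2], rule allI)
    fix j
    have "w (Vv j) - w (Wv j) = D j"
      using B0_cols[of j] Z[of j] by (auto simp: w_def D_def)
    moreover have "(\<Sum>i<nrows P. w (Lv i) * rowA P i $ j) =
        (\<Sum>i<nrows P. x (Lv i) * rowA P i $ j) - (\<Sum>i<nrows P. x' (Lv i) * rowA P i $ j)"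
      unfolding sum_subtractf[symmetric] by (intro sum.cong) (auto simp: w_def algebra_simps)
    ultimately show "mpart P w $ j = (mpart P x - mpart P x') $ j"
      by (simp add: mpart_def D_def)
  qed
  moreover have "zpart w = 0" "w Tv = 0" "\<And>i. w (Sv i) = 0" by (auto simp: vec_eq_iff w_def)
  ultimately have "solves_homogeneous P M r w" using eq by (simp add: solves_homogeneous_def)
  moreover have "w y = 0" if "y \<notin> B0" for y
    using that L by (cases y) (auto simp: w_def)
  ultimately have 0: "w y = 0" for y using is_basis_zero[OF basis0] by blast
  show "i < nrows P \<Longrightarrow> x (Lv i) = x' (Lv i)" using 0[of "Lv i"] by (simp add: w_def)
  show "x (Vv j) - x (Wv j) = x' (Vv j) - x' (Wv j)"
    using 0[of "Vv j"] 0[of "Wv j"] B0_cols[of j] Z[of j] by (auto simp: w_def D_def)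
qed

text \<open>The n basic multipliers have independent gradients, so these span the space and only 0
  is orthogonal to all of them.\<close>

lemma initial_gradients_span:
  assumes L: "\<And>i. i < nrows P \<Longrightarrow> Lv i \<in> B0 \<Longrightarrow> rowA P i \<bullet> v = 0"
    and VW: "\<And>j. Vv j \<in> B0 \<or> Wv j \<in> B0 \<Longrightarrow> v $ j = 0"
  shows "v = 0"
proof (rule ccontr)
  assume "v \<noteq> 0"
  then obtain j0 where j0: "v $ j0 \<noteq> 0" by (auto simp: vec_eq_iff)
  define J where "J = {y \<in> B0. is_multiplier y}"
  have J: "finite J" "card J = CARD('n)"
    using start is_basis_finite[OF basis0] by (auto simp: J_def start_def vertex_basis_def)
  let ?a = "\<lambda>j y. residual P M r (\<lambda>z. if z = y then 1 else 0) (Inl j)"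
  \<comment> \<open>With n multipliers against n - 1 coordinates, some combination has its gradient
    along coordinate \<open>j0\<close> alone; orthogonality to \<open>v\<close> kills that
    coordinate too.\<close>
  have "card (UNIV - {j0}) < card J" using J by (simp add: card_Diff_singleton)
  then obtain c where c: "\<exists>y\<in>J. c y \<noteq> 0" "\<forall>y. y \<notin> J \<longrightarrow> c y = 0"
      "\<forall>j\<in>UNIV - {j0}. (\<Sum>y\<in>J. ?a j y * c y) = 0"
    using underdetermined_nontrivial_solution[of "UNIV - {j0}" J ?a] J by auto
  have nz: "c (Zv j) = 0" "c Tv = 0" "c (Sv i) = 0" for i j using c(2) by (auto simp: J_def)
  have z: "zpart c = 0" by (simp add: vec_eq_iff nz)
  have "mpart P c $ j = residual P M r c (Inl j)" for j
    using z nz by (simp add: residual_def)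
  then have m: "mpart P c $ j = 0" if "j \<noteq> j0" for j
    using residual_eq_sum[OF J(1), of c P M r "Inl j"] c that by simp
  have "mpart P c \<bullet> v = 0"
  proof -
    have "- c (Lv i) * (rowA P i \<bullet> v) = 0" if "i < nrows P" for i
      using L[OF that] c(2) by (cases "Lv i \<in> B0") (auto simp: J_def)
    moreover have "(c (Vv j) - c (Wv j)) * v $ j = 0" for j
      using VW[of j] c(2) by (cases "Vv j \<in> B0 \<or> Wv j \<in> B0") (auto simp: J_def)
    ultimately show ?thesis unfolding mpart_inner by (simp add: sum.neutral del: mult_eq_0_iff mult_minus_left)
  qed
  moreover have "mpart P c \<bullet> v = mpart P c $ j0 * v $ j0"
  proof -
    have "mpart P c \<bullet> v = (\<Sum>j\<in>UNIV. if j = j0 then mpart P c $ j0 * v $ j0 else 0)"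
      unfolding inner_vec_def using m by (intro sum.cong) auto
    then show ?thesis by simp
  qed
  ultimately have "mpart P c = 0" using m j0 by (auto simp: vec_eq_iff) metis
  then have "solves_homogeneous P M r c" using z nz by (simp add: solves_homogeneous_def)
  then have "c y = 0" for y using is_basis_zero[OF basis0] c(2) by (auto simp: J_def)
  then show False using c(1) by auto
qed

section \<open>Deviation from the initial extreme point, level by level\<close>

definition dev :: "'n state \<Rightarrow> nat \<Rightarrow> real^'n" where
  "dev s k = zpart (\<lambda>y. point s y k) - (if k = 0 then zbar else 0)"

lemma level_value:
  assumes s: "valid s" and y: "y \<in> primal P"
  shows "point s y k = grad P y (dev s k) + (if k = 0 then val P y zbar else 0)"
proof (cases k)
  case 0
  then show ?thesis
    using s y unfolding valid_def solves_system_def primal_def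
    by (auto simp: grad_def val_def dev_def inner_diff_right)
next
  case (Suc l)
  have "solves_homogeneous P M r (\<lambda>y. point s y (Suc l))" using s by (simp add: valid_def)
  then show ?thesis
    using y Suc unfolding solves_homogeneous_def primal_def
    by (auto simp: grad_def dev_def)
qed

text \<open>With vanishing lower deviations and an active, unrelaxed bound, level \<open>k\<close>
  is the first at which the slack can be nonzero, and feasibility fixes its sign there.\<close>

lemma deviation_sign:
  assumes s: "valid s" and y: "y \<in> primal P" and u: "has_bound P u y"
    and 0: "\<And>i. i < k \<Longrightarrow> dev s i = 0" and unrel: "\<And>i. i < k \<Longrightarrow> lex_bound P ord u y (Suc i) = 0"
    and active: "bnd u y = val P y zbar"
  shows "sg u * grad P y (dev s k) \<le> 0"
proof -
  have g0: "grad P y 0 = 0" using grad_scale[of P y 0 0] by simp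
  have eq: "slack P ord (point s) u y i = - sg u * grad P y (dev s i)" if "i \<le> k" for i
  proof (cases i)
    case 0
    then show ?thesis using level_value[OF s y, of 0] active by (simp add: slack_def lex_bound_0 algebra_simps)
  next
    case (Suc l)
    then show ?thesis using level_value[OF s y, of i] unrel[of l] that by (simp add: slack_def)
  qed
  have "0 \<le> slack P ord (point s) u y k"
    by (rule lnn_nonneg[OF feasible_tableau[OF s u]]) (use eq 0 g0 in auto)
  then show ?thesis using eq[of k] by simp
qed

text \<open>A variable off the edge sits on its relaxed bound, which the extreme point does not
  exceed: the deviation points outwards at every level, by exactly 1 at the level of the variable's
  own relaxation.\<close>

lemma fixed_gap:
  assumes s: "valid s" and y: "y \<in> primal P" "y \<notin> edge s"
  defines "u \<equiv> fixed_side P (edge s) y"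
  shows "has_bound P u y" and "0 \<le> sg u * grad P y (dev s k)"
    and "k = Suc l \<Longrightarrow> l < length ord \<Longrightarrow> ord ! l = y \<Longrightarrow> sg u * grad P y (dev s k) = 1"
    and "k = Suc l \<Longrightarrow> y \<notin> B0 \<Longrightarrow> grad P y (dev s k) = 0"
proof -
  have X: "point s y = lex_bound P ord u y" using s y by (simp add: valid_def u_def)
  show hb: "has_bound P u y"
  proof -
    have "Wv j \<in> edge s \<Longrightarrow> lbd P j \<noteq> - \<infinity>" "Vv j \<in> edge s \<Longrightarrow> ubd P j \<noteq> \<infinity>" for j
      using edge_variables[OF s] by (metis subsetD variables_iff(5,6))+
    then show ?thesis
      using y edge_cols[OF s] unfolding u_def primal_def
      by (auto simp: fixed_side_def has_bound_def lower_def upper_def split: if_splits) blast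
  qed
  have later: "grad P y (dev s k) = sg u * (if l < length ord \<and> ord ! l = y then 1 else 0)" if "k = Suc l" for l
    using level_value[OF s y(1), of k] that X by (auto simp: lex_bound_def sg_def)
  show "0 \<le> sg u * grad P y (dev s k)"
  proof (cases k)
    case 0
    have "0 \<le> sg u * (bnd u y - val P y zbar)" using zbar y(1) hb by (auto simp: feasible_iff_slack)
    then show ?thesis using level_value[OF s y(1), of k] X 0 by (simp add: lex_bound_0 algebra_simps)
  next
    case (Suc l)
    show ?thesis unfolding later[OF Suc] by (simp add: sg_def)
  qed
  show "k = Suc l \<Longrightarrow> l < length ord \<Longrightarrow> ord ! l = y \<Longrightarrow> sg u * grad P y (dev s k) = 1"
    using later by (simp add: sg_def)
  show "k = Suc l \<Longrightarrow> y \<notin> B0 \<Longrightarrow> grad P y (dev s k) = 0"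
    using later ord(2) nth_mem by fastforce
qed

lemma row_gap:
  assumes s: "valid s" and i: "i < nrows P" "Lv i \<in> edge s"
  shows "fac P i = Nonneg \<Longrightarrow> rowA P i \<bullet> dev s k \<le> 0"
    and "fac P i = Nonpos \<Longrightarrow> 0 \<le> rowA P i \<bullet> dev s k"
    and "fac P i = Zero \<Longrightarrow> rowA P i \<bullet> dev s k = 0"
proof -
  have y: "Sv i \<in> primal P" "Sv i \<notin> edge s" using i edge_rows[OF s i(1)] by (auto simp: primal_def)
  have g: "grad P (Sv i) v = rowA P i \<bullet> v" for v by (simp add: grad_def)
  note G = fixed_gap(2,4)[OF s y, where k = k, unfolded g]
  show "fac P i = Nonneg \<Longrightarrow> rowA P i \<bullet> dev s k \<le> 0" using G(1) by (simp add: fixed_side_def)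
  show "fac P i = Nonpos \<Longrightarrow> 0 \<le> rowA P i \<bullet> dev s k" using G(1) by (simp add: fixed_side_def)
  assume z: "fac P i = Zero"
  then have "Sv i \<notin> B0" using s i y by (auto simp: valid_def edge_def)
  show "rowA P i \<bullet> dev s k = 0"
  proof (cases k)
    case (Suc l)
    then show ?thesis using G(2) \<open>Sv i \<notin> B0\<close> by blast
  next
    case 0
    have "point s (Sv i) 0 = 0" using y by (intro off_edge_zero[OF s]) auto
    moreover have "val P (Sv i) zbar = 0" using zbar i z by (auto simp: feasible_set_def val_def)
    ultimately show ?thesis using level_value[OF s y(1), of k] 0 by (simp add: g)
  qed
qed

lemma col_gap:
  assumes s: "valid s"
  shows "Wv j \<in> edge s \<Longrightarrow> dev s k $ j \<le> 0" and "Vv j \<in> edge s \<Longrightarrow> 0 \<le> dev s k $ j"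
proof -
  have g: "grad P (Zv j) v = v $ j" for v by (simp add: grad_def)
  have y: "Zv j \<in> primal P" by (auto simp: primal_def)
  show "Wv j \<in> edge s \<Longrightarrow> dev s k $ j \<le> 0"
    using fixed_gap(2)[OF s y, of k] edge_cols[OF s, of j] by (auto simp: g fixed_side_def)
  show "Vv j \<in> edge s \<Longrightarrow> 0 \<le> dev s k $ j"
    using fixed_gap(2)[OF s y, of k] edge_cols[OF s, of j] by (auto simp: g fixed_side_def)
qed

lemma multiplier_pairing_rows:
  assumes s: "valid s" and i: "i < nrows P"
    and off: "Lv i \<notin> edge s \<Longrightarrow> c = (\<lambda>k. 0)"
    and sign: "fac P i = Nonneg \<Longrightarrow> lnn c" "fac P i = Nonpos \<Longrightarrow> lnn (\<lambda>k. - c k)"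
  shows "lnn (\<lambda>k'. - c k' * (rowA P i \<bullet> dev s k))"
proof (cases "Lv i \<in> edge s")
  case True
  note R = row_gap[OF s i True, of k]
  show ?thesis
  proof (cases "fac P i")
    case Nonneg
    show ?thesis using lnn_scale[OF sign(1)[OF Nonneg], of "- (rowA P i \<bullet> dev s k)"] R(1)[OF Nonneg]
      by (simp add: mult.commute)
  next
    case Nonpos
    show ?thesis using lnn_scale[OF sign(2)[OF Nonpos], of "rowA P i \<bullet> dev s k"] R(2)[OF Nonpos]
      by (simp add: mult.commute)
  qed (use R in simp)
qed (use off in simp)

lemma multiplier_pairing_cols:
  assumes s: "valid s"
    and off: "Wv j \<notin> edge s \<Longrightarrow> w = (\<lambda>k. 0)" "Vv j \<notin> edge s \<Longrightarrow> v = (\<lambda>k. 0)"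
    and sign: "lnn w" "lnn v"
  shows "lnn (\<lambda>k'. (v k' - w k') * dev s k $ j)"
proof -
  consider "Zv j \<in> edge s" | "Wv j \<in> edge s" | "Vv j \<in> edge s" using edge_cols[OF s, of j] by blast
  then show ?thesis
  proof cases
    case 1
    then show ?thesis using off edge_cols[OF s, of j] by simp
  next
    case 2
    then have "v = (\<lambda>k. 0)" using off edge_cols[OF s, of j] by auto
    then show ?thesis using lnn_scale[OF sign(1), of "- dev s k $ j"] col_gap(1)[OF s 2, of k]
      by (simp add: mult.commute)
  next
    case 3
    then have "w = (\<lambda>k. 0)" using off edge_cols[OF s, of j] by auto
    then show ?thesis using lnn_scale[OF sign(2), of "dev s k $ j"] col_gap(2)[OF s 3, of k]
      by (simp add: mult.commute)
  qed
qed

text \<open>A multiplier on the edge has its constraint off the edge, so in each term of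
  \<open>mpart_inner\<close> the sign of the multiplier matches the outward deviation of the
  constraint.\<close>

lemma mpart_pairing:
  assumes s: "valid s"
    and off: "\<And>y k. y \<notin> edge s \<Longrightarrow> is_multiplier y \<Longrightarrow> c k y = 0"
    and rows: "\<And>i. i < nrows P \<Longrightarrow> fac P i = Nonneg \<Longrightarrow> lnn (\<lambda>k. c k (Lv i))"
      "\<And>i. i < nrows P \<Longrightarrow> fac P i = Nonpos \<Longrightarrow> lnn (\<lambda>k. - c k (Lv i))"
    and cols: "\<And>j. lnn (\<lambda>k. c k (Wv j))" "\<And>j. lnn (\<lambda>k. c k (Vv j))"
  shows "lnn (\<lambda>k'. mpart P (c k') \<bullet> dev s k)"
  unfolding mpart_inner
proof (intro lnn_add lnn_sum)
  fix i assume "i \<in> {..<nrows P}"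
  then have i: "i < nrows P" by simp
  show "lnn (\<lambda>k'. - c k' (Lv i) * (rowA P i \<bullet> dev s k))"
    by (rule multiplier_pairing_rows[OF s i]) (use off rows[OF i] in auto)
next
  fix j
  show "lnn (\<lambda>k'. (c k' (Vv j) - c k' (Wv j)) * dev s k $ j)"
    by (rule multiplier_pairing_cols[OF s]) (use off cols in auto)
qed

section \<open>Directions along which nothing blocks\<close>

context
  fixes s d
  assumes s: "valid s" and d: "pivot_direction P M r s d" and free: "\<And>y. \<not> blocking P d y"
begin

lemma ray_sign: "has_bound P u y \<Longrightarrow> sg u * d y \<le> 0"
  using free[of y] blocking_side[of P u y d] by force

lemma ray_hom: "M *v zpart d + mpart P d = d Tv *\<^sub>R r" "i < nrows P \<Longrightarrow> rowA P i \<bullet> zpart d = d (Sv i)"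
  using d by (auto simp: pivot_direction_def solves_homogeneous_def)

lemma ray_grad: "y \<in> primal P \<Longrightarrow> grad P y (zpart d) = d y"
  using ray_hom by (auto simp: primal_def grad_def)

lemma ray_recession: "zpart d \<in> recession_cone C"
  unfolding recession_cone_iff using ray_grad ray_sign by simp

lemma ray_multiplier_signs:
  "i < nrows P \<Longrightarrow> fac P i = Nonneg \<Longrightarrow> 0 \<le> d (Lv i)"
  "i < nrows P \<Longrightarrow> fac P i = Nonpos \<Longrightarrow> d (Lv i) \<le> 0"
  "0 \<le> d (Wv j)" "0 \<le> d (Vv j)" "0 \<le> d Tv"
  using ray_sign[of False "Lv i"] ray_sign[of True "Lv i"] ray_sign[of False "Wv j"] ray_sign[of False "Vv j"]
    ray_sign[of False Tv]
  by (auto simp: has_bound_def lower_def upper_def)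

lemma ray_dual: "- mpart P d \<in> dual_cone (recession_cone C)"
  unfolding dual_cone_def
proof (intro CollectI ballI)
  fix k assume k: "k \<in> recession_cone C"
  have g: "sg u * grad P y k \<le> 0" if "y \<in> primal P" "has_bound P u y" for y u
    using k that unfolding recession_cone_iff by blast
  have "- d (Lv i) * (rowA P i \<bullet> k) \<le> 0" if i: "i < nrows P" for i
  proof -
    have "Sv i \<in> primal P" "grad P (Sv i) k = rowA P i \<bullet> k" using i by (auto simp: primal_def grad_def)
    then have gi: "sg u * (rowA P i \<bullet> k) \<le> 0" if "has_bound P u (Sv i)" for u using g that by metis
    show ?thesis
      using ray_multiplier_signs(1,2)[OF i] gi[of True] gi[of False] i
      by (cases "fac P i") (auto simp: has_bound_def lower_def upper_def mult_nonpos_nonpos)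
  qed
  moreover have "(d (Vv j) - d (Wv j)) * k $ j \<le> 0" for j
  proof -
    have "Zv j \<in> primal P" "grad P (Zv j) k = k $ j" by (auto simp: primal_def grad_def)
    then have gj: "sg u * k $ j \<le> 0" if "has_bound P u (Zv j)" for u using g that by metis
    have "d (Vv j) * k $ j \<le> 0"
    proof (cases "d (Vv j) = 0")
      case False
      then have "ubd P j \<noteq> \<infinity>"
        using direction_off_edge[OF d] edge_variables[OF s] by (metis subsetD variables_iff(6))
      then show ?thesis
        using gj[of True] ray_multiplier_signs(4)[of j]
        by (auto simp: has_bound_def upper_def mult_nonneg_nonpos)
    qed simp
    moreover have "0 \<le> d (Wv j) * k $ j"
    proof (cases "d (Wv j) = 0")
      case False
      then have "lbd P j \<noteq> - \<infinity>"
        using direction_off_edge[OF d] edge_variables[OF s] by (metis subsetD variables_iff(5))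
      then show ?thesis
        using gj[of False] ray_multiplier_signs(3)[of j] by (auto simp: has_bound_def lower_def)
    qed simp
    ultimately show ?thesis by (simp add: left_diff_distrib)
  qed
  ultimately have "mpart P d \<bullet> k \<le> 0" unfolding mpart_inner by (intro add_nonpos_nonpos sum_nonpos) auto
  then show "0 \<le> - mpart P d \<bullet> k" by simp
qed

text \<open>For each constraint, either its multiplier is off the edge and vanishes, or the
  constraint itself is off the edge and does not move along the ray.\<close>

lemma ray_complementary:
  assumes x: "\<And>y. is_multiplier y \<Longrightarrow> y \<notin> edge s \<Longrightarrow> x y = 0"
  shows "mpart P x \<bullet> zpart d = 0"
proof -
  have d0: "d y = 0" if "y \<notin> edge s" for y using direction_off_edge[OF d that] .
  have "- x (Lv i) * (rowA P i \<bullet> zpart d) = 0" if i: "i < nrows P" for i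
    using edge_rows[OF s i] d0[of "Sv i"] x[of "Lv i"] ray_hom(2)[OF i] by auto
  moreover have "(x (Vv j) - x (Wv j)) * zpart d $ j = 0" for j
    using edge_cols[OF s, of j] d0[of "Zv j"] x[of "Vv j"] x[of "Wv j"] by auto
  ultimately show ?thesis
    unfolding mpart_inner by (simp add: sum.neutral del: mult_eq_0_iff mult_minus_left zpart_nth)
qed

lemma ray_z_constant:
  assumes t: "0 < point s Tv 0" shows "zpart d = 0"
proof (rule ccontr)
  assume nz: "zpart d \<noteq> 0"
  have rd: "r \<bullet> zpart d < 0" using r_recession[OF ray_recession nz] .
  have "d y = 0" if "y \<notin> edge s" for y using direction_off_edge[OF d that] .
  then have orth: "mpart P d \<bullet> zpart d = 0" by (intro ray_complementary) auto
  show False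
  proof (cases "d Tv = 0")
    case False
    then have t: "0 < d Tv" using ray_multiplier_signs(5) by simp
    let ?p = "- d Tv *\<^sub>R r"
    have Mp: "M *v zpart d + ?p = - mpart P d" using ray_hom(1) by (simp add: algebra_simps)
    have "zpart d \<in> {z \<in> recession_cone C. M *v z + ?p \<in> dual_cone (recession_cone C) \<and> z \<bullet> (M *v z + ?p) = 0}"
      using ray_recession ray_dual orth unfolding Mp[symmetric]
      by (simp add: Mp inner_commute del: scaleR_minus_left)
    then have "zpart d \<in> lineality_space (recession_cone C)"
      using semi minus_r_dual[OF t] unfolding semimonotone_def by blast
    then show False using lineality_recession nz by auto
  next
    case True
    then have Md: "M *v zpart d = - mpart P d" using ray_hom(1) by (simp add: eq_neg_iff_add_eq_0)
    let ?x = "\<lambda>y. point s y 0"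
    have "0 \<le> zpart d \<bullet> (M *v zpart ?x + q)"
      using copositive[OF nz ray_recession] ray_dual orth level0_feasible[OF s]
      by (simp add: Md inner_commute)
    moreover have "M *v zpart ?x + q = ?x Tv *\<^sub>R r - mpart P ?x"
      using s by (simp add: valid_def solves_system_def algebra_simps)
    moreover have "mpart P ?x \<bullet> zpart d = 0"
      by (rule ray_complementary, rule off_edge_zero[OF s]) auto
    \<comment> \<open>Pairing the system at the current point with \<open>zpart d\<close> leaves
      only the term of r, whose sign is strict.\<close>
    ultimately have "0 \<le> ?x Tv * (r \<bullet> zpart d)" by (simp add: inner_diff_right inner_commute)
    then show False using t rd by (simp add: zero_le_mult_iff)
  qed
qed

lemma d_nonzero: "d (entering s) \<noteq> 0"
  using s d by (auto simp: pivot_direction_def valid_def)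

context
  assumes dz: "zpart d = 0"
begin

lemma ray_primal_zero: "d (Zv j) = 0" "i < nrows P \<Longrightarrow> d (Sv i) = 0"
proof -
  show "d (Zv j) = 0" using dz by (metis zpart_nth zero_index)
  show "i < nrows P \<Longrightarrow> d (Sv i) = 0" using ray_hom(2)[of i] unfolding dz by simp
qed

lemma ray_mpart: "mpart P d = d Tv *\<^sub>R r"
  using ray_hom(1) dz by simp

lemma ray_pairing_terms:
  "i < nrows P \<Longrightarrow> 0 \<le> - d (Lv i) * (rowA P i \<bullet> dev s k)"
  "0 \<le> (d (Vv j) - d (Wv j)) * dev s k $ j"
proof -
  have d0: "d y = 0" if "y \<notin> edge s" for y using direction_off_edge[OF d that] .
  \<comment> \<open>Through constant sequences the lexicographic pairing lemmas cover plain
    numbers.\<close>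
  have c: "lnn (\<lambda>k::nat. x)" if "0 \<le> x" for x
    using that lpos_first[of "\<lambda>k. x"] by (cases "x = 0") (auto simp: lnn_def)
  show "0 \<le> - d (Lv i) * (rowA P i \<bullet> dev s k)" if i: "i < nrows P"
    using lnn_first[OF multiplier_pairing_rows[OF s i, of "\<lambda>k. d (Lv i)" k]]
      ray_multiplier_signs(1,2)[OF i] c d0 by auto
  show "0 \<le> (d (Vv j) - d (Wv j)) * dev s k $ j"
    using lnn_first[OF multiplier_pairing_cols[OF s, of j "\<lambda>k. d (Wv j)" "\<lambda>k. d (Vv j)" k]]
      ray_multiplier_signs(3,4) c d0 by auto
qed

lemma ray_pairing: "0 \<le> d Tv * (r \<bullet> dev s k)"
proof -
  have "0 \<le> mpart P d \<bullet> dev s k"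
    unfolding mpart_inner using ray_pairing_terms by (intro add_nonneg_nonneg sum_nonneg) auto
  then show ?thesis by (simp add: ray_mpart)
qed

text \<open>If \<open>t\<close> were constant as well, each level of the perturbation would kill the multipliers of
  the constraints relaxed at that level, and the others have independent gradients.\<close>

lemma ray_t_increases: "0 < d Tv"
proof (rule ccontr)
  assume "\<not> 0 < d Tv"
  then have T: "d Tv = 0" using ray_multiplier_signs(5) by simp
  have d0: "d y = 0" if "y \<notin> edge s" for y using direction_off_edge[OF d that] .
  have m0: "mpart P d = 0" by (simp add: ray_mpart T)
  have terms: "\<forall>i<nrows P. - d (Lv i) * (rowA P i \<bullet> dev s k) = 0"
      "\<forall>j. (d (Vv j) - d (Wv j)) * dev s k $ j = 0" for k
  proof -
    have "(\<Sum>i<nrows P. - d (Lv i) * (rowA P i \<bullet> dev s k)) + (\<Sum>j\<in>UNIV. (d (Vv j) - d (Wv j)) * dev s k $ j) = 0"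
      using m0 mpart_inner[of P d "dev s k"] by simp
    moreover have "0 \<le> (\<Sum>i<nrows P. - d (Lv i) * (rowA P i \<bullet> dev s k))"
      "0 \<le> (\<Sum>j\<in>UNIV. (d (Vv j) - d (Wv j)) * dev s k $ j)"
      using ray_pairing_terms by (auto intro!: sum_nonneg simp del: mult_minus_left)
    ultimately have "(\<Sum>i<nrows P. - d (Lv i) * (rowA P i \<bullet> dev s k)) = 0"
      "(\<Sum>j\<in>UNIV. (d (Vv j) - d (Wv j)) * dev s k $ j) = 0" by linarith+
    then show "\<forall>i<nrows P. - d (Lv i) * (rowA P i \<bullet> dev s k) = 0"
      "\<forall>j. (d (Vv j) - d (Wv j)) * dev s k $ j = 0"
      using ray_pairing_terms
        sum_nonneg_eq_0_iff[of "{..<nrows P}" "\<lambda>i. - d (Lv i) * (rowA P i \<bullet> dev s k)"]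
        sum_nonneg_eq_0_iff[of UNIV "\<lambda>j. (d (Vv j) - d (Wv j)) * dev s k $ j"]
      by (simp_all only: finite_lessThan lessThan_iff finite UNIV_I ball_UNIV) blast+
  qed
  have L: "d (Lv i) = 0" if i: "i < nrows P" "Lv i \<notin> B0" for i
  proof (cases "Lv i \<in> edge s")
    case True
    have y: "Sv i \<in> primal P" "Sv i \<notin> edge s" "Sv i \<in> set ord"
      using i True edge_rows[OF s i(1)] B0_rows[OF i(1)] ord by (auto simp: primal_def)
    then obtain l where l: "l < length ord" "ord ! l = Sv i" by (metis in_set_conv_nth)
    have "grad P (Sv i) (dev s (Suc l)) \<noteq> 0"
      using fixed_gap(3)[OF s y(1,2) refl l] by auto
    then show ?thesis using terms(1)[of "Suc l"] i(1) by (auto simp: grad_def)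
  qed (use d0 in simp)
  have VW: "d (Vv j) - d (Wv j) = 0" if j: "Zv j \<in> B0" for j
  proof (cases "Zv j \<in> edge s")
    case True
    then show ?thesis using edge_cols[OF s, of j] d0 by simp
  next
    case False
    obtain l where l: "l < length ord" "ord ! l = Zv j" using j ord by (metis in_set_conv_nth)
    have "grad P (Zv j) (dev s (Suc l)) \<noteq> 0"
      using fixed_gap(3)[OF s _ False refl l] by (auto simp: primal_def)
    then show ?thesis using terms(2)[of "Suc l"] by (auto simp: grad_def)
  qed
  have L0: "d (Lv i) = 0" if "i < nrows P" for i
    using mpart_inj(1)[of d "\<lambda>y. 0" i] m0 L VW that by simp
  have VW0: "d (Vv j) = d (Wv j)" for j
    using mpart_inj(2)[of d "\<lambda>y. 0" j] m0 L VW by simp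
  have "d y = 0" for y
  proof (cases "y \<in> edge s")
    case True
    then have v: "y \<in> variables P" using edge_variables[OF s] by auto
    have VW1: "d (Vv j) = 0 \<and> d (Wv j) = 0" for j
      using VW0[of j] d0[of "Vv j"] d0[of "Wv j"] edge_cols[OF s, of j] by auto
    show ?thesis
      using v L0 ray_primal_zero T VW1 by (cases y) auto
  qed (use d0 in simp)
  then show False using d_nonzero by simp
qed

text \<open>Without a deviation at this level the term of M is the one on the starting ray, so
  \<open>mpart\<close> depends on \<open>t\<close> alone; \<open>a0\<close>, whose
  \<open>mpart\<close> is r, accounts for that dependence.\<close>

lemma level_mpart:
  assumes a0: "solves_homogeneous P M r a0" "zpart a0 = 0" "a0 Tv = 1" and 0: "dev s k = 0"
  shows "mpart P (\<lambda>y. point s y k) =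
    mpart P (\<lambda>y. point s Tv k * a0 y + (if k = 0 then point s0 y 0 - point s0 Tv 0 * a0 y else 0))"
proof -
  have ma: "mpart P a0 = r" using a0 by (simp add: solves_homogeneous_def)
  show ?thesis
  proof (cases k)
    case z: 0
    let ?x = "\<lambda>y. point s y 0" and ?z = "\<lambda>y. point s0 y 0"
    have "zpart ?x = zbar" using 0 z by (simp add: dev_def)
    then have 1: "mpart P ?x = ?x Tv *\<^sub>R r - (M *v zbar + q)"
      using s by (simp add: valid_def solves_system_def algebra_simps)
    have 2: "mpart P ?z = ?z Tv *\<^sub>R r - (M *v zbar + q)"
      using start_system(1) unfolding solves_system_def start_system(3) by (simp add: algebra_simps)
    have "mpart P (\<lambda>y. ?x Tv * a0 y + (?z y - ?z Tv * a0 y)) =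
        mpart P (\<lambda>y. (?x Tv - ?z Tv) * a0 y + 1 * ?z y)" by (simp add: algebra_simps)
    also have "\<dots> = mpart P ?x" unfolding mpart_lincomb ma 1 2 by (simp add: algebra_simps)
    finally show ?thesis using z by simp
  next
    case (Suc l)
    have "solves_homogeneous P M r (\<lambda>y. point s y (Suc l))" using s by (simp add: valid_def)
    then have "mpart P (\<lambda>y. point s y k) = point s Tv k *\<^sub>R r"
      using 0 Suc by (simp add: solves_homogeneous_def dev_def)
    then show ?thesis using Suc mpart_lincomb[of P "point s Tv k" a0 0 a0] ma by simp
  qed
qed

end

end

section \<open>A ray with t > 0 lies on the initial edge\<close>

lemma fixed_side_multiplier: "is_multiplier y \<Longrightarrow> fixed_side P E y = fixed_side P {} y"
  by (cases y) (auto simp: fixed_side_def)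

lemma not_multiplier_primal: "y \<in> primal P \<Longrightarrow> \<not> is_multiplier y"
  by (auto simp: primal_def)

lemma multipliers_first: "i < k \<Longrightarrow> k < length ord \<Longrightarrow> is_multiplier (ord ! k) \<Longrightarrow> is_multiplier (ord ! i)"
  using start unfolding start_def by blast

text \<open>The starting ray holds every primal variable outside \<open>B0\<close> at a bound; for a
  component of z, \<open>side\<close> picks the bound whose multiplier is basic.\<close>

lemma start_active:
  assumes y: "y \<in> primal P" "y \<notin> B0" and u: "has_bound P u y"
    and side: "\<And>j. y = Zv j \<Longrightarrow> u = (Vv j \<in> B0)"
  shows "bnd u y = val P y zbar"
proof -
  have "val P y zbar = point s0 y 0"
    using level_value[OF valid_start y(1), of 0] start_system(3) by (simp add: dev_def grad_def val_def split: var.split)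
  moreover have "point s0 y 0 = bnd u y"
  proof (cases "y \<in> range Zv")
    case True
    then obtain j where j: "y = Zv j" by auto
    have "y \<notin> edge s0" using y j by (auto simp: start_edge)
    then have "point s0 y = lex_bound P ord (fixed_side P (edge s0) y) y" using valid_start by (simp add: valid_def)
    moreover have "fixed_side P (edge s0) y = u" using side[OF j] j by (auto simp: fixed_side_def start_edge)
    ultimately show ?thesis by (simp add: lex_bound_0)
  next
    case False
    then have "point s0 y 0 = 0" using y by (intro start_system(4)) (auto simp: primal_def)
    moreover have "bnd u y = 0"
      using y False u by (auto simp: primal_def bnd_def has_bound_def lower_def upper_def)
    ultimately show ?thesis by simp
  qed
  ultimately show ?thesis by simp
qed

context
  fixes s d
  assumes s: "valid s" and d: "pivot_direction P M r s d" and free: "\<And>y. \<not> blocking P d y"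
    and t: "0 < point s Tv 0"
begin

lemmas ray_dz_zero = ray_z_constant[OF s d free t]
lemmas ray_dt_pos = ray_t_increases[OF s d free ray_dz_zero]

text \<open>No constraint of C is relaxed before the last multiplier in \<open>ord\<close>, so a
  first nonzero deviation is a feasible direction from the extreme point: r strictly decreases along
  it, against \<open>ray_pairing\<close>.\<close>

lemma deviation_zero_low:
  assumes 0: "\<And>i. i < k \<Longrightarrow> dev s i = 0"
    and low: "k = 0 \<or> (\<exists>l<length ord. is_multiplier (ord ! l) \<and> k \<le> Suc l)"
  shows "dev s k = 0"
proof (rule ccontr)
  assume nz: "dev s k \<noteq> 0"
  have unrel: "lex_bound P ord u y (Suc i) = 0" if i: "i < k" and y: "y \<in> primal P" for i y u
  proof -
    \<comment> \<open>Up to level \<open>k\<close> only the variables \<open>ord ! i\<close> with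
      \<open>i < k\<close> are relaxed, all of them multipliers because these come first.\<close>
    obtain l where l: "l < length ord" "is_multiplier (ord ! l)" "k \<le> Suc l" using low i by auto
    have "is_multiplier (ord ! i)" using multipliers_first[of i l] l i by (cases "i = l") auto
    then show ?thesis using not_multiplier_primal[OF y] by (auto simp: lex_bound_def)
  qed
  obtain \<delta> where "0 < \<delta>" "zbar + \<delta> *\<^sub>R dev s k \<in> C"
    using feasible_direction[OF zbar, of "dev s k"] deviation_sign[OF s] 0 unrel by blast
  then have "r \<bullet> dev s k < 0" using r_strict nz by blast
  moreover have "0 \<le> d Tv * (r \<bullet> dev s k)" using ray_pairing[OF s d free ray_dz_zero] .
  ultimately show False using ray_dt_pos by (simp add: zero_le_mult_iff)
qed

text \<open>The sequences \<open>c\<close> and \<open>D\<close> below prepend the direction of the ray, as a level of lower order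
  than level 0, to the multipliers at the point of the ray and to those of the starting ray (both
  measured from their relaxed bounds). They have the same multiplier part, but its pairing with
  the first nonzero deviation is nonnegative by \<open>c\<close> and negative by \<open>D\<close>.\<close>

lemma deviation_zero_high:
  assumes 0: "\<And>i. i < Suc N \<Longrightarrow> dev s i = 0"
    and high: "\<And>l. l < length ord \<Longrightarrow> is_multiplier (ord ! l) \<Longrightarrow> Suc l < Suc N"
  shows "dev s (Suc N) = 0"
proof (rule ccontr)
  define v where "v = dev s (Suc N)"
  assume nz: "dev s (Suc N) \<noteq> 0"
  obtain a0 where a0: "solves_homogeneous P M r a0" "a0 Tv = 1" "zpart a0 = 0"
    and a0': "\<forall>y. y \<notin> insert Tv B0 \<longrightarrow> a0 y = 0" "\<forall>y u. has_bound P u y \<longrightarrow> sg u * a0 y \<le> 0"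
    using start_ray by blast
  define side where "side = fixed_side P {}"
  define b where "b y i = lex_bound P ord (side y) y i" for y i
  define Y where "Y i y = point s Tv i * a0 y + (if i = 0 then point s0 y 0 - point s0 Tv 0 * a0 y else 0)" for i y
  \<comment> \<open>Cut off after level \<open>N\<close>, up to which the deviation vanishes and
    \<open>level_mpart\<close> applies.\<close>
  define c where "c = case_nat d (\<lambda>i y. if i \<le> N then point s y i - b y i else 0)"
  define D where "D = case_nat (\<lambda>y. d Tv * a0 y) (\<lambda>i y. if i \<le> N then Y i y - b y i else 0)"
  note sgn = ray_multiplier_signs[OF s d free]
  have mpart_eq: "mpart P (c k) = mpart P (D k)" for k
  proof (cases k)
    case 0
    have "mpart P a0 = r" using a0 by (simp add: solves_homogeneous_def)
    then have "mpart P (\<lambda>y. d Tv * a0 y) = d Tv *\<^sub>R r" using mpart_lincomb[of P "d Tv" a0 0 a0] by simp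
    then show ?thesis using 0 ray_mpart[OF s d free ray_dz_zero] by (simp add: c_def D_def)
  next
    case (Suc i)
    show ?thesis
    proof (cases "i \<le> N")
      case True
      have "mpart P (\<lambda>y. point s y i) = mpart P (Y i)"
        using level_mpart[OF s d free ray_dz_zero a0(1,3,2), of i] 0[of i] True by (simp add: Y_def[abs_def])
      then have "mpart P (\<lambda>y. 1 * point s y i + (-1) * b y i) = mpart P (\<lambda>y. 1 * Y i y + (-1) * b y i)"
        unfolding mpart_lincomb by simp
      then show ?thesis using Suc True by (simp add: c_def D_def)
    qed (simp add: Suc c_def D_def)
  qed
  have split: "(\<lambda>k. c k y) = case_nat (d y) (\<lambda>i. if i \<le> N then point s y i - b y i else 0)" for y
    by (auto simp: c_def fun_eq_iff split: nat.split)
  have lnn_c: "lnn (\<lambda>k. - sg (side y) * c k y)"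
    if u: "has_bound P (side y) y" and dy: "0 \<le> - sg (side y) * d y" for y
  proof -
    have "(\<lambda>k. - sg (side y) * c k y) = case_nat (- sg (side y) * d y)
        (\<lambda>i. if i \<le> N then slack P ord (point s) (side y) y i else 0)"
      by (auto simp: c_def fun_eq_iff slack_def b_def right_diff_distrib split: nat.split)
    then show ?thesis using lnn_shift[OF dy lnn_truncate[OF feasible_tableau[OF s u]]] by simp
  qed
  have nonneg: "lnn (\<lambda>k. mpart P (c k) \<bullet> v)"
    unfolding v_def
  proof (rule mpart_pairing[OF s])
    fix y k assume y: "y \<notin> edge s" "is_multiplier y"
    have "point s y = lex_bound P ord (fixed_side P (edge s) y) y" using s y by (simp add: valid_def)
    then have "point s y = lex_bound P ord (side y) y"
      using fixed_side_multiplier[OF y(2), of "edge s"] by (simp add: side_def)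
    then show "c k y = 0"
      using direction_off_edge[OF d y(1)] by (simp add: c_def b_def split: nat.split)
  next
    fix i assume i: "i < nrows P" "fac P i = Nonneg"
    then show "lnn (\<lambda>k. c k (Lv i))"
      using lnn_c[of "Lv i"] sgn(1)[OF i] by (simp add: side_def fixed_side_def has_bound_def lower_def)
  next
    fix i assume i: "i < nrows P" "fac P i = Nonpos"
    then show "lnn (\<lambda>k. - c k (Lv i))"
      using lnn_c[of "Lv i"] sgn(2)[OF i] by (simp add: side_def fixed_side_def has_bound_def upper_def)
  next
    fix j show "lnn (\<lambda>k. c k (Wv j))"
      using lnn_c[of "Wv j"] sgn(3)[of j] by (simp add: side_def fixed_side_def has_bound_def lower_def)
  next
    fix j show "lnn (\<lambda>k. c k (Vv j))"
      using lnn_c[of "Vv j"] sgn(4)[of j] by (simp add: side_def fixed_side_def has_bound_def lower_def)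
  qed
  have b0: "b y 0 = 0" if "is_multiplier y" for y
    unfolding b_def side_def using that by (intro fixed_bound_zero) auto
  have D_off: "D k y = 0" if y: "y \<notin> B0" "is_multiplier y" for k y
  proof -
    have "y \<noteq> Tv" "y \<notin> range Zv" using y by auto
    then have "a0 y = 0" "point s0 y 0 = 0" using y a0'(1)[rule_format, of y] start_system(4)[of y] by auto
    moreover have "b y i = 0" for i
      using b0[OF y(2)] y ord by (cases i) (auto simp: b_def lex_bound_notin)
    ultimately show ?thesis by (auto simp: D_def Y_def split: nat.split)
  qed
  \<comment> \<open>An initial basic multiplier grows along the starting ray, or is off its bound
    there, or else its own relaxation counts, which \<open>high\<close> places at or below level
    \<open>N\<close>.\<close>
  have D_pos: "lpos (\<lambda>k. - sg (side y) * D k y)"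
    if y: "y \<in> B0" "is_multiplier y" and u: "has_bound P (side y) y" for y
  proof (cases "a0 y = 0")
    case False
    then have "0 < - sg (side y) * a0 y" using a0'(2)[rule_format, OF u] ray_dt_pos by (auto simp: less_le)
    then have "0 < d Tv * (- sg (side y) * a0 y)" by (rule mult_pos_pos[OF ray_dt_pos])
    then show ?thesis by (intro lpos_first) (simp add: D_def algebra_simps)
  next
    case True
    have eq: "(\<lambda>k. - sg (side y) * D k y) = case_nat 0 (case_nat (- sg (side y) * point s0 y 0)
        (\<lambda>i. if Suc i \<le> N \<and> i < length ord \<and> ord ! i = y then 1 else 0))"
      using True b0[OF y(2)]
      by (auto simp: D_def Y_def fun_eq_iff b_def lex_bound_def sg_def split: nat.split)
    obtain l where l: "l < length ord" "ord ! l = y" using y ord by (metis in_set_conv_nth)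
    then have "Suc l \<le> N" using high[of l] y by simp
    then have "lpos (\<lambda>i. if Suc i \<le> N \<and> i < length ord \<and> ord ! i = y then 1 else 0)"
      unfolding lpos_def using ord(1) l by (intro exI[of _ l]) (auto simp: nth_eq_iff_index_eq)
    moreover have "0 \<le> - sg (side y) * point s0 y 0"
      using start_bounds[OF u] b0[OF y(2)] by (simp add: b_def lex_bound_0)
    ultimately show ?thesis unfolding eq by (intro lpos_shift) auto
  qed
  have sign: "sg u * grad P y v \<le> 0"
    if "y \<in> primal P" "y \<notin> B0" "has_bound P u y" "\<And>j. y = Zv j \<Longrightarrow> u = (Vv j \<in> B0)" for y u
    unfolding v_def
    by (rule deviation_sign[OF s that(1,3) 0 _ start_active[OF that]])
       (use that(2) ord in \<open>auto intro: lex_bound_notin\<close>)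
  have row: "lnn (\<lambda>k. D k (Lv i) * (rowA P i \<bullet> v)) \<and>
      (Lv i \<in> B0 \<and> rowA P i \<bullet> v \<noteq> 0 \<longrightarrow> lpos (\<lambda>k. D k (Lv i) * (rowA P i \<bullet> v)))"
    if i: "i < nrows P" for i
  proof (cases "Lv i \<in> B0 \<and> rowA P i \<bullet> v \<noteq> 0")
    case False
    then have "(\<lambda>k. D k (Lv i) * (rowA P i \<bullet> v)) = (\<lambda>k. 0)" using D_off[of "Lv i"] by auto
    then show ?thesis using False by simp
  next
    case True
    have S: "sg u * (rowA P i \<bullet> v) \<le> 0" if "has_bound P u (Sv i)" for u
      using sign[of "Sv i" u] B0_rows[OF i] True i that by (simp add: primal_def grad_def)
    \<comment> \<open>An equation bounds its slack on both sides, which would make the product of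
      its row with \<open>v\<close> vanish.\<close>
    have "fac P i \<noteq> Zero \<and> 0 < - sg (side (Lv i)) * (rowA P i \<bullet> v)"
      using S[of True] S[of False] True i by (cases "fac P i")
        (auto simp: side_def fixed_side_def has_bound_def lower_def upper_def)
    moreover have "fac P i \<noteq> Zero \<longrightarrow> lpos (\<lambda>k. - sg (side (Lv i)) * D k (Lv i))"
      using D_pos[of "Lv i"] True i
      by (cases "fac P i") (auto simp: side_def fixed_side_def has_bound_def lower_def upper_def)
    ultimately have A: "lpos (\<lambda>k. - sg (side (Lv i)) * D k (Lv i))" "0 < - sg (side (Lv i)) * (rowA P i \<bullet> v)"
      by blast+
    note lpos_scale[OF A]
    moreover have "(- sg (side (Lv i)) * (rowA P i \<bullet> v)) * (- sg (side (Lv i)) * D k (Lv i)) =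
        D k (Lv i) * (rowA P i \<bullet> v)" for k
      by (simp add: sg_def)
    ultimately have "lpos (\<lambda>k. D k (Lv i) * (rowA P i \<bullet> v))" by (simp only:)
    then show ?thesis by (auto intro: lpos_imp_lnn)
  qed
  have col: "lnn (\<lambda>k. (D k (Wv j) - D k (Vv j)) * v $ j) \<and>
      ((Vv j \<in> B0 \<or> Wv j \<in> B0) \<and> v $ j \<noteq> 0 \<longrightarrow> lpos (\<lambda>k. (D k (Wv j) - D k (Vv j)) * v $ j))" for j
  proof (cases "(Vv j \<in> B0 \<or> Wv j \<in> B0) \<and> v $ j \<noteq> 0")
    case False
    then have "(\<lambda>k. (D k (Wv j) - D k (Vv j)) * v $ j) = (\<lambda>k. 0)"
      using D_off[of "Wv j"] D_off[of "Vv j"] by auto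
    then show ?thesis using False by simp
  next
    case True
    have var: "Wv j \<in> B0 \<Longrightarrow> lbd P j \<noteq> - \<infinity>" "Vv j \<in> B0 \<Longrightarrow> ubd P j \<noteq> \<infinity>"
      using basis0 by (auto simp: is_basis_def subset_iff)
    have pos: "lpos (\<lambda>k. D k (Wv j))" if "Wv j \<in> B0"
      using D_pos[of "Wv j"] that by (simp add: side_def fixed_side_def has_bound_def lower_def)
    have pos': "lpos (\<lambda>k. D k (Vv j))" if "Vv j \<in> B0"
      using D_pos[of "Vv j"] that by (simp add: side_def fixed_side_def has_bound_def lower_def)
    have "lpos (\<lambda>k. (D k (Wv j) - D k (Vv j)) * v $ j)"
    proof (cases "Wv j \<in> B0")
      case W: True
      then have "0 < v $ j"
        using sign[of "Zv j" False] B0_cols[of j] var True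
        by (auto simp: primal_def grad_def has_bound_def lower_def)
      then show ?thesis
        using lpos_scale[OF pos[OF W]] D_off[of "Vv j"] B0_cols[of j] W by (simp add: mult.commute)
    next
      case W: False
      then have V: "Vv j \<in> B0" using True by simp
      then have "0 < - v $ j"
        using sign[of "Zv j" True] B0_cols[of j] var True
        by (auto simp: primal_def grad_def has_bound_def upper_def)
      then show ?thesis
        using lpos_scale[OF pos'[OF V], of "- v $ j"] D_off[of "Wv j"] W by (simp add: mult.commute)
    qed
    then show ?thesis by (auto intro: lpos_imp_lnn)
  qed
  define R where "R k = (\<Sum>i<nrows P. D k (Lv i) * (rowA P i \<bullet> v))" for k
  define Q where "Q k = (\<Sum>j\<in>UNIV. (D k (Wv j) - D k (Vv j)) * v $ j)" for k
  have lnnRQ: "lnn R" "lnn Q" unfolding R_def Q_def using row col by (auto intro!: lnn_sum)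
  \<comment> \<open>Otherwise \<open>v\<close> is orthogonal to the gradients of all initial basic
    multipliers, hence zero.\<close>
  have "lpos R \<or> lpos Q"
  proof (rule ccontr)
    assume no: "\<not> (lpos R \<or> lpos Q)"
    have "rowA P i \<bullet> v = 0" if "i < nrows P" "Lv i \<in> B0" for i
    proof (rule ccontr)
      assume "rowA P i \<bullet> v \<noteq> 0"
      then have "lpos R" unfolding R_def using row that by (intro lpos_sum[where ?y0.0 = i]) auto
      then show False using no by simp
    qed
    moreover have "v $ j = 0" if "Vv j \<in> B0 \<or> Wv j \<in> B0" for j
    proof (rule ccontr)
      assume "v $ j \<noteq> 0"
      then have "lpos Q" unfolding Q_def using col that by (intro lpos_sum[where ?y0.0 = j]) auto
      then show False using no by simp
    qed
    ultimately show False using initial_gradients_span[of v] nz by (auto simp: v_def)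
  qed
  then have "lpos (\<lambda>k. R k + Q k)"
    using lpos_add_lnn[of R Q] lpos_add_lnn[of Q R] lnnRQ by (auto simp: add.commute)
  moreover have "mpart P (c k) \<bullet> v = - (R k + Q k)" for k
  proof -
    have "R k = - (\<Sum>i<nrows P. - D k (Lv i) * (rowA P i \<bullet> v))" by (simp add: R_def sum_negf)
    moreover have "Q k = - (\<Sum>j\<in>UNIV. (D k (Vv j) - D k (Wv j)) * v $ j)"
      unfolding Q_def sum_negf[symmetric] by (intro sum.cong) (auto simp: algebra_simps)
    ultimately show ?thesis unfolding mpart_eq mpart_inner by simp
  qed
  ultimately show False using nonneg lpos_not_neg by force
qed

lemma deviation_zero: "dev s k = 0"
proof (induction k rule: less_induct)
  case (less k)
  show ?case
  proof (cases "k = 0 \<or> (\<exists>l<length ord. is_multiplier (ord ! l) \<and> k \<le> Suc l)")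
    case True
    then show ?thesis using deviation_zero_low less by blast
  next
    case False
    then obtain N where N: "k = Suc N" by (cases k) auto
    show ?thesis unfolding N
      by (rule deviation_zero_high) (use False less N in \<open>auto simp: not_le\<close>)
  qed
qed

text \<open>Without deviations no primal member of \<open>B0\<close> is held at its relaxed bound,
  so these lie on the edge. By \<open>mpart_inj\<close> the multipliers agree with those of the
  starting ray, which carry no infinitesimals but those of \<open>t\<close>; so a basic multiplier
  is not held at its relaxed bound either. Counting gives equality.\<close>

lemma ray_edge: "edge s = insert Tv B0"
proof -
  obtain a0 where a0: "solves_homogeneous P M r a0" "a0 Tv = 1" "zpart a0 = 0"
    and a0': "\<forall>y. y \<notin> insert Tv B0 \<longrightarrow> a0 y = 0" "\<forall>y u. has_bound P u y \<longrightarrow> sg u * a0 y \<le> 0"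
    using start_ray by blast
  define Y where "Y k y = point s Tv k * a0 y + (if k = 0 then point s0 y 0 - point s0 Tv 0 * a0 y else 0)" for k y
  have dev0: "dev s k = 0" for k by (rule deviation_zero)
  have primal_in: "y \<in> edge s" if y: "y \<in> B0" "y \<in> primal P" for y
  proof (rule ccontr)
    assume n: "y \<notin> edge s"
    obtain l where l: "l < length ord" "ord ! l = y" using y ord by (metis in_set_conv_nth)
    have "grad P y (dev s (Suc l)) \<noteq> 0" using fixed_gap(3)[OF s y(2) n refl l] by auto
    then show False using grad_scale[of P y 0 0] by (simp add: dev0)
  qed
  have X_off: "point s y = lex_bound P ord (fixed_side P (edge s) y) y" if "y \<notin> edge s" for y
    using s that by (simp add: valid_def)
  have B0_off: "a0 y = 0" "Y k y = 0" if "y \<notin> B0" "is_multiplier y" for y k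
  proof -
    have "y \<noteq> Tv" "y \<notin> range Zv" using that by auto
    then show "a0 y = 0" "Y k y = 0"
      using that a0'(1) start_system(4)[of y] by (auto simp: Y_def)
  qed
  have off: "d y = 0" "point s y k = 0" if y: "y \<notin> edge s" "y \<notin> B0" "is_multiplier y" for y k
  proof -
    show "d y = 0" using direction_off_edge[OF d y(1)] .
    have "lex_bound P ord (fixed_side P (edge s) y) y 0 = 0" using y(3) by (intro fixed_bound_zero) auto
    then show "point s y k = 0"
      using X_off[OF y(1)] y(2) ord by (cases k) (auto simp: lex_bound_notin)
  qed
  have rows: "Lv i \<notin> edge s \<and> Lv i \<notin> B0" if "i < nrows P" "Lv i \<notin> B0" for i
    using primal_in[of "Sv i"] that B0_rows[of i] edge_rows[OF s, of i] by (auto simp: primal_def)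
  have cols: "Wv j \<notin> edge s \<and> Vv j \<notin> edge s \<and> Wv j \<notin> B0 \<and> Vv j \<notin> B0" if "Zv j \<in> B0" for j
    using primal_in[of "Zv j"] that B0_cols[of j] edge_cols[OF s, of j] by (auto simp: primal_def)
  have md: "mpart P d = mpart P (\<lambda>y. d Tv * a0 y)"
  proof -
    have "mpart P a0 = r" using a0 by (simp add: solves_homogeneous_def)
    then show ?thesis using mpart_lincomb[of P "d Tv" a0 0 a0] ray_mpart[OF s d free ray_dz_zero] by simp
  qed
  have mX: "mpart P (\<lambda>y. point s y k) = mpart P (Y k)" for k
    using level_mpart[OF s d free ray_dz_zero a0(1,3,2) dev0, of k] by (simp add: Y_def[abs_def])
  have dL: "d (Lv i) = d Tv * a0 (Lv i)" if "i < nrows P" for i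
    by (rule mpart_inj(1)[OF md]) (use that rows cols off B0_off in auto)
  have dVW: "d (Vv j) - d (Wv j) = d Tv * a0 (Vv j) - d Tv * a0 (Wv j)" for j
    by (rule mpart_inj(2)[OF md]) (use rows cols off B0_off in auto)
  have XL: "point s (Lv i) k = Y k (Lv i)" if "i < nrows P" for i k
    by (rule mpart_inj(1)[OF mX]) (use that rows cols off B0_off in auto)
  have XVW: "point s (Vv j) k - point s (Wv j) k = Y k (Vv j) - Y k (Wv j)" for j k
    by (rule mpart_inj(2)[OF mX]) (use rows cols off B0_off in auto)
  have row_in: "Lv i \<in> edge s" if i: "Lv i \<in> B0" for i
  proof (rule ccontr)
    assume n: "Lv i \<notin> edge s"
    have m: "i < nrows P" using i basis0 by (auto simp: is_basis_def subset_iff)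
    have "a0 (Lv i) = 0" using dL[OF m] direction_off_edge[OF d n] ray_dt_pos by simp
    moreover obtain l where l: "l < length ord" "ord ! l = Lv i" using i ord by (metis in_set_conv_nth)
    ultimately have "point s (Lv i) (Suc l) = 0" using XL[OF m, of "Suc l"] by (simp add: Y_def)
    then show False using X_off[OF n] l by (simp add: lex_bound_def split: if_splits)
  qed
  \<comment> \<open>Only the difference of the two bound multipliers is determined. If
    \<open>A\<close> were held at its relaxed bound, which is -1 at the level of \<open>A\<close>,
    then \<open>B\<close> would follow it below its own bound 0.\<close>
  have col_in: "A \<in> edge s"
    if A: "A \<in> B0" and AB: "(A, B) = (Wv j, Vv j) \<or> (A, B) = (Vv j, Wv j)" for A B j
  proof (rule ccontr)
    assume n: "A \<notin> edge s"
    have mult: "is_multiplier A" "is_multiplier B" and bd: "has_bound P False A" "has_bound P False B"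
      using AB by (auto simp: has_bound_def lower_def)
    have B: "B \<notin> B0" using A AB B0_cols[of j] by auto
    have "d B - d A = d Tv * a0 B - d Tv * a0 A" using AB dVW[of j] by auto
    moreover have "0 \<le> d B" using ray_multiplier_signs[OF s d free] AB by auto
    moreover have "0 \<le> d Tv * a0 A" using a0'(2)[rule_format, OF bd(1)] ray_dt_pos by simp
    ultimately have aA: "a0 A = 0"
      using B0_off(1)[OF B mult(2)] direction_off_edge[OF d n] ray_dt_pos by simp
    have XB: "point s B k - point s A k = (if k = 0 then - point s0 A 0 else 0)" for k
    proof -
      have "point s B k - point s A k = Y k B - Y k A" using AB XVW[of j k] by auto
      then show ?thesis using B0_off(2)[OF B mult(2)] aA by (simp add: Y_def)
    qed
    have lower0: "bnd False A = 0" "bnd False B = 0"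
      using AB by (auto simp: bnd_def lower_def)
    have XA: "point s A = lex_bound P ord False A"
      using X_off[OF n] AB by (auto simp: fixed_side_def)
    have lB: "lex_bound P ord False B k = 0" for k
      using lower0(2) B ord by (cases k) (auto simp: lex_bound_0 lex_bound_notin)
    have feas: "lnn (\<lambda>k. point s B k)"
      using feasible_tableau[OF s bd(2)] lB by (simp add: slack_def[abs_def])
    obtain l where l: "l < length ord" "ord ! l = A" using A ord by (metis in_set_conv_nth)
    have "0 \<le> point s0 A 0" using start_bounds[OF bd(1)] lower0 by simp
    moreover have "0 \<le> point s B 0" using lnn_first[OF feas] .
    ultimately have "point s B 0 = 0" using XB[of 0] XA lower0(1) by (simp add: lex_bound_0)
    moreover have "point s B (Suc i) = 0" if "i < l" for i
      using XB[of "Suc i"] XA l that ord(1) by (auto simp: lex_bound_def nth_eq_iff_index_eq)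
    ultimately have "point s B i = 0" if "i < Suc l" for i using that by (cases i) auto
    then have "0 \<le> point s B (Suc l)" by (rule lnn_nonneg[OF feas])
    moreover have "point s B (Suc l) = - 1" using XB[of "Suc l"] XA l by (simp add: lex_bound_def)
    ultimately show False by simp
  qed
  have "y \<in> edge s" if y: "y \<in> B0" for y
  proof (cases y)
    case (Lv i)
    then show ?thesis using row_in y by simp
  next
    case (Wv j)
    then show ?thesis using col_in[of "Wv j" "Vv j" j] y by simp
  next
    case (Vv j)
    then show ?thesis using col_in[of "Vv j" "Wv j" j] y by simp
  next
    case (Sv i)
    then have "i < nrows P" using y basis0 by (auto simp: is_basis_def subset_iff)
    then show ?thesis using primal_in[of y] Sv y by (auto simp: primal_def)
  qed (use primal_in y Tv_notin_B0 in \<open>auto simp: primal_def\<close>)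
  then have sub: "insert Tv B0 \<subseteq> edge s" using s by (auto simp: valid_def)
  have bs: "is_basis P M r (basis s)" "entering s \<notin> basis s" using s by (auto simp: valid_def)
  have card: "card B0 = CARD('n) + nrows P" "card (basis s) = CARD('n) + nrows P"
    using basis0 bs(1) unfolding is_basis_def by blast+
  have "card (insert Tv B0) = card (edge s)"
    unfolding edge_def
    using card is_basis_finite[OF basis0] is_basis_finite[OF bs(1)] Tv_notin_B0 bs(2) by simp
  moreover have "finite (edge s)" using is_basis_finite[OF bs(1)] by (simp add: edge_def)
  ultimately show ?thesis using card_subset_eq[OF _ sub] by simp
qed

end

text \<open>Looking back from the far end of the starting ray, the direction is a positive multiple
  of \<open>a0\<close>, along which nothing blocks.\<close>

lemma start_ray_end:
  assumes t: "traverse s0 g"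
  obtains a where "pivot_direction P M r g a" "\<And>y. \<not> blocking P a y" "0 < a Tv"
proof -
  obtain a0 where a0: "a0 Tv = 1" "\<forall>y u. has_bound P u y \<longrightarrow> sg u * a0 y \<le> 0"
      "pivot_direction P M r s0 (\<lambda>y. - a0 y)"
    using start_ray by blast
  obtain d y where d: "pivot_direction P M r s0 d" and l: "leaves P ord (point s0) d y"
    and g: "g = opposite s0 d y"
    using t unfolding traverse_def by blast
  have da: "d = (\<lambda>y. - a0 y)" using direction_unique[OF valid_start d a0(3)] .
  have y: "d y \<noteq> 0" using leaving(2)[OF valid_start d l] .
  define a where "a = (\<lambda>x. - d x / \<bar>d y\<bar>)"
  have "\<not> blocking P a x" for x
  proof
    assume "blocking P a x"
    then have b: "a x \<noteq> 0" "has_bound P (0 < a x) x" by (auto simp: blocking_iff)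
    have "sg (0 < a x) * a0 x \<le> 0" using a0(2) b(2) by blast
    moreover have "a x = a0 x / \<bar>d y\<bar>" by (simp add: a_def da)
    ultimately show False using b(1) y by (auto simp: sg_def zero_less_divide_iff split: if_splits)
  qed
  moreover have "0 < a Tv" using y a0(1) by (simp add: a_def da)
  ultimately show thesis
    using opposite_direction[OF valid_start d l] by (intro that[of a]) (auto simp: a_def g)
qed

lemma start_ray_end_blocked: "traverse s0 g \<Longrightarrow> at_vertex g \<Longrightarrow> \<not> traverse g h"
  using start_ray_end[of g] direction_unique[of g] unfolding traverse_def leaves_def at_vertex_def by metis

section \<open>The path of vertices and its termination\<close>

context
  fixes f :: "nat \<Rightarrow> 'n state" and N :: nat
  assumes f0: "f 0 = s0" and step: "\<And>k. k < N \<Longrightarrow> pivot P M r ord (f k) (f (Suc k))"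
    and last: "point (f N) Tv 0 \<noteq> 0"
begin

lemma path_nonzero: "k \<le> N \<Longrightarrow> point (f k) Tv 0 \<noteq> 0"
  using step[of k] last by (cases "k = N") (auto simp: pivot_def)

lemma path_valid: "k \<le> N \<Longrightarrow> valid (f k)"
  by (induction k) (use f0 valid_start step pivot_valid in \<open>auto simp: Suc_le_eq\<close>)

lemma path_turn: "k < N \<Longrightarrow> \<exists>g. traverse (f k) g \<and> at_vertex g \<and> f (Suc k) = switch g"
  using pivot_at_vertex[OF path_valid step path_nonzero] by (metis Suc_leI less_imp_le)

lemma path_at_vertex: "0 < k \<Longrightarrow> k \<le> N \<Longrightarrow> at_vertex (f k)"
  using path_turn[of "k - 1"] switch_switch_at_vertex(1) by fastforce

lemma path_traverse: "k < N \<Longrightarrow> traverse (f k) (switch (f (Suc k)))"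
  using path_turn[of k] switch_switch_at_vertex(2) by metis

lemma path_traverse_back:
  assumes "0 < k" "k < N" shows "traverse (switch (f (Suc k))) (f k)"
proof (rule traverse_symmetric)
  show "at_vertex (f k)" using path_at_vertex assms by simp
  show "traverse (f k) (switch (f (Suc k)))" using path_traverse assms by simp
  have "at_vertex (switch (f (Suc k)))"
    using path_at_vertex[of "Suc k"] assms switch_switch_at_vertex(1) by simp
  then show "entering (switch (f (Suc k))) \<noteq> Tv" by (simp add: at_vertex_def)
qed

text \<open>By reversibility equal states have equal predecessors, so a repetition can be pushed
  back to the far end of the starting ray; but from there, looking back, nothing can be traversed
  to.\<close>

lemma path_no_repetition:
  assumes "0 < i" "i < j" "j \<le> N" shows "f i \<noteq> f j"
  using assms
proof (induction i arbitrary: j)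
  case (Suc i)
  show ?case
  proof
    assume eq: "f (Suc i) = f j"
    obtain k where k: "j = Suc k" using Suc.prems by (cases j) auto
    have b: "traverse (switch (f (Suc i))) (f k)"
      using path_traverse_back[of k] Suc.prems eq k by auto
    show False
    proof (cases "i = 0")
      case True
      have "traverse s0 (switch (f (Suc 0)))" using path_traverse[of 0] Suc.prems f0 by simp
      moreover have "at_vertex (switch (f (Suc 0)))"
        using path_at_vertex[of "Suc 0"] Suc.prems switch_switch_at_vertex(1) by simp
      ultimately show False using start_ray_end_blocked b True by blast
    next
      case False
      have v: "at_vertex (switch (f (Suc i)))"
        using path_at_vertex[of "Suc i"] Suc.prems switch_switch_at_vertex(1) by simp
      have "traverse (switch (f (Suc i))) (f i)" using path_traverse_back[of i] False Suc.prems by simp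
      then have "f i = f k" using traverse_unique[OF _ _ b] v by (simp add: at_vertex_def)
      then show False using Suc.IH[of k] False Suc.prems k by simp
    qed
  qed
qed simp

text \<open>A path that came back to the far end of the starting ray would be the reverse of itself, with
  a fixed point of \<open>switch\<close> or of \<open>traverse\<close> in the middle.\<close>

lemma path_not_return:
  assumes N: "0 < N" shows "f N \<noteq> switch (f 1)"
proof
  assume ret: "f N = switch (f 1)"
  have mirror: "k < N \<Longrightarrow> f (N - k) = switch (f (Suc k))" for k
  proof (induction k)
    case 0
    then show ?case using ret by simp
  next
    case (Suc k)
    define l where "l = N - Suc k"
    have l: "0 < l" "l < N" "N - k = Suc l" using Suc.prems by (auto simp: l_def)
    have v: "at_vertex (f (Suc k))" using path_at_vertex[of "Suc k"] Suc.prems by simp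
    have "f (Suc l) = switch (f (Suc k))" using Suc l by simp
    then have "switch (f (Suc l)) = f (Suc k)" using switch_switch_at_vertex(2)[OF v] by simp
    then have "traverse (f (Suc k)) (f l)" using path_traverse_back[OF l(1,2)] by simp
    moreover have "traverse (f (Suc k)) (switch (f (Suc (Suc k))))" using path_traverse Suc.prems by simp
    ultimately have "f l = switch (f (Suc (Suc k)))"
      using traverse_unique v by (auto simp: at_vertex_def)
    then show ?case by (simp add: l_def)
  qed
  show False
  proof (cases "even N")
    case False
    then obtain m where m: "N = 2 * m + 1" by (auto elim: oddE)
    have "f (Suc m) = switch (f (Suc m))" using mirror[of m] m by simp
    then show False using switch_switch_at_vertex(3)[OF path_at_vertex[of "Suc m"]] m by simp
  next
    case True
    then obtain m where m: "N = 2 * m" by auto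
    obtain l where l: "m = Suc l" using N m by (cases m) auto
    have "f (Suc m) = switch (f m)" using mirror[of l] m l by simp
    then have "traverse (f m) (switch (switch (f m)))" using path_traverse[of m] m l by simp
    moreover have v: "at_vertex (f m)" using path_at_vertex[of m] m l by simp
    ultimately show False using traverse_neq switch_switch_at_vertex(2)[OF v] by (auto simp: at_vertex_def)
  qed
qed

text \<open>A stuck state lies on the initial edge with \<open>t\<close> increasing. So does the far
  end of the starting ray, looking back. By \<open>edge_end_unique\<close> the two coincide, so the
  path would have returned.\<close>

lemma path_continues: "\<exists>s'. pivot P M r ord (f N) s'"
proof (rule ccontr)
  assume stuck: "\<nexists>s'. pivot P M r ord (f N) s'"
  have i: "valid (f N)" using path_valid by simp
  obtain d where d: "pivot_direction P M r (f N) d" using direction_exists[OF i] by blast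
  have free: "\<not> blocking P d y" for y using pivot_exists[OF i last d] stuck by blast
  have t: "0 < point (f N) Tv 0"
    using level0_bounds[OF i] last by (auto simp: within_bounds_def lower_def less_le split: var.splits dest!: spec[of _ Tv])
  have dT: "0 < d Tv" by (rule ray_dt_pos[OF i d free t])
  have E: "edge (f N) = edge s0" using ray_edge[OF i d free t] by (simp add: start_edge)
  show False
  proof (cases "N = 0")
    case True
    then have "d Tv = - 1" using d f0 start_system by (simp add: pivot_direction_def)
    then show False using dT by simp
  next
    case False
    define g where "g = switch (f 1)"
    have g: "traverse s0 g" "at_vertex g"
      using path_traverse[of 0] False f0 path_at_vertex[of 1] switch_switch_at_vertex(1) by (auto simp: g_def)
    obtain a where a: "pivot_direction P M r g a" "0 < a Tv" by (rule start_ray_end[OF g(1)])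
    have Eg: "edge g = edge s0" using traverse_edge[OF valid_start g(1)] .
    have ig: "valid g" using g(2) by (simp add: at_vertex_def)
    define c where "c = d (entering g) / sense g"
    have c: "d y = c * a y" for y
      unfolding c_def
      by (rule homogeneous_on_edge[OF ig a(1)])
         (use d direction_off_edge[OF d] E Eg in \<open>auto simp: pivot_direction_def\<close>)
    have "0 < c" using c[of Tv] dT a(2) by (simp add: zero_less_mult_iff)
    then have "g = f N"
      using edge_end_unique[OF g(2) _ _ a(1) d] c path_at_vertex[of N] False E Eg by auto
    then show False using path_not_return False by (simp add: g_def)
  qed
qed

end

lemma run_finite: "\<not> (\<exists>f. f 0 = s0 \<and> (\<forall>k::nat. pivot P M r ord (f k) (f (Suc k))))"
proof
  assume "\<exists>f. f 0 = s0 \<and> (\<forall>k::nat. pivot P M r ord (f k) (f (Suc k)))"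
  then obtain f where f: "f 0 = s0" "\<And>k. pivot P M r ord (f k) (f (Suc k))" by blast
  have last: "point (f N) Tv 0 \<noteq> 0" for N using f(2)[of N] by (simp add: pivot_def)
  have "at_vertex (f (Suc k))" for k
    using path_at_vertex[where f = f and N = "Suc k"] f last by simp
  then have "(\<lambda>k. f (Suc k)) ` UNIV \<subseteq> {s. at_vertex s}" by auto
  then have "finite ((\<lambda>k. f (Suc k)) ` UNIV)" using finite_at_vertex by (rule finite_subset)
  then have "\<not> inj (\<lambda>k. f (Suc k))" using finite_imageD infinite_UNIV_nat by blast
  then obtain i j where ij: "i < j" "f (Suc i) = f (Suc j)"
    unfolding inj_def by (metis linorder_neqE_nat)
  then show False using path_no_repetition[where f = f and N = "Suc j" and i = "Suc i" and j = "Suc j"] f last by simp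
qed

lemma run_stops:
  assumes "(pivot P M r ord)\<^sup>*\<^sup>* s0 s'" and stuck: "\<nexists>s''. pivot P M r ord s' s''"
  shows "stops_at_solution P M q s'"
proof -
  obtain N where "(pivot P M r ord ^^ N) s0 s'" using assms(1) by (auto simp: rtranclp_power)
  then obtain f where f: "f 0 = s0" "f N = s'" "\<And>k. k < N \<Longrightarrow> pivot P M r ord (f k) (f (Suc k))"
    by (auto simp: relpowp_fun_conv)
  have "valid s'"
  proof -
    have "k \<le> N \<Longrightarrow> valid (f k)" for k
      by (induction k) (use f valid_start pivot_valid in \<open>auto simp: Suc_le_eq\<close>)
    then show ?thesis using f by blast
  qed
  moreover have "point s' Tv 0 = 0"
    using path_continues[where f = f and N = N] f stuck by auto
  ultimately show ?thesis by (rule stops_at_t_zero)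
qed

end

section \<open>Conic combinations with independent generators\<close>

text \<open>Independence of the family, not of the set of its values: two constraints with the same
  gradient must count as dependent.\<close>

definition indep_family :: "('i \<Rightarrow> 'a::real_vector) \<Rightarrow> 'i set \<Rightarrow> bool" where
  "indep_family h J \<longleftrightarrow> (\<forall>c. (\<Sum>y\<in>J. c y *\<^sub>R h y) = 0 \<longrightarrow> (\<forall>y\<in>J. c y = 0))"

lemma indep_family_empty [simp]: "indep_family h {}"
  by (simp add: indep_family_def)

lemma indep_family_subset:
  assumes "indep_family h J" "I \<subseteq> J" "finite J" shows "indep_family h I"
  unfolding indep_family_def
proof (intro allI impI)
  fix c assume c: "(\<Sum>y\<in>I. c y *\<^sub>R h y) = 0"
  have eq: "(\<Sum>y\<in>J. (if y \<in> I then c y else 0) *\<^sub>R h y) = (\<Sum>y\<in>I. c y *\<^sub>R h y)"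
    using assms by (intro sum.mono_neutral_cong_right) auto
  have "\<forall>y\<in>J. (if y \<in> I then c y else 0) = 0"
    using assms(1)[unfolded indep_family_def, THEN spec, THEN mp, OF trans[OF eq c]] .
  then show "\<forall>y\<in>I. c y = 0" using assms(2) by (metis subsetD)
qed

lemma span_image_coeffs:
  assumes "finite J" "x \<in> span (h ` J)" shows "\<exists>c. x = (\<Sum>y\<in>J. c y *\<^sub>R h y)"
  using assms(2)
proof (induction rule: span_induct_alt)
  case base
  show ?case by (intro exI[of _ "\<lambda>y. 0"]) simp
next
  case (step a v w)
  then obtain c y where c: "w = (\<Sum>y\<in>J. c y *\<^sub>R h y)" "y \<in> J" "v = h y" by auto
  have "(\<Sum>z\<in>J. (c z + (if z = y then a else 0)) *\<^sub>R h z) = w + (\<Sum>z\<in>J. if z = y then a *\<^sub>R h y else 0)"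
    unfolding c(1) sum.distrib[symmetric] by (intro sum.cong) (auto simp: scaleR_add_left)
  also have "\<dots> = a *\<^sub>R v + w" using c assms(1) by simp
  finally show ?case by (intro exI[of _ "\<lambda>z. c z + (if z = y then a else 0)"]) simp
qed

lemma indep_family_insert:
  assumes J: "finite J" "indep_family h J" and y: "h y \<notin> span (h ` J)"
  shows "indep_family h (insert y J)"
  unfolding indep_family_def
proof (intro allI impI)
  have yJ: "y \<notin> J" using y by (metis imageI span_base)
  fix c assume "(\<Sum>z\<in>insert y J. c z *\<^sub>R h z) = 0"
  then have s: "c y *\<^sub>R h y + (\<Sum>z\<in>J. c z *\<^sub>R h z) = 0" using J yJ by simp
  have "c y = 0"
  proof (rule ccontr)
    assume n: "c y \<noteq> 0"
    have e: "c y *\<^sub>R h y = - (\<Sum>z\<in>J. c z *\<^sub>R h z)" using s by (simp add: eq_neg_iff_add_eq_0)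
    have "h y = (1 / c y) *\<^sub>R (c y *\<^sub>R h y)" using n by simp
    also have "\<dots> = (- 1 / c y) *\<^sub>R (\<Sum>z\<in>J. c z *\<^sub>R h z)" unfolding e by simp
    also have "\<dots> \<in> span (h ` J)" by (intro span_scale span_sum) (auto intro: span_base)
    finally show False using y by simp
  qed
  then show "\<forall>z\<in>insert y J. c z = 0" using s J by (auto simp: indep_family_def)
qed

lemma indep_family_extend:
  assumes A: "finite A" and J: "J \<subseteq> A" "indep_family h J"
  shows "\<exists>J'. J \<subseteq> J' \<and> J' \<subseteq> A \<and> indep_family h J' \<and> h ` A \<subseteq> span (h ` J')"
proof -
  let ?F = "{J'. J \<subseteq> J' \<and> J' \<subseteq> A \<and> indep_family h J'}"
  have "finite ?F" "?F \<noteq> {}" using A J by auto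
  then obtain J' where J': "J' \<in> ?F" "\<And>I. I \<in> ?F \<Longrightarrow> J' \<subseteq> I \<Longrightarrow> I = J'"
    using finite_has_maximal[of ?F] by (metis (no_types, lifting))
  have "h y \<in> span (h ` J')" if y: "y \<in> A" for y
  proof (rule ccontr)
    assume n: "h y \<notin> span (h ` J')"
    have "finite J'" using J' A finite_subset by auto
    then have "insert y J' \<in> ?F" using J'(1) y indep_family_insert[OF _ _ n] by auto
    then have "y \<in> J'" using J'(2)[of "insert y J'"] by blast
    then show False using n by (metis imageI span_base)
  qed
  then show ?thesis using J' by auto
qed

lemma indep_family_card:
  fixes h :: "'i \<Rightarrow> real^'n"
  assumes J: "finite J" "indep_family h J" and sp: "span (h ` J) = UNIV"
  shows "card J = CARD('n)"
proof (rule antisym)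
  show "card J \<le> CARD('n)"
  proof (rule ccontr)
    assume "\<not> ?thesis"
    then obtain x where x: "\<exists>j\<in>J. x j \<noteq> 0" "\<forall>i\<in>UNIV. (\<Sum>j\<in>J. h j $ i * x j) = 0"
      using underdetermined_nontrivial_solution[of "UNIV :: 'n set" J "\<lambda>i j. h j $ i"] J by auto
    then have "(\<Sum>j\<in>J. x j *\<^sub>R h j) = 0" by (simp add: vec_eq_iff mult.commute)
    then show False using J(2) x(1) by (auto simp: indep_family_def)
  qed
  have "CARD('n) = dim (UNIV :: (real^'n) set)" by (simp add: dim_UNIV)
  also have "\<dots> = dim (h ` J)" using sp by (metis dim_span)
  also have "\<dots> \<le> card (h ` J)" using J by (intro dim_le_card') auto
  also have "\<dots> \<le> card J" using J by (intro card_image_le)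
  finally show "CARD('n) \<le> card J" .
qed

text \<open>The coefficients of the generators in \<open>F\<close> are free.\<close>

lemma conic_caratheodory:
  assumes A: "finite A" and F: "F \<subseteq> A" and E: "E \<subseteq> F" "indep_family h E" "h ` F \<subseteq> span (h ` E)"
    and c: "c = (\<Sum>y\<in>A. \<nu> y *\<^sub>R h y)" and nn: "\<And>y. y \<in> A - F \<Longrightarrow> 0 \<le> \<nu> y"
  shows "\<exists>S \<nu>'. S \<subseteq> A - F \<and> indep_family h (E \<union> S) \<and> (\<forall>y\<in>S. 0 \<le> \<nu>' y) \<and>
      c = (\<Sum>y\<in>E \<union> S. \<nu>' y *\<^sub>R h y)"
proof -
  define Q where "Q S \<longleftrightarrow> S \<subseteq> A - F \<and> (\<exists>\<nu>'. (\<forall>y\<in>S. 0 \<le> \<nu>' y) \<and> c = (\<Sum>y\<in>E \<union> S. \<nu>' y *\<^sub>R h y))" for S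
  have fin: "finite E" "finite F"
    using finite_subset[OF F A] finite_subset[OF E(1)] by blast+
  have "(\<Sum>y\<in>F. \<nu> y *\<^sub>R h y) \<in> span (h ` E)"
    using E(3) by (intro span_sum span_scale) auto
  then obtain e where e: "(\<Sum>y\<in>F. \<nu> y *\<^sub>R h y) = (\<Sum>y\<in>E. e y *\<^sub>R h y)"
    using span_image_coeffs[OF fin(1)] by blast
  \<comment> \<open>The part over \<open>F\<close> has free coefficients and is rewritten over the
    independent \<open>E\<close>; only the generators outside \<open>F\<close> remain to be
    reduced.\<close>
  have "Q (A - F)"
    unfolding Q_def
  proof (intro conjI exI[of _ "\<lambda>y. if y \<in> E then e y else \<nu> y"])
    have "c = (\<Sum>y\<in>F. \<nu> y *\<^sub>R h y) + (\<Sum>y\<in>A - F. \<nu> y *\<^sub>R h y)"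
      unfolding c using A F by (subst sum.subset_diff[of F A]) auto
    also have "\<dots> = (\<Sum>y\<in>E \<union> (A - F). (if y \<in> E then e y else \<nu> y) *\<^sub>R h y)"
      unfolding e using A fin E
      by (subst sum.union_disjoint) (auto intro!: arg_cong2[of _ _ _ _ "(+)"] sum.cong)
    finally show "c = (\<Sum>y\<in>E \<union> (A - F). (if y \<in> E then e y else \<nu> y) *\<^sub>R h y)" .
  qed (use nn E in auto)
  then obtain S where S: "Q S" "\<And>S'. card S' < card S \<Longrightarrow> \<not> Q S'"
    using ex_has_least_nat[of Q _ card] by (metis not_less)
  obtain \<nu>' where \<nu>': "\<forall>y\<in>S. 0 \<le> \<nu>' y" "c = (\<Sum>y\<in>E \<union> S. \<nu>' y *\<^sub>R h y)" and SA: "S \<subseteq> A - F"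
    using S(1) unfolding Q_def by blast
  have finS: "finite S" "S \<inter> E = {}" using SA E(1) finite_subset[of S A] A by auto
  \<comment> \<open>A dependency with a positive entry in \<open>S\<close> can be subtracted until
    the first coefficient in \<open>S\<close> vanishes, against the minimality of
    \<open>S\<close>.\<close>
  have no: False if \<beta>: "(\<Sum>y\<in>E \<union> S. \<beta> y *\<^sub>R h y) = 0" "s \<in> S" "0 < \<beta> s" for \<beta> s
  proof -
    let ?R = "{y \<in> S. 0 < \<beta> y}"
    have R: "finite ?R" "?R \<noteq> {}" using \<beta> finS by auto
    obtain m where m: "m \<in> ?R" "\<And>y. y \<in> ?R \<Longrightarrow> \<nu>' m / \<beta> m \<le> \<nu>' y / \<beta> y"
      using arg_min_if_finite(1)[OF R, of "\<lambda>y. \<nu>' y / \<beta> y"] arg_min_least[OF R, of _ "\<lambda>y. \<nu>' y / \<beta> y"]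
      by blast
    define \<theta> where "\<theta> = \<nu>' m / \<beta> m"
    define \<mu> where "\<mu> y = \<nu>' y - \<theta> * \<beta> y" for y
    have \<theta>: "0 \<le> \<theta>" using m(1) \<nu>'(1) by (auto simp: \<theta>_def)
    have \<mu>m: "\<mu> m = 0" using m(1) by (auto simp: \<mu>_def \<theta>_def)
    have "0 \<le> \<mu> y" if y: "y \<in> S" for y
    proof (cases "0 < \<beta> y")
      case True
      then have "\<theta> \<le> \<nu>' y / \<beta> y" using m(2) y by (simp add: \<theta>_def)
      then show ?thesis using True by (simp add: \<mu>_def field_simps)
    next
      case False
      then have "\<theta> * \<beta> y \<le> 0" using \<theta> by (intro mult_nonneg_nonpos) auto
      moreover have "0 \<le> \<nu>' y" using \<nu>'(1) y by blast
      ultimately show ?thesis by (simp add: \<mu>_def)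
    qed
    moreover have "c = (\<Sum>y\<in>E \<union> (S - {m}). \<mu> y *\<^sub>R h y)"
    proof -
      have "(\<Sum>y\<in>E \<union> S. \<mu> y *\<^sub>R h y) = c - \<theta> *\<^sub>R (\<Sum>y\<in>E \<union> S. \<beta> y *\<^sub>R h y)"
        unfolding \<nu>'(2) \<mu>_def by (simp add: scaleR_diff_left sum_subtractf scaleR_sum_right)
      also have "(\<Sum>y\<in>E \<union> S. \<mu> y *\<^sub>R h y) = (\<Sum>y\<in>E \<union> (S - {m}). \<mu> y *\<^sub>R h y)"
        using fin finS \<mu>m m(1) by (intro sum.mono_neutral_right) auto
      finally show ?thesis using \<beta>(1) by simp
    qed
    ultimately have "Q (S - {m})" unfolding Q_def using SA by blast
    moreover have "card (S - {m}) < card S" using m(1) finS by (intro card_Diff1_less) auto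
    ultimately show False using S(2) by blast
  qed
  have "indep_family h (E \<union> S)"
    unfolding indep_family_def
  proof (intro allI impI)
    fix \<beta> assume \<beta>: "(\<Sum>y\<in>E \<union> S. \<beta> y *\<^sub>R h y) = 0"
    then have neg: "(\<Sum>y\<in>E \<union> S. (- \<beta> y) *\<^sub>R h y) = 0" by (simp add: sum_negf)
    have S0: "\<beta> y = 0" if "y \<in> S" for y
      using no[OF \<beta> that] no[OF neg that] by force
    have "(\<Sum>y\<in>E \<union> S. \<beta> y *\<^sub>R h y) = (\<Sum>y\<in>E. \<beta> y *\<^sub>R h y)"
      using fin finS S0 by (intro sum.mono_neutral_right) auto
    then have "\<forall>y\<in>E. \<beta> y = 0" using \<beta> E(2) by (auto simp: indep_family_def)
    then show "\<forall>y\<in>E \<union> S. \<beta> y = 0" using S0 by auto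
  qed
  then show ?thesis using SA \<nu>' by blast
qed

text \<open>Farkas' lemma by separation: a finitely generated cone is closed, and minus the
  separating vector would violate the polar condition. The negatives of the generators in
  \<open>F\<close> make their coefficients free.\<close>

lemma polar_of_polar_finite:
  fixes h :: "'i \<Rightarrow> real^'n"
  assumes A: "finite A" "F \<subseteq> A"
    and polar: "\<And>v. (\<forall>y\<in>A - F. h y \<bullet> v \<le> 0) \<Longrightarrow> (\<forall>y\<in>F. h y \<bullet> v = 0) \<Longrightarrow> c \<bullet> v \<le> 0"
  shows "\<exists>\<nu>. (\<forall>y\<in>A - F. 0 \<le> \<nu> y) \<and> c = (\<Sum>y\<in>A. \<nu> y *\<^sub>R h y)"
proof -
  define K where "K = {x. \<exists>\<nu>. (\<forall>y\<in>A - F. 0 \<le> \<nu> y) \<and> x = (\<Sum>y\<in>A. \<nu> y *\<^sub>R h y)}"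
  define G where "G = h ` A \<union> (\<lambda>y. - h y) ` F"
  have "convex_cone K"
    unfolding convex_cone_iff
  proof (intro conjI ballI allI impI)
    show "0 \<in> K" unfolding K_def by (intro CollectI exI[of _ "\<lambda>y. 0"]) auto
  next
    fix x y assume "x \<in> K" "y \<in> K"
    then obtain \<nu> \<mu> where "\<forall>y\<in>A - F. 0 \<le> \<nu> y" "x = (\<Sum>y\<in>A. \<nu> y *\<^sub>R h y)"
      "\<forall>y\<in>A - F. 0 \<le> \<mu> y" "y = (\<Sum>y\<in>A. \<mu> y *\<^sub>R h y)" unfolding K_def by blast
    then show "x + y \<in> K"
      unfolding K_def
      by (intro CollectI exI[of _ "\<lambda>y. \<nu> y + \<mu> y"]) (auto simp: scaleR_add_left sum.distrib)
  next
    fix x and a :: real assume "x \<in> K" "0 \<le> a"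
    then obtain \<nu> where "\<forall>y\<in>A - F. 0 \<le> \<nu> y" "x = (\<Sum>y\<in>A. \<nu> y *\<^sub>R h y)" unfolding K_def by blast
    then show "a *\<^sub>R x \<in> K"
      unfolding K_def using \<open>0 \<le> a\<close>
      by (intro CollectI exI[of _ "\<lambda>y. a * \<nu> y"]) (auto simp: scaleR_sum_right)
  qed
  moreover have "G \<subseteq> K"
  proof -
    have single: "a *\<^sub>R h y = (\<Sum>z\<in>A. (if z = y then a else 0) *\<^sub>R h z)" if "y \<in> A" for a y
    proof -
      have "(\<Sum>z\<in>A. (if z = y then a else 0) *\<^sub>R h z) = (\<Sum>z\<in>A. if z = y then a *\<^sub>R h y else 0)"
        by (intro sum.cong) auto
      then show ?thesis using that A by simp
    qed
    have "h y \<in> K" if "y \<in> A" for y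
      unfolding K_def using single[OF that, of 1]
      by (intro CollectI exI[of _ "\<lambda>z. if z = y then 1 else 0"]) auto
    moreover have "- h y \<in> K" if "y \<in> F" for y
      unfolding K_def using single[of y "-1"] that A
      by (intro CollectI exI[of _ "\<lambda>z. if z = y then -1 else 0"]) auto
    ultimately show ?thesis by (auto simp: G_def)
  qed
  ultimately have sub: "convex_cone hull G \<subseteq> K" by (intro hull_minimal)
  have finG: "finite G" using A finite_subset by (auto simp: G_def)
  have "c \<in> convex_cone hull G"
  proof (rule ccontr)
    assume "c \<notin> convex_cone hull G"
    then obtain a b where ab: "a \<bullet> c < b" "\<And>x. x \<in> convex_cone hull G \<Longrightarrow> b < a \<bullet> x"
      using separating_hyperplane_closed_point[OF convex_convex_cone_hull closed_convex_cone_hull[OF finG]]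
      by blast
    have b: "b < 0" using ab(2)[OF convex_cone_hull_contains_0] by simp
    have pos: "0 \<le> a \<bullet> x" if x: "x \<in> G" for x
    proof (rule ray_bounded_below[of b 0])
      fix t :: real assume "0 \<le> t"
      then have "t *\<^sub>R x \<in> convex_cone hull G" using x by (intro convex_cone_hull_mul hull_inc)
      then show "b \<le> 0 + t * (a \<bullet> x)" using ab(2)[of "t *\<^sub>R x"] by simp
    qed
    have A0: "0 \<le> h y \<bullet> a" if "y \<in> A" for y using pos[of "h y"] that by (simp add: G_def inner_commute)
    have F0: "h y \<bullet> a \<le> 0" if "y \<in> F" for y using pos[of "- h y"] that by (simp add: G_def inner_commute)
    have "\<forall>y\<in>A - F. h y \<bullet> (- a) \<le> 0" using A0 by simp
    moreover have "\<forall>y\<in>F. h y \<bullet> (- a) = 0" using A0 F0 A(2) by (simp add: antisym subset_iff)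
    ultimately have "c \<bullet> (- a) \<le> 0" by (rule polar)
    then show False using ab(1) b by (simp add: inner_commute)
  qed
  then show ?thesis using sub unfolding K_def by blast
qed

section \<open>Starting the method\<close>

text \<open>The sign that makes the coefficient of an inequality nonnegative. The value -1 for
  equations turns their generator into the row itself.\<close>

definition msign :: "'n::finite rep \<Rightarrow> 'n var \<Rightarrow> real" where
  "msign P y = (case y of Lv i \<Rightarrow> if fac P i = Nonneg then 1 else - 1 | _ \<Rightarrow> 1)"

definition generator :: "'n::finite rep \<Rightarrow> 'n var \<Rightarrow> real^'n" where
  "generator P y = msign P y *\<^sub>R mpart P (\<lambda>z. if z = y then 1 else 0)"

definition equality_rows :: "'n::finite rep \<Rightarrow> 'n var set" where
  "equality_rows P = {Lv i |i. i < nrows P \<and> fac P i = Zero}"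

definition active :: "'n::finite rep \<Rightarrow> real^'n \<Rightarrow> 'n var set" where
  "active P z = {Lv i |i. i < nrows P \<and> rowA P i \<bullet> z = rhs P i} \<union>
     {Wv j |j. lbd P j = ereal (z $ j)} \<union> {Vv j |j. ubd P j = ereal (z $ j)}"

lemma msign_square [simp]: "msign P y * msign P y = 1"
  by (cases y) (auto simp: msign_def)

lemma mpart_eq_sum:
  assumes "finite J" "\<And>y. is_multiplier y \<Longrightarrow> y \<notin> J \<Longrightarrow> x y = 0"
  shows "mpart P x = (\<Sum>y\<in>J. x y *\<^sub>R mpart P (\<lambda>z. if z = y then 1 else 0))"
  using assms
proof (induction J arbitrary: x rule: finite_induct)
  case empty
  then show ?case by (simp add: vec_eq_iff mpart_def)
next
  case (insert e J)
  let ?u = "\<lambda>y z. if z = y then 1 else 0 :: real"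
  let ?x = "x(e := 0)"
  have x: "x = (\<lambda>y. 1 * ?x y + x e * ?u e y)" by auto
  have "mpart P x = mpart P ?x + x e *\<^sub>R mpart P (?u e)"
    by (subst x, subst mpart_lincomb) simp
  also have "mpart P ?x = (\<Sum>y\<in>J. ?x y *\<^sub>R mpart P (?u y))"
    using insert.prems by (intro insert.IH) auto
  also have "\<dots> = (\<Sum>y\<in>J. x y *\<^sub>R mpart P (?u y))"
    using insert.hyps by (intro sum.cong) auto
  finally show ?case using insert.hyps by (simp add: add.commute)
qed

lemma mpart_eq_sum_generator:
  assumes "finite J" "\<And>y. is_multiplier y \<Longrightarrow> y \<notin> J \<Longrightarrow> x y = 0"
  shows "mpart P x = (\<Sum>y\<in>J. (msign P y * x y) *\<^sub>R generator P y)"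
proof -
  have "(msign P y * x y) *\<^sub>R generator P y = x y *\<^sub>R mpart P (\<lambda>z. if z = y then 1 else 0)" for y
    by (simp add: generator_def mult.assoc[symmetric] mult.commute[of "msign P y * x y"])
  then show ?thesis using mpart_eq_sum[OF assms] by simp
qed

lemma generator_inner:
  "i < nrows P \<Longrightarrow> generator P (Lv i) \<bullet> v = - msign P (Lv i) * (rowA P i \<bullet> v)"
  "generator P (Wv j) \<bullet> v = - v $ j" "generator P (Vv j) \<bullet> v = v $ j"
proof -
  have eq: "(if b then 1 else 0 :: real) * x = (if b then x else 0)" for b x by simp
  show "i < nrows P \<Longrightarrow> generator P (Lv i) \<bullet> v = - msign P (Lv i) * (rowA P i \<bullet> v)"
    by (simp add: generator_def mpart_inner sum_negf eq)
  show "generator P (Wv j) \<bullet> v = - v $ j" "generator P (Vv j) \<bullet> v = v $ j"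
    by (simp_all add: generator_def msign_def mpart_inner sum_negf eq)
qed

lemma active_subset: "active P z \<subseteq> variables P" "y \<in> active P z \<Longrightarrow> is_multiplier y"
  by (auto simp: active_def)

lemma finite_active: "finite (active P z)"
  using active_subset(1) finite_variables finite_subset by blast

section \<open>Normal cones generated by the active constraints\<close>

context feasible_rep
begin

context
  fixes z assumes z: "z \<in> feasible_set P"
begin

lemma equality_rows_active: "equality_rows P \<subseteq> active P z"
  using z by (auto simp: equality_rows_def active_def feasible_set_def)

lemma active_feasible_direction:
  assumes 1: "\<And>y. y \<in> active P z - equality_rows P \<Longrightarrow> generator P y \<bullet> v \<le> 0"
    and 2: "\<And>y. y \<in> equality_rows P \<Longrightarrow> generator P y \<bullet> v = 0"
  shows "\<exists>\<delta>>0. z + \<delta> *\<^sub>R v \<in> feasible_set P"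
proof (rule feasible_direction[OF z])
  fix y u assume y: "y \<in> primal P" and u: "has_bound P u y" and b: "bnd u y = val P y z"
  show "sg u * grad P y v \<le> 0"
  proof (cases y)
    case (Sv i)
    then have i: "i < nrows P" using y by (auto simp: primal_def)
    have g: "generator P (Lv i) \<bullet> v = - msign P (Lv i) * (rowA P i \<bullet> v)" by (rule generator_inner(1)[OF i])
    have "val P y z = 0 \<Longrightarrow> Lv i \<in> active P z" using i Sv by (auto simp: active_def val_def)
    moreover have "bnd u y = 0" using Sv u by (auto simp: bnd_def lower_def upper_def has_bound_def)
    ultimately have act: "Lv i \<in> active P z" using b by simp
    show ?thesis
    proof (cases "fac P i = Zero")
      case True
      then show ?thesis using 2[of "Lv i"] i g Sv by (auto simp: equality_rows_def grad_def msign_def)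
    next
      case False
      then have "generator P (Lv i) \<bullet> v \<le> 0" using 1[of "Lv i"] act by (auto simp: equality_rows_def)
      then show ?thesis
        using g Sv u i False
        by (cases "fac P i"; cases u) (auto simp: grad_def msign_def has_bound_def lower_def upper_def)
    qed
  next
    case (Zv j)
    show ?thesis
    proof (cases u)
      case True
      then have "ubd P j = ereal (z $ j)"
        using b u Zv upper_finite[of y] by (auto simp: bnd_def upper_def val_def)
      then have "generator P (Vv j) \<bullet> v \<le> 0" using 1[of "Vv j"] by (auto simp: active_def equality_rows_def)
      then show ?thesis using True Zv by (simp add: generator_inner grad_def)
    next
      case False
      then have "lbd P j = ereal (z $ j)"
        using b u Zv lower_finite[of y] by (auto simp: bnd_def lower_def val_def)
      then have "generator P (Wv j) \<bullet> v \<le> 0" using 1[of "Wv j"] by (auto simp: active_def equality_rows_def)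
      then show ?thesis using False Zv by (simp add: generator_inner grad_def)
    qed
  qed (use y in \<open>auto simp: primal_def\<close>)
qed

text \<open>A direction in the polar of the active generators is feasible for a short step, so a
  normal is nonpositive on it; Farkas' lemma does the rest.\<close>

lemma normal_cone_generated:
  assumes c: "c \<in> normal_cone (feasible_set P) z"
  shows "\<exists>\<nu>. (\<forall>y\<in>active P z - equality_rows P. 0 \<le> \<nu> y) \<and> c = (\<Sum>y\<in>active P z. \<nu> y *\<^sub>R generator P y)"
proof (rule polar_of_polar_finite[OF finite_active equality_rows_active])
  fix v assume "\<forall>y\<in>active P z - equality_rows P. generator P y \<bullet> v \<le> 0" "\<forall>y\<in>equality_rows P. generator P y \<bullet> v = 0"
  then obtain \<delta> where \<delta>: "0 < \<delta>" "z + \<delta> *\<^sub>R v \<in> feasible_set P" using active_feasible_direction by blast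
  then have "c \<bullet> (z + \<delta> *\<^sub>R v - z) \<le> 0" using c unfolding normal_cone_def by blast
  then show "c \<bullet> v \<le> 0" using \<delta>(1) by (simp add: mult_le_0_iff)
qed

lemma generator_normal: "y \<in> active P z \<Longrightarrow> generator P y \<in> normal_cone (feasible_set P) z"
  unfolding normal_cone_def
proof (intro CollectI ballI)
  fix z' assume y: "y \<in> active P z" and z': "z' \<in> feasible_set P"
  show "generator P y \<bullet> (z' - z) \<le> 0"
  proof (cases y)
    case (Lv i)
    then have i: "i < nrows P" "rowA P i \<bullet> z = rhs P i" using y by (auto simp: active_def)
    have "rowA P i \<bullet> z' - rhs P i \<in> factor_set (fac P i)" using z' i by (auto simp: feasible_set_def)
    then show ?thesis
      using Lv i by (cases "fac P i") (auto simp: generator_inner(1) msign_def inner_diff_right)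
  next
    case (Wv j)
    then have "lbd P j = ereal (z $ j)" using y by (auto simp: active_def)
    moreover have "lbd P j \<le> ereal (z' $ j)" using z' by (auto simp: feasible_set_def)
    ultimately show ?thesis using Wv by (simp add: generator_inner)
  next
    case (Vv j)
    then have "ubd P j = ereal (z $ j)" using y by (auto simp: active_def)
    moreover have "ereal (z' $ j) \<le> ubd P j" using z' by (auto simp: feasible_set_def)
    ultimately show ?thesis using Vv by (simp add: generator_inner)
  qed (use y in \<open>auto simp: active_def\<close>)
qed

end

context
  fixes z assumes ext: "z extreme_point_of feasible_set P"
begin

lemma extreme_feasible: "z \<in> feasible_set P"
  using ext by (simp add: extreme_point_of_def)

text \<open>A vector orthogonal to all active gradients could be followed a little way in both
  directions, against extremality.\<close>

lemma extreme_generators_span: "span (generator P ` active P z) = UNIV"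
proof (rule ccontr)
  assume "span (generator P ` active P z) \<noteq> UNIV"
  then obtain v where v: "v \<noteq> 0" "\<forall>x\<in>span (generator P ` active P z). v \<bullet> x = 0"
    using span_not_UNIV_orthogonal by blast
  have g: "generator P y \<bullet> v = 0" if "y \<in> active P z" for y
    using v(2) that by (metis imageI inner_commute span_base)
  have dir: "\<exists>\<delta>>0. z + \<delta> *\<^sub>R w \<in> feasible_set P" if w: "w = v \<or> w = - v" for w
  proof (rule active_feasible_direction[OF extreme_feasible])
    have gw: "generator P y \<bullet> w = 0" if "y \<in> active P z" for y using g[OF that] w by auto
    then show "generator P y \<bullet> w \<le> 0" if "y \<in> active P z - equality_rows P" for y using that by auto
    show "generator P y \<bullet> w = 0" if "y \<in> equality_rows P" for y
      using gw that equality_rows_active[OF extreme_feasible] by blast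
  qed
  obtain d where d: "0 < d" "z + d *\<^sub>R v \<in> feasible_set P" using dir[of v] by blast
  obtain e where e: "0 < e" "z + e *\<^sub>R (- v) \<in> feasible_set P" using dir[of "- v"] by blast
  \<comment> \<open>The weight at which the two steps, of different lengths, cancel.\<close>
  define u where "u = d / (d + e)"
  have u: "(1 - u) * d - u * e = 0" "0 < u" "u < 1" using d e by (auto simp: u_def field_simps)
  have "z \<in> open_segment (z + d *\<^sub>R v) (z + e *\<^sub>R (- v))"
    unfolding in_segment
  proof (intro conjI exI[of _ u])
    have "d *\<^sub>R v + e *\<^sub>R v \<noteq> 0" using v(1) d e by (simp add: scaleR_add_left[symmetric])
    then show "z + d *\<^sub>R v \<noteq> z + e *\<^sub>R - v" by (auto simp: add_eq_0_iff)
    have "(1 - u) *\<^sub>R (z + d *\<^sub>R v) + u *\<^sub>R (z + e *\<^sub>R - v) = z + ((1 - u) * d - u * e) *\<^sub>R v"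
      by (simp add: algebra_simps)
    then show "z = (1 - u) *\<^sub>R (z + d *\<^sub>R v) + u *\<^sub>R (z + e *\<^sub>R - v)" unfolding u(1) by simp
  qed (use u in auto)
  then show False using ext d e unfolding extreme_point_of_def by blast
qed

lemma extreme_rel_interior:
  "rel_interior (normal_cone (feasible_set P) z) = interior (normal_cone (feasible_set P) z)"
proof (rule rel_interior_interior)
  let ?N = "normal_cone (feasible_set P) z"
  have "0 \<in> ?N" by (simp add: normal_cone_def)
  then have "affine hull ?N = span ?N" by (intro affine_hull_span_0 hull_inc)
  moreover have "span (generator P ` active P z) \<subseteq> span ?N"
    using generator_normal[OF extreme_feasible] by (intro span_mono) auto
  ultimately show "affine hull ?N = UNIV" using extreme_generators_span by auto
qed

text \<open>t r - w is t times r - w / t, which for large t stays in a ball around r inside the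
  cone; the 1 in the threshold keeps t positive.\<close>

lemma eventually_normal:
  assumes r: "r \<in> interior (normal_cone (feasible_set P) z)"
  shows "\<exists>t1\<ge>0. \<forall>t\<ge>t1. t *\<^sub>R r - w \<in> normal_cone (feasible_set P) z"
proof -
  obtain e where e: "0 < e" "cball r e \<subseteq> normal_cone (feasible_set P) z"
    using r by (auto simp: mem_interior_cball)
  show ?thesis
  proof (intro exI[of _ "norm w / e + 1"] conjI allI impI)
    show "0 \<le> norm w / e + 1" using e by simp
    fix t assume t: "norm w / e + 1 \<le> t"
    have "0 \<le> norm w / e" using e by simp
    then have t0: "0 < t" using t by linarith
    have "norm w \<le> t * e" using t e by (simp add: field_simps)
    then have "norm (w /\<^sub>R t) \<le> e" using t0 by (simp add: field_simps)
    then have "r - w /\<^sub>R t \<in> normal_cone (feasible_set P) z" using e(2) by (auto simp: dist_norm)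
    then have *: "(r - w /\<^sub>R t) \<bullet> (z' - z) \<le> 0" if "z' \<in> feasible_set P" for z'
      using that by (auto simp: normal_cone_def)
    have eq: "t *\<^sub>R r - w = t *\<^sub>R (r - w /\<^sub>R t)" using t0 by (simp add: scaleR_diff_right)
    show "t *\<^sub>R r - w \<in> normal_cone (feasible_set P) z"
      unfolding eq normal_cone_def using * t0 by (auto simp: mult_nonneg_nonpos)
  qed
qed

text \<open>The bases obtained from Caratheodory's theorem for \<open>t = t1, t1 + 1, \<dots>\<close> repeat infinitely
  often, and the set of \<open>t\<close> that belong to one basis is convex.\<close>

lemma starting_generators:
  assumes r: "r \<in> interior (normal_cone (feasible_set P) z)"
  shows "\<exists>J t0. J \<subseteq> active P z \<and> indep_family (generator P) J \<and> card J = CARD('n) \<and>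
      span (generator P ` J) = UNIV \<and>
      generator P ` equality_rows P \<subseteq> span (generator P ` (J \<inter> equality_rows P)) \<and> 0 \<le> t0 \<and>
      (\<forall>t\<ge>t0. \<exists>\<nu>. (\<forall>y\<in>J - equality_rows P. 0 \<le> \<nu> y) \<and> t *\<^sub>R r - w = (\<Sum>y\<in>J. \<nu> y *\<^sub>R generator P y))"
proof -
  let ?h = "generator P" and ?A = "active P z" and ?F = "equality_rows P"
  note FA = equality_rows_active[OF extreme_feasible]
  obtain t1 where t1: "0 \<le> t1" "\<And>t. t1 \<le> t \<Longrightarrow> t *\<^sub>R r - w \<in> normal_cone (feasible_set P) z"
    using eventually_normal[OF r] by blast
  \<comment> \<open>A maximal independent set of equations, put into every basis; it yields the
    redundancy condition of \<open>vertex_basis\<close>.\<close>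
  obtain E where E: "E \<subseteq> ?F" "indep_family ?h E" "?h ` ?F \<subseteq> span (?h ` E)"
    using indep_family_extend[of ?F "{}" ?h] finite_subset[OF FA finite_active] by auto
  define Q where "Q t J \<nu> \<longleftrightarrow> E \<subseteq> J \<and> J \<subseteq> ?A \<and> indep_family ?h J \<and> ?h ` ?A \<subseteq> span (?h ` J) \<and>
      (\<forall>y\<in>J - ?F. 0 \<le> \<nu> y) \<and> t *\<^sub>R r - w = (\<Sum>y\<in>J. \<nu> y *\<^sub>R ?h y)" for t J \<nu>
  have Q: "\<exists>J \<nu>. Q t J \<nu>" if t: "t1 \<le> t" for t
  proof -
    obtain \<nu> where \<nu>: "\<And>y. y \<in> ?A - ?F \<Longrightarrow> 0 \<le> \<nu> y" "t *\<^sub>R r - w = (\<Sum>y\<in>?A. \<nu> y *\<^sub>R ?h y)"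
      using normal_cone_generated[OF extreme_feasible t1(2)[OF t]] by blast
    obtain S \<mu> where S: "S \<subseteq> ?A - ?F" "indep_family ?h (E \<union> S)" "\<forall>y\<in>S. 0 \<le> \<mu> y"
        "t *\<^sub>R r - w = (\<Sum>y\<in>E \<union> S. \<mu> y *\<^sub>R ?h y)"
      using conic_caratheodory[OF finite_active FA E \<nu>(2,1)] by blast
    have ES: "E \<union> S \<subseteq> ?A" using S(1) E(1) FA by blast
    obtain J where J: "E \<union> S \<subseteq> J" "J \<subseteq> ?A" "indep_family ?h J" "?h ` ?A \<subseteq> span (?h ` J)"
      using indep_family_extend[OF finite_active ES S(2)] by blast
    let ?\<nu> = "\<lambda>y. if y \<in> E \<union> S then \<mu> y else 0"
    have "(\<Sum>y\<in>J. ?\<nu> y *\<^sub>R ?h y) = (\<Sum>y\<in>E \<union> S. \<mu> y *\<^sub>R ?h y)"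
      using J(1) finite_subset[OF J(2) finite_active] by (intro sum.mono_neutral_cong_right) auto
    then have "t *\<^sub>R r - w = (\<Sum>y\<in>J. ?\<nu> y *\<^sub>R ?h y)" using S(4) by simp
    moreover have "\<forall>y\<in>J - ?F. 0 \<le> ?\<nu> y" using S(3) E(1) by auto
    moreover have "E \<subseteq> J" using J(1) by blast
    ultimately show ?thesis
      unfolding Q_def using J(2-4) by (intro exI[of _ J] exI[of _ ?\<nu>] conjI)
  qed
  have "\<forall>k. \<exists>J \<nu>. Q (t1 + real k) J \<nu>" using Q by simp
  then obtain J where "\<forall>k. \<exists>\<nu>. Q (t1 + real k) (J k) \<nu>" by metis
  then obtain \<nu> where Q: "\<And>k. Q (t1 + real k) (J k) (\<nu> k)" by metis
  have J: "\<And>k. E \<subseteq> J k" "\<And>k. J k \<subseteq> ?A" "\<And>k. indep_family ?h (J k)"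
      "\<And>k. ?h ` ?A \<subseteq> span (?h ` J k)"
      and \<nu>: "\<And>k y. y \<in> J k - ?F \<Longrightarrow> 0 \<le> \<nu> k y"
        "\<And>k. (t1 + real k) *\<^sub>R r - w = (\<Sum>y\<in>J k. \<nu> k y *\<^sub>R ?h y)"
    using Q unfolding Q_def by blast+
  have "finite (J ` UNIV)" by (rule finite_subset[of _ "Pow ?A"]) (use J(2) finite_active in auto)
  then obtain k0 where "infinite {k \<in> UNIV. J k = J k0}" using pigeonhole_infinite[of UNIV J] by auto
  then have inf: "infinite {k. J k = J k0}" by simp
  let ?J = "J k0"
  have span: "span (?h ` ?J) = UNIV"
    using extreme_generators_span J(4)[of k0] by (metis span_minimal subspace_span top.extremum_uniqueI)
  have finJ: "finite ?J" using J(2) finite_active finite_subset by blast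
  have "\<exists>\<mu>. (\<forall>y\<in>?J - ?F. 0 \<le> \<mu> y) \<and> t *\<^sub>R r - w = (\<Sum>y\<in>?J. \<mu> y *\<^sub>R ?h y)"
    if t: "t1 + real k0 \<le> t" for t
  proof -
    \<comment> \<open>A later repetition of the same basis lies beyond \<open>t\<close>;
      interpolating between the two occurrences keeps the coefficients nonnegative.\<close>
    obtain k where k: "J k = ?J" "nat \<lceil>t - t1\<rceil> + k0 + 1 \<le> k"
      using inf by (metis (mono_tags) infinite_nat_iff_unbounded_le mem_Collect_eq)
    have kt: "t \<le> t1 + real k" "k0 < k" using k(2) by linarith+
    define \<theta> where "\<theta> = (t - (t1 + real k0)) / (real k - real k0)"
    have \<theta>: "0 \<le> \<theta>" "\<theta> \<le> 1" using t kt by (auto simp: \<theta>_def field_simps)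
    have "\<theta> * (real k - real k0) = t - (t1 + real k0)" using kt by (simp add: \<theta>_def)
    then have tt: "t = (1 - \<theta>) * (t1 + real k0) + \<theta> * (t1 + real k)" by (simp add: algebra_simps)
    have "t *\<^sub>R r - w = (1 - \<theta>) *\<^sub>R ((t1 + real k0) *\<^sub>R r - w) + \<theta> *\<^sub>R ((t1 + real k) *\<^sub>R r - w)"
      by (subst tt) (simp add: algebra_simps)
    also have "\<dots> = (\<Sum>y\<in>?J. ((1 - \<theta>) * \<nu> k0 y + \<theta> * \<nu> k y) *\<^sub>R ?h y)"
      unfolding \<nu>(2) k(1) by (simp add: scaleR_sum_right sum.distrib scaleR_add_left)
    finally show ?thesis
      using \<theta> \<nu>(1)[of _ k0] \<nu>(1)[of _ k] k(1)
      by (intro exI[of _ "\<lambda>y. (1 - \<theta>) * \<nu> k0 y + \<theta> * \<nu> k y"]) auto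
  qed
  moreover have "?h ` ?F \<subseteq> span (?h ` (?J \<inter> ?F))"
    using E(3) span_mono[of "?h ` E" "?h ` (?J \<inter> ?F)"] J(1)[of k0] E(1) by blast
  ultimately show ?thesis
    using J(2,3)[of k0] span indep_family_card[OF finJ J(3) span] t1(1)
    by (intro exI[of _ ?J] exI[of _ "t1 + real k0"]) auto
qed

end

end

text \<open>The groups of complementary variables correspond to the equations of the system, and a
  complementary set picks one variable from each group.\<close>

lemma complementary_card:
  fixes P :: "'n::finite rep"
  assumes c: "complementary P B" and B: "B \<subseteq> variables P"
  shows "card B = CARD('n) + nrows P"
proof -
  define grp :: "'n var \<Rightarrow> 'n + nat" where
    "grp y = (case y of Zv j \<Rightarrow> Inl j | Wv j \<Rightarrow> Inl j | Vv j \<Rightarrow> Inl j | Sv i \<Rightarrow> Inr i | Lv i \<Rightarrow> Inr i | Tv \<Rightarrow> Inr 0)" for y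
  have rows: "(Sv i \<in> B) \<noteq> (Lv i \<in> B)" if "i < nrows P" for i
    using c that by (simp add: complementary_iff)
  have cols: "Zv j \<in> B \<and> Wv j \<notin> B \<and> Vv j \<notin> B \<or> Zv j \<notin> B \<and> Wv j \<in> B \<and> Vv j \<notin> B \<or>
      Zv j \<notin> B \<and> Wv j \<notin> B \<and> Vv j \<in> B" for j
    using c by (simp add: complementary_iff)
  have T: "Tv \<notin> B" using c by (simp add: complementary_iff)
  have lt: "Sv i \<in> B \<Longrightarrow> i < nrows P" "Lv i \<in> B \<Longrightarrow> i < nrows P" for i
    using B by auto
  have "inj_on grp B"
  proof (rule inj_onI)
    fix x y assume xy: "x \<in> B" "y \<in> B" "grp x = grp y"
    show "x = y"
    proof (cases "grp x")
      case (Inl j)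
      then have "x \<in> {Zv j, Wv j, Vv j}" "y \<in> {Zv j, Wv j, Vv j}"
        using xy T by (auto simp: grp_def split: var.splits)
      then show ?thesis using cols[of j] xy by auto
    next
      case (Inr i)
      then have "x \<in> {Sv i, Lv i}" "y \<in> {Sv i, Lv i}"
        using xy T by (auto simp: grp_def split: var.splits)
      then show ?thesis using rows[of i] lt[of i] xy by auto
    qed
  qed
  moreover have "grp ` B = equations P"
  proof
    show "grp ` B \<subseteq> equations P"
      using lt T by (auto simp: grp_def equations_def split: var.splits)
    show "equations P \<subseteq> grp ` B"
    proof
      fix e assume "e \<in> equations P"
      then consider j where "e = Inl j" | i where "e = Inr i" "i < nrows P" by (auto simp: equations_def)
      then show "e \<in> grp ` B"
      proof cases
        case (1 j)
        then have "grp (Zv j) = e" "grp (Wv j) = e" "grp (Vv j) = e" by (auto simp: grp_def)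
        then show ?thesis using cols[of j] by (metis imageI)
      next
        case (2 i)
        then have "grp (Sv i) = e" "grp (Lv i) = e" by (auto simp: grp_def)
        then show ?thesis using rows[OF 2(2)] by (metis imageI)
      qed
    qed
  qed
  ultimately show ?thesis using card_image card_equations(1)[of P] by metis
qed

lemma generator_row: "i < nrows P \<Longrightarrow> generator P (Lv i) = (- msign P (Lv i)) *\<^sub>R rowA P i"
  by (subst vector_eq_rdot[symmetric]) (simp add: generator_inner)

context feasible_rep
begin

lemma start_exists:
  fixes M :: "real^'n^'n" and q z r :: "real^'n"
  assumes ext: "z extreme_point_of feasible_set P"
    and r: "r \<in> interior (normal_cone (feasible_set P) z)"
  shows "\<exists>ord s. start P M q z r ord s"
proof -
  let ?h = "generator P" and ?F = "equality_rows P"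
  have zC: "z \<in> feasible_set P" using extreme_feasible[OF ext] .
  obtain J t0 where J: "J \<subseteq> active P z" "indep_family ?h J" "card J = CARD('n)" "span (?h ` J) = UNIV"
      "?h ` ?F \<subseteq> span (?h ` (J \<inter> ?F))" and t0: "0 \<le> t0"
      and \<nu>: "\<And>t. t0 \<le> t \<Longrightarrow> \<exists>\<nu>. (\<forall>y\<in>J - ?F. 0 \<le> \<nu> y) \<and> t *\<^sub>R r - (M *v z + q) = (\<Sum>y\<in>J. \<nu> y *\<^sub>R ?h y)"
    using starting_generators[OF ext r, of "M *v z + q"] by blast
  have Jm: "is_multiplier y" "y \<in> variables P" if "y \<in> J" for y
    using that J(1) active_subset(1)[of P z] active_subset(2)[of y P z] by auto
  have finJ: "finite J" using J(1) finite_active finite_subset by blast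
  \<comment> \<open>The gradients of the two bounds of a component are opposite, so an independent
    family cannot contain both.\<close>
  have WV: "\<not> (Wv j \<in> J \<and> Vv j \<in> J)" for j
  proof
    assume "Wv j \<in> J \<and> Vv j \<in> J"
    then have i: "indep_family ?h {Wv j, Vv j}" using indep_family_subset[OF J(2) _ finJ] by auto
    have "?h (Wv j) + ?h (Vv j) = 0"
      by (subst vector_eq_rdot[symmetric]) (simp add: generator_inner inner_add_left)
    then have S: "(\<Sum>y\<in>{Wv j, Vv j}. 1 *\<^sub>R ?h y) = 0" by simp
    show False using i[unfolded indep_family_def, THEN spec, THEN mp, OF S, THEN bspec, of "Wv j"] by simp
  qed
  define B where "B = J \<union> Sv ` {i. i < nrows P \<and> Lv i \<notin> J} \<union> Zv ` {j. Wv j \<notin> J \<and> Vv j \<notin> J}"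
  have mem: "Sv i \<in> B \<longleftrightarrow> i < nrows P \<and> Lv i \<notin> J" "Lv i \<in> B \<longleftrightarrow> Lv i \<in> J"
      "Zv j \<in> B \<longleftrightarrow> Wv j \<notin> J \<and> Vv j \<notin> J" "Wv j \<in> B \<longleftrightarrow> Wv j \<in> J" "Vv j \<in> B \<longleftrightarrow> Vv j \<in> J" "Tv \<notin> B" for i j
    using Jm(1)[of "Sv i"] Jm(1)[of "Zv j"] Jm(1)[of Tv] by (auto simp: B_def)
  have Lm: "i < nrows P" if "Lv i \<in> J" for i using Jm(2)[OF that] by simp
  have comp: "complementary P B" unfolding complementary_iff mem(1-5) using WV mem(6) by auto
  have BV: "B \<subseteq> variables P" using Jm by (auto simp: B_def)
  have mult: "{y \<in> B. is_multiplier y} = J" using Jm by (auto simp: B_def)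
  \<comment> \<open>Constraints with a basic multiplier do not move and their gradients span, so z
    vanishes; then independence makes the multipliers vanish.\<close>
  have basis: "is_basis P M r B"
    unfolding is_basis_def
  proof (intro conjI allI impI BV complementary_card[OF comp BV])
    fix x y assume x: "solves_homogeneous P M r x \<and> (\<forall>y. y \<notin> B \<longrightarrow> x y = 0)"
    then have off: "\<And>y. y \<notin> B \<Longrightarrow> x y = 0" by blast
    have gen: "?h y \<bullet> zpart x = 0" if y: "y \<in> J" for y
    proof (cases y)
      case (Lv i)
      then have "x (Sv i) = 0" "i < nrows P" using y off[of "Sv i"] mem(1)[of i] Lm by auto
      then have "rowA P i \<bullet> zpart x = 0" using x by (auto simp: solves_homogeneous_def)
      then show ?thesis using Lv \<open>i < nrows P\<close> by (simp add: generator_inner)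
    next
      case (Wv j)
      then show ?thesis using y off[of "Zv j"] mem(3)[of j] by (simp add: generator_inner)
    next
      case (Vv j)
      then show ?thesis using y off[of "Zv j"] mem(3)[of j] by (simp add: generator_inner)
    qed (use Jm(1)[OF y] in auto)
    have "a \<bullet> zpart x = 0" if "a \<in> span (?h ` J)" for a
      using that by (induction rule: span_induct_alt) (auto simp: inner_add_left gen)
    then have z0: "zpart x = 0" using J(4) by (metis UNIV_I inner_eq_zero_iff)
    have T0: "x Tv = 0" using off mem(6) by blast
    have m0: "mpart P x = 0" using x z0 T0 by (simp add: solves_homogeneous_def)
    have S: "mpart P x = (\<Sum>y\<in>J. (msign P y * x y) *\<^sub>R ?h y)"
      by (rule mpart_eq_sum_generator[OF finJ]) (use off mult in blast)
    have "\<forall>y\<in>J. msign P y * x y = 0"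
      using J(2)[unfolded indep_family_def, THEN spec, THEN mp, OF trans[OF S[symmetric] m0]] .
    moreover have "msign P y \<noteq> 0" for y by (metis msign_square mult_zero_left zero_neq_one)
    ultimately have xJ: "x y = 0" if "y \<in> J" for y using that by simp
    show "x y = 0"
    proof (cases y)
      case (Zv j)
      then show ?thesis using z0 by (metis zero_index zpart_nth)
    next
      case (Sv i)
      then show ?thesis
        using x z0 off[of y] mem(1)[of i] by (cases "i < nrows P") (auto simp: solves_homogeneous_def)
    qed (use off[of y] xJ[of y] mem T0 in auto)
  qed
  have redundant: "rowA P i \<in> span {rowA P k |k. k < nrows P \<and> fac P k = Zero \<and> Lv k \<in> B}"
    if i: "i < nrows P" "fac P i = Zero" for i
  proof -
    have h: "?h (Lv k) = rowA P k" if "k < nrows P" "fac P k = Zero" for k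
      using that by (simp add: generator_row msign_def)
    have "Lv i \<in> ?F" using i by (simp add: equality_rows_def)
    then have "rowA P i \<in> span (?h ` (J \<inter> ?F))" using J(5) h[OF i] by (metis imageI subsetD)
    moreover have "?h ` (J \<inter> ?F) \<subseteq> {rowA P k |k. k < nrows P \<and> fac P k = Zero \<and> Lv k \<in> B}"
      using h mem(2) by (auto simp: equality_rows_def)
    ultimately show ?thesis using span_mono by blast
  qed
  have vertex: "vertex_basis P M r B"
    unfolding vertex_basis_def using basis comp mult J(3) redundant by simp
  have ray: "\<exists>x. starting_ray_point P M q z r B x \<and> x Tv = t" if t: "t0 \<le> t" for t
  proof -
    obtain \<mu> where \<mu>: "\<forall>y\<in>J - ?F. 0 \<le> \<mu> y" "t *\<^sub>R r - (M *v z + q) = (\<Sum>y\<in>J. \<mu> y *\<^sub>R ?h y)"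
      using \<nu>[OF t] by blast
    define x where "x y = (case y of Zv j \<Rightarrow> z $ j
        | Sv i \<Rightarrow> if i < nrows P then rowA P i \<bullet> z - rhs P i else 0
        | Tv \<Rightarrow> t
        | _ \<Rightarrow> if y \<in> J then msign P y * \<mu> y else 0)" for y
    have xm: "x y = (if y \<in> J then msign P y * \<mu> y else 0)" if "is_multiplier y" for y
      using that by (cases y) (auto simp: x_def)
    have "mpart P x = (\<Sum>y\<in>J. (msign P y * x y) *\<^sub>R ?h y)"
      by (rule mpart_eq_sum_generator[OF finJ]) (simp add: xm)
    also have "\<dots> = (\<Sum>y\<in>J. \<mu> y *\<^sub>R ?h y)"
      using xm Jm(1) by (intro sum.cong) (auto simp: mult.assoc[symmetric])
    finally have mp: "mpart P x = t *\<^sub>R r - (M *v z + q)" using \<mu>(2) by simp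
    have zp: "zpart x = z" by (simp add: vec_eq_iff x_def)
    have "solves_system P M q r x"
      unfolding solves_system_def zp mp by (simp add: x_def)
    moreover have "within_bounds P x"
      unfolding within_bounds_def
    proof
      fix y
      show "lower P y \<le> ereal (x y) \<and> ereal (x y) \<le> upper P y"
      proof (cases y)
        case (Zv j)
        then show ?thesis using zC by (auto simp: feasible_set_def lower_def upper_def x_def)
      next
        case (Sv i)
        then show ?thesis
          using zC by (cases "i < nrows P"; cases "fac P i")
            (auto simp: feasible_set_def lower_def upper_def x_def dest!: spec[of _ i])
      next
        case (Lv i)
        have "Lv i \<in> J \<Longrightarrow> fac P i \<noteq> Zero \<Longrightarrow> 0 \<le> \<mu> (Lv i)"
          using \<mu>(1) by (auto simp: equality_rows_def)
        then show ?thesis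
          using Lv Lm[of i] by (cases "fac P i") (auto simp: xm lower_def upper_def msign_def)
      next
        case (Wv j)
        then show ?thesis
          using \<mu>(1) Jm(2)[of y] by (auto simp: xm lower_def upper_def msign_def equality_rows_def)
      next
        case (Vv j)
        then show ?thesis
          using \<mu>(1) Jm(2)[of y] by (auto simp: xm lower_def upper_def msign_def equality_rows_def)
      next
        case Tv
        then show ?thesis using t t0 by (simp add: x_def lower_def upper_def)
      qed
    qed
    moreover have "x y = 0" if y: "y \<notin> B" "y \<noteq> Tv" "y \<notin> range Zv" for y
    proof (cases y)
      case (Sv i)
      then have "i < nrows P \<Longrightarrow> Lv i \<in> active P z" using y(1) mem(1)[of i] J(1) by auto
      then show ?thesis using Sv by (auto simp: x_def active_def)
    qed (use y mem in \<open>auto simp: xm\<close>)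
    moreover have "ereal (x (Zv j)) = lbd P j" if "Wv j \<in> B" for j
    proof -
      have "Wv j \<in> active P z" using that mem(4) J(1) by auto
      then show ?thesis by (auto simp: active_def x_def)
    qed
    moreover have "ereal (x (Zv j)) = ubd P j" if "Vv j \<in> B" for j
    proof -
      have "Vv j \<in> active P z" using that mem(5) J(1) by auto
      then show ?thesis by (auto simp: active_def x_def)
    qed
    ultimately have "starting_ray_point P M q z r B x"
      unfolding starting_ray_point_def using zp by blast
    moreover have "x Tv = t" by (simp add: x_def)
    ultimately show ?thesis by blast
  qed
  \<comment> \<open>The multipliers are listed before the other basic variables, as
    \<open>start\<close> demands.\<close>
  obtain xs where xs: "set xs = J" "distinct xs" using finite_distinct_list[OF finJ] by blast
  have "finite (B - J)" using is_basis_finite[OF basis] by simp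
  then obtain ys where ys: "set ys = B - J" "distinct ys" using finite_distinct_list by blast
  have JB: "J \<subseteq> B" by (auto simp: B_def)
  have order: "is_multiplier ((xs @ ys) ! i)"
    if i: "i < k" "k < length (xs @ ys)" "is_multiplier ((xs @ ys) ! k)" for i k
  proof -
    have "k < length xs"
    proof (rule ccontr)
      assume n: "\<not> k < length xs"
      then have "(xs @ ys) ! k \<in> set ys" using i(2) by (simp add: nth_append)
      then show False using i(3) ys(1) mult by blast
    qed
    then have "(xs @ ys) ! i \<in> J" using i(1) xs(1) by (auto simp: nth_append)
    then show ?thesis using Jm(1) by blast
  qed
  obtain x where x: "starting_ray_point P M q z r B x" "x Tv = t0" using ray[of t0] by blast
  define s where "s = \<lparr>basis = B, point = (\<lambda>y k. if k = 0 then x y else 0), entering = Tv, sense = - 1\<rparr>"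
  have "start P M q z r (xs @ ys) s"
    unfolding start_def
  proof (intro conjI)
    show "vertex_basis P M r (basis s)" using vertex by (simp add: s_def)
    show "distinct (xs @ ys)" "set (xs @ ys) = basis s" using xs ys JB by (auto simp: s_def)
    show "\<forall>i k. i < k \<and> k < length (xs @ ys) \<and> is_multiplier ((xs @ ys) ! k) \<longrightarrow> is_multiplier ((xs @ ys) ! i)"
      using order by blast
    show "starting_ray_point P M q z r (basis s) (\<lambda>y. point s y 0)" using x by (simp add: s_def)
    show "\<forall>t\<ge>point s Tv 0. \<exists>x. starting_ray_point P M q z r (basis s) x \<and> x Tv = t"
      using ray x(2) by (simp add: s_def)
  qed (auto simp: s_def)
  then show ?thesis by blast
qed

end

section \<open>Extreme points and representations\<close>

text \<open>Convex combinations of \<open>y\<close> with points ever farther out on the line tend to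
  a translate of \<open>y\<close> along it, so closedness carries the line from \<open>x\<close> to
  every \<open>y\<close>.\<close>

lemma lineality_line:
  assumes C: "convex C" "closed C" and x: "x \<in> C" and line: "\<And>t::real. x + t *\<^sub>R v \<in> C"
  shows "v \<in> lineality_space C"
proof -
  have rec: "w \<in> recession_cone C" if w: "\<And>t::real. x + t *\<^sub>R w \<in> C" for w
    unfolding recession_cone_def
  proof (intro CollectI ballI allI impI)
    fix y and a :: real assume y: "y \<in> C"
    define p where "p k = (1 - 1 / real (Suc k)) *\<^sub>R y + (1 / real (Suc k)) *\<^sub>R (x + (a * real (Suc k)) *\<^sub>R w)" for k
    have eq: "p k = y + (1 / real (Suc k)) *\<^sub>R (x - y) + a *\<^sub>R w" for k
    proof -
      have "(1 / real (Suc k)) *\<^sub>R ((a * real (Suc k)) *\<^sub>R w) = a *\<^sub>R w" by simp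
      then show ?thesis unfolding p_def scaleR_add_right by (simp add: algebra_simps)
    qed
    have "p k \<in> C" for k
      unfolding p_def using C(1) y w by (intro convexD) auto
    moreover have "p \<longlonglongrightarrow> y + 0 *\<^sub>R (x - y) + a *\<^sub>R w"
      unfolding eq[abs_def] using LIMSEQ_inverse_real_of_nat
      by (intro tendsto_intros) (simp add: inverse_eq_divide)
    ultimately show "y + a *\<^sub>R w \<in> C" using C(2) closed_sequentially[of C p] by simp
  qed
  have "- v \<in> recession_cone C" using rec[of "- v"] line[of "- t" for t] by simp
  moreover have "v \<in> recession_cone C" using rec[of v] line by simp
  ultimately show ?thesis unfolding lineality_space_def by (force intro: image_eqI[of _ _ "- v"])
qed

text \<open>A minimal nonempty face of a polyhedron has no proper faces, hence it is affine.\<close>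

lemma polyhedron_extreme_point:
  fixes C :: "(real^'n) set"
  assumes C: "polyhedron C" "C \<noteq> {}" and lin: "lineality_space C = {0}"
  shows "\<exists>z. z extreme_point_of C"
proof -
  have "finite {F. F face_of C \<and> F \<noteq> {}}"
    by (rule finite_subset[OF _ finite_polyhedron_faces[OF C(1)]]) auto
  moreover have "C \<in> {F. F face_of C \<and> F \<noteq> {}}"
    using C by (simp add: face_of_refl polyhedron_imp_convex)
  ultimately obtain F where F: "F \<in> {F. F face_of C \<and> F \<noteq> {}}"
      "\<And>G. G \<in> {F. F face_of C \<and> F \<noteq> {}} \<Longrightarrow> G \<subseteq> F \<Longrightarrow> G = F"
    using finite_has_minimal[of "{F. F face_of C \<and> F \<noteq> {}}"] by (metis (no_types, lifting) empty_iff)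
  then have Ff: "F face_of C" "F \<noteq> {}" by auto
  have PF: "polyhedron F" using Ff(1) C(1) face_of_polyhedron_polyhedron by blast
  have "rel_frontier F = {}"
  proof -
    have "G = {}" if G: "G facet_of F" for G
    proof (rule ccontr)
      assume "G \<noteq> {}"
      moreover have "G face_of C" using G Ff(1) facet_of_imp_face_of face_of_trans by blast
      moreover have "G \<subseteq> F" using G facet_of_imp_subset by blast
      ultimately have "G = F" using F(2) by blast
      then show False using G by (simp add: facet_of_def)
    qed
    then show ?thesis using rel_frontier_of_polyhedron[OF PF] by auto
  qed
  then have aff: "affine F"
    using rel_frontier_eq_empty by auto
  obtain x where x: "x \<in> F" using Ff(2) by blast
  have FC: "F \<subseteq> C" using Ff(1) face_of_imp_subset by blast
  have "F = {x}"
  proof (rule ccontr)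
    assume "F \<noteq> {x}"
    then obtain y where y: "y \<in> F" "y \<noteq> x" using x by blast
    have "x + t *\<^sub>R (y - x) \<in> C" for t
    proof -
      have "(1 - t) *\<^sub>R x + t *\<^sub>R y \<in> F" using aff x y by (intro mem_affine) auto
      then show ?thesis using FC by (auto simp: algebra_simps)
    qed
    then have "y - x \<in> lineality_space C"
      using lineality_line[of C x "y - x"] C(1) x FC polyhedron_imp_convex polyhedron_imp_closed by blast
    then show False using lin y by simp
  qed
  then show ?thesis using Ff(1) face_of_singleton by blast
qed

lemma polyhedron_representation:
  fixes C :: "(real^'n) set"
  assumes "polyhedron C"
  shows "\<exists>P. represents P C"
proof -
  obtain H where H: "finite H" "C = \<Inter> H" "\<forall>h\<in>H. \<exists>a b. a \<noteq> 0 \<and> h = {x. a \<bullet> x \<le> b}"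
    using assms by (auto simp: polyhedron_def)
  then obtain a b where ab: "\<And>h. h \<in> H \<Longrightarrow> a h \<noteq> 0 \<and> h = {x. a h \<bullet> x \<le> b h}" by metis
  obtain hs where hs: "set hs = H" using finite_list[OF H(1)] by blast
  define P :: "'n rep" where "P = \<lparr>nrows = length hs, rowA = (\<lambda>i. a (hs ! i)), rhs = (\<lambda>i. b (hs ! i)),
    fac = (\<lambda>i. Nonpos), lbd = (\<lambda>j. - \<infinity>), ubd = (\<lambda>j. \<infinity>)\<rparr>"
  have "feasible_set P = C"
  proof (intro set_eqI)
    fix x
    have "x \<in> feasible_set P \<longleftrightarrow> (\<forall>i<length hs. a (hs ! i) \<bullet> x \<le> b (hs ! i))"
      by (simp add: feasible_set_def P_def)
    also have "\<dots> \<longleftrightarrow> (\<forall>h\<in>H. a h \<bullet> x \<le> b h)" unfolding hs[symmetric] by (simp add: all_set_conv_all_nth)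
    also have "\<dots> \<longleftrightarrow> x \<in> C" unfolding H(2) using ab by blast
    finally show "x \<in> feasible_set P \<longleftrightarrow> x \<in> C" .
  qed
  moreover have "rowA P i \<noteq> 0" if "i < nrows P" for i
  proof -
    have "hs ! i \<in> H" using that hs by (auto simp: P_def)
    then show ?thesis using ab by (simp add: P_def)
  qed
  ultimately show ?thesis unfolding represents_def by blast
qed

theorem lemma3p1:
  fixes C :: "(real^'n) set" and q :: "real^'n" and M :: "real^'n^'n"
  assumes "polyhedron C" and "C \<noteq> {}" and "lineality_space C = {0}"
    and "semimonotone M (recession_cone C)"
    and "\<And>z. z \<noteq> 0 \<Longrightarrow> z \<in> recession_cone C \<Longrightarrow> M *v z \<in> dual_cone (recession_cone C) \<Longrightarrow>
           z \<bullet> (M *v z) = 0 \<Longrightarrow> (\<forall>z'\<in>C. 0 \<le> z \<bullet> (M *v z' + q))"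
  shows "(\<forall>P. represents P C \<longrightarrow> pathavi_solves P q M) \<and> (\<exists>z. avi_solution C q M z)"
proof -
  obtain z0 where z0: "z0 extreme_point_of C" using polyhedron_extreme_point assms(1-3) by blast
  have main: "pathavi_solves P q M" if "represents P C" for P
  proof -
    have C: "C = feasible_set P" using that by (simp add: represents_def)
    interpret feasible_rep P using assms(2) C by unfold_locales simp
    show ?thesis
      unfolding pathavi_solves_def
    proof (intro conjI allI impI)
      show "\<exists>z. z extreme_point_of feasible_set P" using z0 C by blast
    next
      fix zbar r assume "zbar extreme_point_of feasible_set P \<and> r \<in> rel_interior (normal_cone (feasible_set P) zbar)"
      then have ext: "zbar extreme_point_of feasible_set P"
        and r: "r \<in> interior (normal_cone (feasible_set P) zbar)"
        using extreme_rel_interior by auto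
      show "\<exists>ord s. start P M q zbar r ord s" using start_exists[OF ext r] .
      fix ord s assume st: "start P M q zbar r ord s"
      interpret pathavi_run P M q zbar r ord s
        using st extreme_feasible[OF ext] r assms(3-5) C by unfold_locales auto
      show "\<not> (\<exists>f. f 0 = s \<and> (\<forall>k::nat. pivot P M r ord (f k) (f (Suc k))))" by (rule run_finite)
      fix s' assume "(pivot P M r ord)\<^sup>*\<^sup>* s s' \<and> (\<nexists>s''. pivot P M r ord s' s'')"
      then show "stops_at_solution P M q s'" using run_stops by blast
    qed
  qed
  have "\<exists>z. avi_solution C q M z"
  proof -
    obtain P where P: "represents P C" using polyhedron_representation assms(1) by blast
    have C: "C = feasible_set P" using P by (simp add: represents_def)
    have solves: "pathavi_solves P q M" using main[OF P] .
    \<comment> \<open>A nonempty convex set has nonempty relative interior, so an admissible r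
      exists; the existence of a solution is then read off from a run of the method.\<close>
    have "convex (normal_cone C z0)"
      unfolding normal_cone_def convex_def by (auto simp: inner_add_left intro!: add_nonpos_nonpos mult_nonneg_nonpos)
    moreover have "0 \<in> normal_cone C z0" by (simp add: normal_cone_def)
    ultimately obtain r where r: "r \<in> rel_interior (normal_cone C z0)"
      using rel_interior_eq_empty by blast
    have zr: "z0 extreme_point_of feasible_set P \<and> r \<in> rel_interior (normal_cone (feasible_set P) z0)"
      using z0 r by (simp add: C[symmetric])
    have run: "(\<exists>ord s. start P M q z0 r ord s) \<and> (\<forall>ord s. start P M q z0 r ord s \<longrightarrow>
        \<not> (\<exists>f. f 0 = s \<and> (\<forall>k::nat. pivot P M r ord (f k) (f (Suc k)))) \<and>
        (\<forall>s'. (pivot P M r ord)\<^sup>*\<^sup>* s s' \<and> (\<nexists>s''. pivot P M r ord s' s'') \<longrightarrow> stops_at_solution P M q s'))"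
      by (rule solves[unfolded pathavi_solves_def, THEN conjunct2, THEN spec, THEN spec, THEN mp, OF zr])
    then obtain ord s where st: "start P M q z0 r ord s" by blast
    define R where "R = pivot P M r ord"
    have fin: "\<not> (\<exists>f. f 0 = s \<and> (\<forall>k::nat. R (f k) (f (Suc k))))"
      and stop: "\<And>s'. R\<^sup>*\<^sup>* s s' \<Longrightarrow> \<nexists>s''. R s' s'' \<Longrightarrow> stops_at_solution P M q s'"
      using run st unfolding R_def by blast+
    \<comment> \<open>If every reachable state had a successor, dependent choice would build an
      infinite run.\<close>
    have "\<exists>s'. R\<^sup>*\<^sup>* s s' \<and> (\<nexists>s''. R s' s'')"
    proof (rule ccontr)
      assume "\<not> ?thesis"
      then have more: "\<exists>s''. R s' s''" if "R\<^sup>*\<^sup>* s s'" for s' using that by blast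
      have "\<exists>f. \<forall>k. (R\<^sup>*\<^sup>* s (f k) \<and> (k = 0 \<longrightarrow> f k = s)) \<and> R (f k) (f (Suc k))"
      proof (rule dependent_nat_choice)
        fix s' k assume "R\<^sup>*\<^sup>* s s' \<and> (k = (0::nat) \<longrightarrow> s' = s)"
        then obtain s'' where "R s' s''" "R\<^sup>*\<^sup>* s s''"
          using more by (meson rtranclp.rtrancl_into_rtrancl)
        then show "\<exists>s''. (R\<^sup>*\<^sup>* s s'' \<and> (Suc k = 0 \<longrightarrow> s'' = s)) \<and> R s' s''" by auto
      qed auto
      then show False using fin by blast
    qed
    then show ?thesis using stop unfolding stops_at_solution_def C by (auto simp: Let_def)
  qed
  then show ?thesis using main by blast
qed

end
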